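(* Let $\mathcal H$ be a complex separable Hilbert space. Assume: (i) $A_-\in\mathcal B(\mathcal H)$ is self-adjoint; (ii) $\{B(t)\}_{t\in\mathbb R}$ is a family of bounded self-adjoint operators in $\mathcal H$, weakly locally absolutely continuous on $\mathbb R$, with a family of bounded self-adjoint operators $\{B'(t)\}_{t\in\mathbb R}$ such that for a.e. $t\in\mathbb R$, $\frac{d}{dt}(g,B(t)h)_{\mathcal H}=(g,B'(t)h)_{\mathcal H}$ for $g,h\in\mathcal H$; (iii) $B'(t)\in\mathcal B_1(\mathcal H)$, $t\in\mathbb R$, and $\int_{\mathbb R}dt\,\|B'(t)\|_{\mathcal B_1(\mathcal H)}<\infty$; and the normalization $\lim_{t\to-\infty}B(t)=0$ in $\mathcal B_1(\mathcal H)$-norm. Let $A(t)=A_-+B(t)$, $t\in\mathbb R$, and $A_+=\lim_{t\to\infty}A(t)$ (norm limit), and let $\boldsymbol D_{\boldsymbol A}=\frac{d}{dt}+\boldsymbol A$ in $L^2(\mathbb R;\mathcal H)$ with $\operatorname{dom}(\boldsymbol D_{\boldsymbol A})=W^{1,2}(\mathbb R;\mathcal H)$. Then $\boldsymbol D_{\boldsymbol A}$ is Fredholm if and only if $0\in\rho(A_+)\cap\rho(A_-)$. More precisely, if $0\in\sigma(A_+)$ (or $0\in\sigma(A_-)$), then $\boldsymbol D_{\boldsymbol A}$ is neither upper-semi-Fredholm nor lower-semi-Fredholm.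
   Context: $\mathcal B_1$ is the trace class; $\rho$, $\sigma$ denote resolvent set and spectrum. A family $\{B(t)\}$ of bounded self-adjoint operators is weakly locally absolutely continuous if $t\mapsto(g,B(t)h)_{\mathcal H}$ is locally absolutely continuous for all $g,h\in\mathcal H$. Under the hypotheses the norm limit $A_+$ exists and is bounded and self-adjoint, and $\sup_t\|A(t)\|_{\mathcal B(\mathcal H)}<\infty$. $\boldsymbol A$ is the bounded operator $(\boldsymbol Af)(t)=A(t)f(t)$ for a.e. $t$, $f\in L^2(\mathbb R;\mathcal H)$. $W^{1,2}(\mathbb R;\mathcal H)$ is the set of locally absolutely continuous $g\in L^2(\mathbb R;\mathcal H)$ (i.e. $g(t)=g(t_0)+\int_{t_0}^t h(s)\,ds$ with $h\in L^1_{\rm loc}(\mathbb R;\mathcal H)$, $g'=h$ a.e.) with $g'\in L^2(\mathbb R;\mathcal H)$, and $(\frac{d}{dt}g)(t)=g'(t)$. The operator $\boldsymbol D_{\boldsymbol A}$ is densely defined and closed. A densely defined closed operator $T$ in a Hilbert space is: upper-semi-Fredholm if $\operatorname{ran}(T)$ is closed and $\dim\ker(T)<\infty$; lower-semi-Fredholm if $\operatorname{ran}(T)$ is closed and $\dim\ker(T^* )<\infty$; Fredholm if $\operatorname{ran}(T)$ is closed and $\dim\ker(T)+\dim\ker(T^* )<\infty$. *)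

theory Defs
  imports "HOL-Analysis.Analysis"
begin

section \<open>Complex Hilbert spaces\<close>

text \<open>
  The underlying real structure is the one of \<^class>\<open>real_inner\<close>, with the real inner product
  being the real part of the complex one. The complex inner product is antilinear in the first
  and linear in the second argument. A separable complex Hilbert space is a type of sort
  \<open>{chilbert_space, second_countable_topology}\<close>.
\<close>

class complex_inner = real_inner +
  fixes scaleC :: "complex \<Rightarrow> 'a \<Rightarrow> 'a" (infixr "*\<^sub>C" 75)
    and cinner :: "'a \<Rightarrow> 'a \<Rightarrow> complex"
  assumes scaleC_add_right: "c *\<^sub>C (x + y) = c *\<^sub>C x + c *\<^sub>C y"
    and scaleC_add_left: "(c + d) *\<^sub>C x = c *\<^sub>C x + d *\<^sub>C x"
    and scaleC_scaleC: "c *\<^sub>C (d *\<^sub>C x) = (c * d) *\<^sub>C x"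
    and scaleC_of_real: "complex_of_real r *\<^sub>C x = r *\<^sub>R x"
    and cinner_commute: "cinner x y = cnj (cinner y x)"
    and cinner_add_right: "cinner x (y + z) = cinner x y + cinner x z"
    and cinner_scaleC_right: "cinner x (c *\<^sub>C y) = c * cinner x y"
    and Re_cinner: "Re (cinner x y) = inner x y"

class chilbert_space = complex_inner + complete_space

subclass (in chilbert_space) banach ..

lemma scaleC_one [simp]: "1 *\<^sub>C (x :: 'a::complex_inner) = x"
  using scaleC_of_real[of 1 x] by simp

global_interpretation cvec: vector_space "scaleC :: complex \<Rightarrow> 'a \<Rightarrow> 'a::complex_inner"
  defines cspan = cvec.span and csubspace = cvec.subspace
  by unfold_locales
    (simp_all add: scaleC_add_right scaleC_add_left scaleC_scaleC)

lemma cinner_eq_inner: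
  "cinner (x :: 'a::complex_inner) y = Complex (inner x y) (inner x ((- \<i>) *\<^sub>C y))"
  using cinner_scaleC_right[of x "- \<i>" y] by (simp add: complex_eq_iff flip: Re_cinner)

lemma cinner_add_left: "cinner (x + y) (z :: 'a::complex_inner) = cinner x z + cinner y z"
  by (subst (1 2 3) cinner_commute) (simp add: cinner_add_right)

lemma cinner_scaleC_left: "cinner (c *\<^sub>C x) (y :: 'a::complex_inner) = cnj c * cinner x y"
  by (subst (1 2) cinner_commute) (simp add: cinner_scaleC_right)

lemma norm_scaleC: "norm (c *\<^sub>C (x :: 'a::complex_inner)) = cmod c * norm x"
proof -
  have "cinner (c *\<^sub>C x) (c *\<^sub>C x) = of_real ((cmod c)\<^sup>2) * cinner x x"
    by (simp add: cinner_scaleC_left cinner_scaleC_right complex_norm_square[symmetric] mult.assoc[symmetric] mult.commute)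
  hence "inner (c *\<^sub>C x) (c *\<^sub>C x) = (cmod c)\<^sup>2 * inner x x"
    by (simp flip: Re_cinner)
  thus ?thesis
    by (simp add: norm_eq_sqrt_inner real_sqrt_mult)
qed

lemma bounded_linear_scaleC: "bounded_linear (\<lambda>x :: 'a::complex_inner. c *\<^sub>C x)"
proof (rule bounded_linear_intro)
  show "c *\<^sub>C (r *\<^sub>R x) = r *\<^sub>R (c *\<^sub>C x)" for r and x :: 'a
    by (simp add: scaleC_scaleC mult.commute flip: scaleC_of_real)
  show "norm (c *\<^sub>C x) \<le> norm x * cmod c" for x :: 'a
    by (simp add: norm_scaleC mult.commute)
qed (simp add: scaleC_add_right)

lemma measurable_scaleC [measurable]:
  "(\<lambda>x :: 'a::complex_inner. c *\<^sub>C x) \<in> borel \<rightarrow>\<^sub>M borel"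
  using bounded_linear_scaleC[THEN bounded_linear.continuous_on, OF continuous_on_id]
  by (rule borel_measurable_continuous_onI)

definition orthonormal_basis :: "'a::complex_inner set \<Rightarrow> bool" where
  "orthonormal_basis E \<longleftrightarrow>
     (\<forall>e\<in>E. \<forall>f\<in>E. cinner e f = (if e = f then 1 else 0)) \<and> closure (cspan E) = UNIV"

section \<open>Bounded operators\<close>

text \<open>
  The Banach space of bounded complex linear operators is the complex linear part of the space
  of bounded real linear operators; the operator norms agree.
\<close>

definition clinear_op :: "('a::complex_inner \<Rightarrow>\<^sub>L 'a) \<Rightarrow> bool" where
  "clinear_op T \<longleftrightarrow> (\<forall>c x. T (c *\<^sub>C x) = c *\<^sub>C T x)"

definition selfadjoint_op :: "('a::complex_inner \<Rightarrow>\<^sub>L 'a) \<Rightarrow> bool" where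
  "selfadjoint_op T \<longleftrightarrow> clinear_op T \<and> (\<forall>x y. cinner x (T y) = cinner (T x) y)"

definition positive_op :: "('a::complex_inner \<Rightarrow>\<^sub>L 'a) \<Rightarrow> bool" where
  "positive_op T \<longleftrightarrow> selfadjoint_op T \<and> (\<forall>x. 0 \<le> Re (cinner x (T x)))"

definition resolvent_set :: "('a::complex_inner \<Rightarrow>\<^sub>L 'a) \<Rightarrow> complex set" where
  "resolvent_set T = {z. \<exists>R. clinear_op R \<and>
     (\<forall>x. R (T x - z *\<^sub>C x) = x) \<and> (\<forall>x. T (R x) - z *\<^sub>C R x = x)}"

definition spectrum :: "('a::complex_inner \<Rightarrow>\<^sub>L 'a) \<Rightarrow> complex set" where
  "spectrum T = - resolvent_set T"

definition is_adjoint_op :: "('a::complex_inner \<Rightarrow>\<^sub>L 'a) \<Rightarrow> ('a \<Rightarrow>\<^sub>L 'a) \<Rightarrow> bool" where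
  "is_adjoint_op S T \<longleftrightarrow> (\<forall>x y. cinner (S x) y = cinner x (T y))"

text \<open>\<open>P = |T| = (T\<^sup>* T)\<^sup>1\<^sup>/\<^sup>2\<close>, the unique positive square root.\<close>

definition is_abs_op :: "('a::complex_inner \<Rightarrow>\<^sub>L 'a) \<Rightarrow> ('a \<Rightarrow>\<^sub>L 'a) \<Rightarrow> bool" where
  "is_abs_op P T \<longleftrightarrow> positive_op P \<and> (\<exists>S. is_adjoint_op S T \<and> P o\<^sub>L P = S o\<^sub>L T)"

text \<open>
  The trace norm is the trace of \<open>|T|\<close>, i.e. the sum of \<open>(e, |T| e)\<close> over an orthonormal basis,
  which does not depend on the basis.
\<close>

definition has_trace_norm :: "('a::complex_inner \<Rightarrow>\<^sub>L 'a) \<Rightarrow> real \<Rightarrow> bool" where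
  "has_trace_norm T s \<longleftrightarrow> (\<exists>P. is_abs_op P T \<and>
     (\<forall>E. orthonormal_basis E \<longrightarrow> ((\<lambda>e. Re (cinner e (P e))) has_sum s) E))"

definition trace_class :: "('a::complex_inner \<Rightarrow>\<^sub>L 'a) \<Rightarrow> bool" where
  "trace_class T \<longleftrightarrow> clinear_op T \<and> (\<exists>s. has_trace_norm T s)"

definition trace_norm :: "('a::complex_inner \<Rightarrow>\<^sub>L 'a) \<Rightarrow> real" where
  "trace_norm T = (THE s. has_trace_norm T s)"

section \<open>Unbounded operators\<close>

text \<open>An operator \<open>T\<close> is represented by its graph, so that \<^term>\<open>Domain T\<close> and \<^term>\<open>Range T\<close>
  are its domain and range.\<close>

definition op_ker :: "('a::complex_inner \<times> 'a) set \<Rightarrow> 'a set" where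
  "op_ker T = {x. (x, 0) \<in> T}"

definition op_adjoint :: "('a::complex_inner \<times> 'a) set \<Rightarrow> ('a \<times> 'a) set" where
  "op_adjoint T = {(y, z). \<forall>(x, w)\<in>T. cinner y w = cinner z x}"

definition finite_dim :: "'a::complex_inner set \<Rightarrow> bool" where
  "finite_dim V \<longleftrightarrow> (\<exists>B. finite B \<and> V \<subseteq> cspan B)"

text \<open>
  The following three notions are meant for densely defined closed operators; these standing
  requirements are not repeated in the definitions.
\<close>

definition upper_semi_Fredholm :: "('a::chilbert_space \<times> 'a) set \<Rightarrow> bool" where
  "upper_semi_Fredholm T \<longleftrightarrow> closed (Range T) \<and> finite_dim (op_ker T)"

definition lower_semi_Fredholm :: "('a::chilbert_space \<times> 'a) set \<Rightarrow> bool" where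
  "lower_semi_Fredholm T \<longleftrightarrow> closed (Range T) \<and> finite_dim (op_ker (op_adjoint T))"

definition Fredholm :: "('a::chilbert_space \<times> 'a) set \<Rightarrow> bool" where
  "Fredholm T \<longleftrightarrow>
     closed (Range T) \<and> finite_dim (op_ker T) \<and> finite_dim (op_ker (op_adjoint T))"

section \<open>The Hilbert space of square integrable functions on the real line\<close>

definition sq_integrable ::
    "(real \<Rightarrow> 'h::{chilbert_space, second_countable_topology}) \<Rightarrow> bool" where
  "sq_integrable f \<longleftrightarrow> f \<in> borel_measurable lborel \<and> integrable lborel (\<lambda>t. (norm (f t))\<^sup>2)"

lemma sq_integrable_measurable [measurable_dest]:
  "sq_integrable f \<Longrightarrow> f \<in> borel_measurable lborel"
  by (simp add: sq_integrable_def)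

lemma sq_integrable_0 [simp]: "sq_integrable (\<lambda>_. 0)"
  by (simp add: sq_integrable_def)

lemma norm_add_sq_le:
  "(norm (x + y :: 'a::real_inner))\<^sup>2 \<le> 2 * (norm x)\<^sup>2 + 2 * (norm y)\<^sup>2"
proof -
  have "0 \<le> (norm (x - y))\<^sup>2" by simp
  thus ?thesis
    by (simp add: power2_norm_eq_inner inner_diff_left inner_diff_right inner_add_left
        inner_add_right inner_commute)
qed

lemma sq_integrable_add:
  assumes "sq_integrable f" "sq_integrable g"
  shows "sq_integrable (\<lambda>t. f t + g t)"
proof -
  note [measurable] = assms[THEN sq_integrable_measurable]
  have "integrable lborel (\<lambda>t. (norm (f t + g t))\<^sup>2)"
  proof (rule Bochner_Integration.integrable_bound)
    show "integrable lborel (\<lambda>t. 2 * (norm (f t))\<^sup>2 + 2 * (norm (g t))\<^sup>2)"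
      using assms by (auto simp: sq_integrable_def)
    show "AE t in lborel. norm ((norm (f t + g t))\<^sup>2)
        \<le> norm (2 * (norm (f t))\<^sup>2 + 2 * (norm (g t))\<^sup>2)"
      using norm_add_sq_le[of "f t" "g t" for t] by (auto intro!: AE_I2 simp del: norm_power)
  qed measurable
  thus ?thesis by (simp add: sq_integrable_def)
qed

lemma sq_integrable_scaleC: "sq_integrable f \<Longrightarrow> sq_integrable (\<lambda>t. c *\<^sub>C f t)"
  unfolding sq_integrable_def
  by (auto simp: norm_scaleC power_mult_distrib intro: measurable_compose[OF _ measurable_scaleC])

lemma sq_integrable_scaleR: "sq_integrable f \<Longrightarrow> sq_integrable (\<lambda>t. r *\<^sub>R f t)"
  using sq_integrable_scaleC[of f "of_real r"] by (simp add: scaleC_of_real)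

lemma sq_integrable_minus: "sq_integrable f \<Longrightarrow> sq_integrable (\<lambda>t. - f t)"
  by (simp add: sq_integrable_def)

lemma sq_integrable_diff:
  "sq_integrable f \<Longrightarrow> sq_integrable g \<Longrightarrow> sq_integrable (\<lambda>t. f t - g t)"
  using sq_integrable_add[of f "\<lambda>t. - g t"] by (simp add: sq_integrable_minus)

lemma sq_integrable_inner:
  assumes "sq_integrable f" "sq_integrable g"
  shows "integrable lborel (\<lambda>t. inner (f t) (g t))"
proof (rule Bochner_Integration.integrable_bound)
  note [measurable] = assms[THEN sq_integrable_measurable]
  show "integrable lborel (\<lambda>t. (norm (f t))\<^sup>2 + (norm (g t))\<^sup>2)"
    using assms by (auto simp: sq_integrable_def)
  have "\<bar>inner (f t) (g t)\<bar> \<le> (norm (f t))\<^sup>2 + (norm (g t))\<^sup>2" for t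
  proof -
    have "2 * (norm (f t) * norm (g t)) \<le> (norm (f t))\<^sup>2 + (norm (g t))\<^sup>2"
      using sum_squares_bound[of "norm (f t)" "norm (g t)"] by simp
    moreover have "0 \<le> norm (f t) * norm (g t)" by simp
    moreover note Cauchy_Schwarz_ineq2[of "f t" "g t"]
    ultimately show ?thesis by linarith
  qed
  thus "AE t in lborel. norm (inner (f t) (g t)) \<le> norm ((norm (f t))\<^sup>2 + (norm (g t))\<^sup>2)"
    by (auto intro!: AE_I2 simp del: norm_power)
  show "(\<lambda>t. inner (f t) (g t)) \<in> borel_measurable lborel" by measurable
qed

lemma complex_eq_ReIm: "Complex a b = of_real a + of_real b * \<i>"
  by (simp add: complex_eq_iff)

lemma sq_integrable_cinner:
  assumes "sq_integrable f" "sq_integrable g"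
  shows "integrable lborel (\<lambda>t. cinner (f t) (g t))"
  unfolding cinner_eq_inner complex_eq_ReIm
  by (intro Bochner_Integration.integrable_add integrable_mult_left integrable_of_real
      sq_integrable_inner sq_integrable_scaleC assms)

definition l2rel :: "(real \<Rightarrow> 'h::{chilbert_space, second_countable_topology}) \<Rightarrow>
    (real \<Rightarrow> 'h) \<Rightarrow> bool" where
  "l2rel f g \<longleftrightarrow> sq_integrable f \<and> sq_integrable g \<and> (AE t in lborel. f t = g t)"

lemma part_equivp_l2rel: "part_equivp l2rel"
proof (rule part_equivpI)
  show "\<exists>f :: real \<Rightarrow> 'a. l2rel f f"
    by (rule exI[of _ "\<lambda>_. 0"]) (simp add: l2rel_def)
  show "symp (l2rel :: (real \<Rightarrow> 'a) \<Rightarrow> _)"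
    by (auto simp: symp_def l2rel_def)
  show "transp (l2rel :: (real \<Rightarrow> 'a) \<Rightarrow> _)"
    unfolding transp_def l2rel_def by (auto elim: AE_mp)
qed

quotient_type (overloaded) 'h l2 =
    "real \<Rightarrow> 'h::{chilbert_space, second_countable_topology}" / partial: l2rel
  by (rule part_equivp_l2rel)

instantiation l2 :: ("{chilbert_space, second_countable_topology}") complex_inner
begin

lift_definition zero_l2 :: "'a l2" is "\<lambda>_. 0"
  by (simp add: l2rel_def)

lift_definition plus_l2 :: "'a l2 \<Rightarrow> 'a l2 \<Rightarrow> 'a l2" is "\<lambda>f g t. f t + g t"
  by (auto simp: l2rel_def sq_integrable_add)

lift_definition minus_l2 :: "'a l2 \<Rightarrow> 'a l2 \<Rightarrow> 'a l2" is "\<lambda>f g t. f t - g t"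
  by (auto simp: l2rel_def sq_integrable_diff)

lift_definition uminus_l2 :: "'a l2 \<Rightarrow> 'a l2" is "\<lambda>f t. - f t"
  by (auto simp: l2rel_def sq_integrable_minus)

lift_definition scaleR_l2 :: "real \<Rightarrow> 'a l2 \<Rightarrow> 'a l2" is "\<lambda>r f t. r *\<^sub>R f t"
  by (auto simp: l2rel_def sq_integrable_scaleR)

lift_definition scaleC_l2 :: "complex \<Rightarrow> 'a l2 \<Rightarrow> 'a l2" is "\<lambda>c f t. c *\<^sub>C f t"
  by (auto simp: l2rel_def sq_integrable_scaleC)

lift_definition cinner_l2 :: "'a l2 \<Rightarrow> 'a l2 \<Rightarrow> complex" is
  "\<lambda>f g. \<integral>t. cinner (f t) (g t) \<partial>lborel"
  unfolding l2rel_def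
  by (rule integral_cong_AE; (intro borel_measurable_integrable sq_integrable_cinner)?) auto

lift_definition inner_l2 :: "'a l2 \<Rightarrow> 'a l2 \<Rightarrow> real" is
  "\<lambda>f g. \<integral>t. inner (f t) (g t) \<partial>lborel"
  unfolding l2rel_def
  by (rule integral_cong_AE; (intro borel_measurable_integrable sq_integrable_inner)?) auto

definition norm_l2 :: "'a l2 \<Rightarrow> real" where "norm_l2 f = sqrt (inner f f)"
definition dist_l2 :: "'a l2 \<Rightarrow> 'a l2 \<Rightarrow> real" where "dist_l2 f g = norm (f - g)"
definition sgn_l2 :: "'a l2 \<Rightarrow> 'a l2" where "sgn_l2 f = inverse (norm f) *\<^sub>R f"
definition uniformity_l2 :: "('a l2 \<times> 'a l2) filter" where
  "uniformity_l2 = (INF e\<in>{0<..}. principal {(f, g). dist f g < e})"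
definition open_l2 :: "'a l2 set \<Rightarrow> bool" where
  "open_l2 U \<longleftrightarrow> (\<forall>f\<in>U. eventually (\<lambda>(f', g). f' = f \<longrightarrow> g \<in> U) uniformity)"

instance
proof
  fix f g h :: "'a l2" and r s :: real and c d :: complex
  show "f + g + h = f + (g + h)"
    by transfer (auto simp: l2rel_def algebra_simps intro!: sq_integrable_add)
  show "f + g = g + f"
    by transfer (auto simp: l2rel_def algebra_simps intro!: sq_integrable_add)
  show "0 + f = f"
    by transfer (auto simp: l2rel_def)
  show "- f + f = 0"
    by transfer (auto simp: l2rel_def)
  show "f - g = f + - g"
    by transfer (auto simp: l2rel_def intro!: sq_integrable_diff)
  show "r *\<^sub>R (f + g) = r *\<^sub>R f + r *\<^sub>R g"
    by transfer (auto simp: l2rel_def scaleR_add_right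
        intro!: sq_integrable_add sq_integrable_scaleR)
  show "(r + s) *\<^sub>R f = r *\<^sub>R f + s *\<^sub>R f"
    by transfer (auto simp: l2rel_def scaleR_add_left
        intro!: sq_integrable_add sq_integrable_scaleR)
  show "r *\<^sub>R s *\<^sub>R f = (r * s) *\<^sub>R f"
    by transfer (auto simp: l2rel_def intro!: sq_integrable_scaleR)
  show "1 *\<^sub>R f = f"
    by transfer (auto simp: l2rel_def)
  show "sgn f = inverse (norm f) *\<^sub>R f" by (rule sgn_l2_def)
  show "dist f g = norm (f - g)" by (rule dist_l2_def)
  show "uniformity = (INF e\<in>{0<..}. principal {(f :: 'a l2, g). dist f g < e})"
    by (rule uniformity_l2_def)
  show "open U \<longleftrightarrow> (\<forall>f\<in>U. eventually (\<lambda>(f', g). f' = f \<longrightarrow> g \<in> U) uniformity)"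
    for U :: "'a l2 set" by (rule open_l2_def)
  show "inner f g = inner g f"
    by transfer (simp add: inner_commute)
  show "inner (f + g) h = inner f h + inner g h"
    by transfer (simp add: l2rel_def inner_add_left sq_integrable_inner)
  show "inner (r *\<^sub>R f) g = r * inner f g"
    by transfer simp
  show "0 \<le> inner f f"
    by transfer simp
  show "inner f f = 0 \<longleftrightarrow> f = 0"
    by transfer
      (auto simp: l2rel_def integral_nonneg_eq_0_iff_AE sq_integrable_inner)
  show "norm f = sqrt (inner f f)" by (rule norm_l2_def)
  show "c *\<^sub>C (f + g) = c *\<^sub>C f + c *\<^sub>C g"
    by transfer (auto simp: l2rel_def scaleC_add_right
        intro!: sq_integrable_add sq_integrable_scaleC)
  show "(c + d) *\<^sub>C f = c *\<^sub>C f + d *\<^sub>C f"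
    by transfer (auto simp: l2rel_def scaleC_add_left
        intro!: sq_integrable_add sq_integrable_scaleC)
  show "c *\<^sub>C d *\<^sub>C f = (c * d) *\<^sub>C f"
    by transfer (auto simp: l2rel_def scaleC_scaleC intro!: sq_integrable_scaleC)
  show "complex_of_real r *\<^sub>C f = r *\<^sub>R f"
    by transfer (auto simp: l2rel_def scaleC_of_real intro!: sq_integrable_scaleR)
  show "cinner f g = cnj (cinner g f)"
    by transfer (rule trans[OF Bochner_Integration.integral_cong[OF refl cinner_commute] Bochner_Integration.integral_cnj])
  show "cinner f (g + h) = cinner f g + cinner f h"
    by transfer (simp add: l2rel_def cinner_add_right sq_integrable_cinner)
  show "cinner f (c *\<^sub>C g) = c * cinner f g"
    by transfer (simp add: cinner_scaleC_right)
  show "Re (cinner f g) = inner f g"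
    by transfer (simp add: l2rel_def sq_integrable_cinner Re_cinner flip: integral_Re)
qed

end

lemma sq_integrable_rep_l2: "sq_integrable (rep_l2 f)"
  using Quotient3_rep_reflp[OF Quotient3_l2] by (simp add: l2rel_def)

lemma abs_rep_l2 [simp]: "abs_l2 (rep_l2 f) = f"
  by (rule Quotient3_abs_rep[OF Quotient3_l2])

lemma norm_abs_l2:
  assumes "sq_integrable f"
  shows "(norm (abs_l2 f))\<^sup>2 = (\<integral>t. (norm (f t))\<^sup>2 \<partial>lborel)"
  using assms
  by (simp add: power2_norm_eq_inner inner_l2.abs_eq l2rel_def)

lemma diff_abs_l2:
  assumes "sq_integrable f" "sq_integrable g"
  shows "abs_l2 f - abs_l2 g = abs_l2 (\<lambda>t. f t - g t)"
  using assms by (intro minus_l2.abs_eq) (simp_all add: l2rel_def)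

lemma half_power_sq: "((1/2)^n)\<^sup>2 = ((1/4)^n :: real)"
proof -
  have "((1/2)^n)\<^sup>2 = (((1/2)\<^sup>2)^n :: real)"
    by (metis power_mult mult.commute)
  thus ?thesis by (simp add: power2_eq_square)
qed

instance l2 :: ("{chilbert_space, second_countable_topology}") chilbert_space
proof
  fix X :: "nat \<Rightarrow> 'a l2"
  assume "Cauchy X"
  hence "\<exists>N. \<forall>m\<ge>N. \<forall>n\<ge>N. norm (X m - X n) < (1/2)^k" for k
    unfolding Cauchy_def dist_norm by simp
  then obtain N where N: "\<And>k m n. m \<ge> N k \<Longrightarrow> n \<ge> N k \<Longrightarrow> norm (X m - X n) < (1/2)^k"
    by metis
  define r where "r k = (\<Sum>i\<le>k. N i + 1)" for k
  have r: "strict_mono r"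
    by (rule strict_mono_Suc_iff[THEN iffD2]) (simp add: r_def)
  have rN: "N k \<le> r m" if "k \<le> m" for k m
  proof -
    have "N k + 1 \<le> (\<Sum>i\<le>m. N i + 1)"
      by (rule member_le_sum) (use that in auto)
    thus ?thesis by (simp add: r_def)
  qed
  define f where "f k = rep_l2 (X (r k))" for k
  have f: "sq_integrable (f k)" for k
    by (simp add: f_def sq_integrable_rep_l2)
  note [measurable] = f[THEN sq_integrable_measurable]
  have Xf: "X (r k) = abs_l2 (f k)" for k
    by (simp add: f_def)
  have nn_diff: "(\<integral>\<^sup>+t. ennreal ((norm (f m t - f n t))\<^sup>2) \<partial>lborel) \<le> ennreal ((1/4)^n)"
    if "n \<le> m" for m n
  proof -
    have sq: "sq_integrable (\<lambda>t. f m t - f n t)"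
      by (intro sq_integrable_diff f)
    have "(\<integral>\<^sup>+t. ennreal ((norm (f m t - f n t))\<^sup>2) \<partial>lborel)
        = ennreal (\<integral>t. (norm (f m t - f n t))\<^sup>2 \<partial>lborel)"
      using sq by (intro nn_integral_eq_integral) (auto simp: sq_integrable_def)
    also have "(\<integral>t. (norm (f m t - f n t))\<^sup>2 \<partial>lborel) = (norm (X (r m) - X (r n)))\<^sup>2"
      by (simp add: Xf diff_abs_l2 f norm_abs_l2[OF sq])
    also have "\<dots> \<le> ((1/2)^n)\<^sup>2"
      using N[of n "r m" "r n"] rN[of n m] rN[of n n] that by (intro power_mono) auto
    also have "((1/2)^n)\<^sup>2 = ((1/4)^n :: real)"
      by (rule half_power_sq)
    finally show ?thesis by (simp add: ennreal_leI)
  qed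
  define d where "d k t = f (Suc k) t - f k t" for k t
  have [measurable]: "d k \<in> borel_measurable lborel" for k
    unfolding d_def by measurable
  have "(\<integral>\<^sup>+t. (\<Sum>k. ennreal (2^k * (norm (d k t))\<^sup>2)) \<partial>lborel)
      = (\<Sum>k. \<integral>\<^sup>+t. ennreal (2^k * (norm (d k t))\<^sup>2) \<partial>lborel)"
    by (rule nn_integral_suminf) measurable
  also have "\<dots> \<le> (\<Sum>k. ennreal ((1/2)^k))"
  proof (intro suminf_le allI)
    fix k
    have "(\<integral>\<^sup>+t. ennreal (2^k * (norm (d k t))\<^sup>2) \<partial>lborel)
        = ennreal (2^k) * (\<integral>\<^sup>+t. ennreal ((norm (d k t))\<^sup>2) \<partial>lborel)"
      by (subst nn_integral_cmult[symmetric]) (auto intro!: nn_integral_cong simp: ennreal_mult)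
    also have "\<dots> \<le> ennreal (2^k) * ennreal ((1/4)^k)"
      unfolding d_def by (intro mult_left_mono nn_diff) auto
    also have "\<dots> = ennreal (2^k * (1/4)^k)"
      by (rule ennreal_mult[symmetric]) auto
    also have "2^k * (1/4)^k = ((1/2)^k :: real)"
      by (subst power_mult_distrib[symmetric]) simp
    finally show "(\<integral>\<^sup>+t. ennreal (2^k * (norm (d k t))\<^sup>2) \<partial>lborel) \<le> ennreal ((1/2)^k)" .
  qed auto
  also have "\<dots> = ennreal (\<Sum>k. (1/2)^k)"
    by (rule suminf_ennreal2) (auto intro: summable_geometric)
  finally have fin: "(\<integral>\<^sup>+t. (\<Sum>k. ennreal (2^k * (norm (d k t))\<^sup>2)) \<partial>lborel) \<noteq> \<infinity>"
    by (auto simp: top_unique)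
  have "AE t in lborel. (\<Sum>k. ennreal (2^k * (norm (d k t))\<^sup>2)) \<noteq> \<infinity>"
    by (rule nn_integral_PInf_AE[OF _ fin]) measurable
  hence conv: "AE t in lborel. (\<lambda>n. f n t) \<longlonglongrightarrow> lim (\<lambda>n. f n t)"
  proof eventually_elim
    case (elim t)
    have "summable (\<lambda>k. 2^k * (norm (d k t))\<^sup>2)"
      by (rule summable_suminf_not_top) (use elim in auto)
    moreover have "summable (\<lambda>k. (1/2 :: real)^k)"
      by (rule summable_geometric) simp
    ultimately have "summable (\<lambda>k. 2^k * (norm (d k t))\<^sup>2 + (1/2)^k)"
      by (rule summable_add)
    hence "summable (\<lambda>k. d k t)"
    proof (rule summable_comparison_test'[of _ 0])
      fix k
      define p :: real where "p = 2^k"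
      have p: "p > 0" "(1/2)^k = 1 / p"
        by (simp_all add: p_def power_divide)
      have "0 \<le> (p * norm (d k t) - 1)\<^sup>2 / p" using p(1) by simp
      also have "\<dots> = p * (norm (d k t))\<^sup>2 + 1 / p - 2 * norm (d k t)"
        using p(1) by (simp add: power2_eq_square field_simps)
      also have "\<dots> = 2^k * (norm (d k t))\<^sup>2 + (1/2)^k - 2 * norm (d k t)"
        unfolding p(2) by (simp add: p_def)
      finally show "norm (d k t) \<le> 2^k * (norm (d k t))\<^sup>2 + (1/2)^k"
        using norm_ge_zero[of "d k t"] by linarith
    qed
    hence "convergent (\<lambda>n. \<Sum>k<n. d k t)"
      by (simp add: summable_iff_convergent)
    hence "convergent (\<lambda>n. (\<Sum>k<n. d k t) + f 0 t)"
      by (intro convergent_add convergent_const)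
    moreover have "(\<Sum>k<n. d k t) + f 0 t = f n t" for n
      unfolding d_def by (subst sum_lessThan_telescope) simp
    ultimately show ?case by (simp add: convergent_LIMSEQ_iff)
  qed
  define g where "g t = lim (\<lambda>n. f n t)" for t
  have [measurable]: "g \<in> borel_measurable lborel"
    unfolding g_def by (rule borel_measurable_lim_metric) measurable
  have nn_g: "(\<integral>\<^sup>+t. ennreal ((norm (g t - f n t))\<^sup>2) \<partial>lborel) \<le> ennreal ((1/4)^n)" for n
  proof -
    have "(\<integral>\<^sup>+t. ennreal ((norm (g t - f n t))\<^sup>2) \<partial>lborel)
        = (\<integral>\<^sup>+t. liminf (\<lambda>m. ennreal ((norm (f m t - f n t))\<^sup>2)) \<partial>lborel)"
    proof (rule nn_integral_cong_AE, use conv in eventually_elim)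
      case (elim t)
      hence "(\<lambda>m. ennreal ((norm (f m t - f n t))\<^sup>2)) \<longlonglongrightarrow> ennreal ((norm (g t - f n t))\<^sup>2)"
        unfolding g_def by (intro tendsto_intros)
      thus ?case by (intro lim_imp_Liminf[symmetric] trivial_limit_sequentially)
    qed
    also have "\<dots> \<le> liminf (\<lambda>m. \<integral>\<^sup>+t. ennreal ((norm (f m t - f n t))\<^sup>2) \<partial>lborel)"
      by (rule nn_integral_liminf) measurable
    also have "\<dots> \<le> ennreal ((1/4)^n)"
      by (rule Liminf_le) (auto intro!: eventually_sequentiallyI[of n] nn_diff)
    finally show ?thesis .
  qed
  have gf: "sq_integrable (\<lambda>t. g t - f n t)" for n
    unfolding sq_integrable_def
  proof (intro conjI integrableI_bounded)
    show "(\<integral>\<^sup>+t. ennreal (norm ((norm (g t - f n t))\<^sup>2)) \<partial>lborel) < \<infinity>"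
      using nn_g[of n] by (auto intro: le_less_trans)
  qed measurable
  have g: "sq_integrable g"
    using sq_integrable_add[OF gf[of 0] f[of 0]] by simp
  have norm_le: "norm (X (r n) - abs_l2 g) \<le> (1/2)^n" for n
  proof -
    have "ennreal ((norm (abs_l2 g - X (r n)))\<^sup>2) = ennreal (\<integral>t. (norm (g t - f n t))\<^sup>2 \<partial>lborel)"
      by (simp add: Xf diff_abs_l2 f g norm_abs_l2[OF gf])
    also have "\<dots> = (\<integral>\<^sup>+t. ennreal ((norm (g t - f n t))\<^sup>2) \<partial>lborel)"
      using gf[of n] by (intro nn_integral_eq_integral[symmetric]) (auto simp: sq_integrable_def)
    also have "\<dots> \<le> ennreal ((1/4)^n)" by (rule nn_g)
    finally have "(norm (abs_l2 g - X (r n)))\<^sup>2 \<le> (1/4)^n"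
      by (simp add: ennreal_le_iff)
    also have "(1/4)^n = (((1/2)^n)\<^sup>2 :: real)"
      by (rule half_power_sq[symmetric])
    finally show ?thesis
      by (subst norm_minus_commute) (rule power2_le_imp_le, simp_all)
  qed
  have "(\<lambda>n. X (r n)) \<longlonglongrightarrow> abs_l2 g"
  proof (rule LIM_zero_cancel, rule Lim_null_comparison)
    show "\<forall>\<^sub>F n in sequentially. norm (X (r n) - abs_l2 g) \<le> (1/2)^n"
      by (simp add: norm_le)
    show "(\<lambda>n. (1/2 :: real)^n) \<longlonglongrightarrow> 0"
      by (rule LIMSEQ_power_zero) simp
  qed
  hence "X \<longlonglongrightarrow> abs_l2 g"
    using Cauchy_converges_subseq[OF \<open>Cauchy X\<close> r] by (simp add: o_def)
  thus "convergent X" by (rule convergentI)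
qed

section \<open>The operator \<open>d/dt + A\<close>\<close>

definition locally_integrable ::
    "(real \<Rightarrow> 'b::{banach, second_countable_topology}) \<Rightarrow> bool" where
  "locally_integrable h \<longleftrightarrow> (\<forall>a b. set_integrable lborel {a..b} h)"

text \<open>\<open>g\<close> is locally absolutely continuous with a.e. derivative \<open>h\<close>.\<close>

definition has_ac_derivative ::
    "(real \<Rightarrow> 'b::{banach, second_countable_topology}) \<Rightarrow> (real \<Rightarrow> 'b) \<Rightarrow> bool" where
  "has_ac_derivative g h \<longleftrightarrow> locally_integrable h \<and>
     (\<forall>t0 t. g t = g t0 + (LBINT s=ereal t0..ereal t. h s))"

definition locally_abs_cont :: "(real \<Rightarrow> 'b::{banach, second_countable_topology}) \<Rightarrow> bool" where
  "locally_abs_cont g \<longleftrightarrow> (\<exists>h. has_ac_derivative g h)"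

definition weakly_locally_abs_cont :: "(real \<Rightarrow> 'h::chilbert_space \<Rightarrow>\<^sub>L 'h) \<Rightarrow> bool" where
  "weakly_locally_abs_cont B \<longleftrightarrow> (\<forall>g h. locally_abs_cont (\<lambda>t. cinner g (B t h)))"

text \<open>The graph of \<open>d/dt\<close> on its domain \<open>W\<^sup>1\<^sup>,\<^sup>2\<close>.\<close>

definition ddt_op :: "('h::{chilbert_space, second_countable_topology} l2 \<times> 'h l2) set" where
  "ddt_op = {(abs_l2 g, abs_l2 g') | g g'.
     sq_integrable g \<and> sq_integrable g' \<and> has_ac_derivative g g'}"

definition W12 :: "'h::{chilbert_space, second_countable_topology} l2 set" where
  "W12 = Domain ddt_op"

text \<open>
  The operator \<open>(A f)(t) = A(t) f(t)\<close>, meaningful if \<open>A\<close> is (weakly) measurable and bounded.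
  The class of the function on the right-hand side does not depend on the representative of \<open>f\<close>.
\<close>

definition mult_op ::
    "(real \<Rightarrow> 'h::{chilbert_space, second_countable_topology} \<Rightarrow>\<^sub>L 'h) \<Rightarrow> 'h l2 \<Rightarrow> 'h l2" where
  "mult_op A f = abs_l2 (\<lambda>t. A t (rep_l2 f t))"

definition D_op ::
    "(real \<Rightarrow> 'h::{chilbert_space, second_countable_topology} \<Rightarrow>\<^sub>L 'h) \<Rightarrow> ('h l2 \<times> 'h l2) set" where
  "D_op A = {(f, f' + mult_op A f) | f f'. (f, f') \<in> ddt_op}"

lemma Domain_D_op: "Domain (D_op A) = W12"
  by (auto simp: D_op_def W12_def)

end

theory Submission
  imports Defs
begin

text \<open>
  \<^bold>\<open>Fredholm property.\<close> It suffices to bound \<open>\<parallel>f\<parallel>\<close> by \<open>\<parallel>D\<^sub>A f\<parallel>\<close> and finitely many functionals of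
  \<open>f\<close>; as \<open>D\<^sub>A\<^sup>* = - D\<^bsub>-A\<^esub>\<close>, the same bound for \<open>-A\<close> takes care of the adjoint. If there were no
  such bound, there would be unit vectors \<open>f\<^sub>n\<close> with \<open>D\<^sub>A f\<^sub>n \<rightarrow> 0\<close> and \<open>f\<^sub>n(t) \<rightarrow> 0\<close> weakly for every \<open>t\<close>.
  Since the \<open>A(t)\<close> differ from \<open>A\<^sub>-\<close> by compact operators, one may replace \<open>A(t)\<close> by \<open>A\<^sub>-\<close> for \<open>t < 0\<close> and
  by \<open>A\<^sub>+\<close> for \<open>t > 0\<close>. Integrating \<open>d/dt (f\<^sub>n, A\<^sub>\<plusminus> f\<^sub>n)\<close> over the two half-lines shows that
  \<open>\<parallel>A\<^sub>\<plusminus> f\<^sub>n\<parallel>\<^sup>2\<close> is bounded by null sequences and the boundary term \<open>(f\<^sub>n(0), (A\<^sub>+ - A\<^sub>-) f\<^sub>n(0))\<close>, which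
  tends to \<open>0\<close> by compactness. As \<open>A\<^sub>\<plusminus>\<close> are bounded below, \<open>f\<^sub>n \<rightarrow> 0\<close>, a contradiction.

  \<^bold>\<open>Converse.\<close> If \<open>0 \<in> \<sigma>(A\<^sub>\<plusminus>)\<close>, then for unit vectors \<open>x\<close> with \<open>A\<^sub>\<plusminus> x \<approx> 0\<close> and wide bumps \<open>\<phi>\<close> far out
  with disjoint supports, the \<open>\<phi> x\<close> are orthogonal approximate kernel vectors both of \<open>D\<^sub>A\<close> and of
  \<open>D\<^sub>A\<^sup>*\<close>; by the open mapping theorem, closed range would force them to be close to the respective
  kernel, which then has infinite dimension.
\<close>

section \<open>Orthogonal projections and orthonormal bases\<close>

text \<open>The hypotheses on \<open>B\<close> are scalar and hold almost everywhere: for fixed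
  \<open>g\<close>, \<open>h\<close> the function (g, B(t) h) is absolutely continuous with some
  density, and off one null set it has the pointwise derivative (g, B'(t) h). No operator-valued
  integral is formed. The gauge integral recovers (g, (B(b) - B(a)) h) from the pointwise
  derivative, and scalar integrals dominated by the trace norm of B' then give norm continuity of A,
  the limit A_+ and compactness of A(t) - A_-. Compactness is applied at each fixed t, and at t = 0
  for the boundary term, so weak convergence has to hold at every single point. Separability
  provides this: step functions with rational endpoints and values in a countable dense set suffice
  as functionals, because the bounds on f_n and D_A f_n control the oscillation of f_n on short
  intervals. The two half-lines contribute boundary terms of opposite sign, which is why only the
  compact difference A_+ - A_- is left; either term alone need not tend to 0.\<close>

lemma csubspace_imp_subspace: "csubspace S \<Longrightarrow> subspace S"
  unfolding cvec.subspace_def subspace_def by (metis scaleC_of_real)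

text \<open>Nearest point argument: a minimizing sequence is Cauchy by the parallelogram law, and
  minimality along every line through its limit forces orthogonality. Only the real structure enters
  here.\<close>

lemma ex_orthogonal_projection:
  fixes S :: "'a::{real_inner, complete_space} set"
  assumes S: "subspace S" "closed S"
  shows "\<exists>y\<in>S. \<forall>z\<in>S. inner (x - y) z = 0"
proof -
  define d where "d = infdist x S"
  have ne: "S \<noteq> {}" using S(1) subspace_0 by blast
  have d0: "d \<ge> 0" by (simp add: d_def infdist_nonneg)
  have dle: "d \<le> norm (x - y)" if "y \<in> S" for y
    using infdist_le[OF that, of x] by (simp add: d_def dist_norm)
  have "\<exists>y\<in>S. norm (x - y) < d + 1 / Suc n" for n
  proof -
    have "infdist x S < d + 1 / Suc n" by (simp add: d_def)
    then obtain y where "y \<in> S" "dist x y < d + 1 / Suc n"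
      using infdist_notempty[OF ne, of x] cINF_less_iff[of S "dist x" "d + 1 / Suc n"] ne
      by (metis (no_types, lifting) bdd_below_image_dist)
    thus ?thesis by (auto simp: dist_norm)
  qed
  then obtain y where yS: "\<And>n. y n \<in> S" and yd: "\<And>n. norm (x - y n) < d + 1 / Suc n"
    by metis
  \<comment> \<open>Midpoints of approximants lie in \<open>S\<close>, hence at distance at least
    \<open>d\<close> from \<open>x\<close>; the parallelogram law turns this into closeness of the
    approximants.\<close>
  have par: "(norm (y m - y n))\<^sup>2 \<le> 2 * (norm (x - y m))\<^sup>2 + 2 * (norm (x - y n))\<^sup>2 - 4 * d\<^sup>2" for m n
  proof -
    have "(1/2) *\<^sub>R (y m + y n) \<in> S"
      using S(1) yS by (intro subspace_scale subspace_add)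
    hence "d\<^sup>2 \<le> (norm (x - (1/2) *\<^sub>R (y m + y n)))\<^sup>2"
      using dle d0 by (intro power_mono)
    thus ?thesis
      by (simp add: power2_norm_eq_inner algebra_simps inner_commute)
  qed
  have "Cauchy y"
  proof (rule metric_CauchyI)
    fix e :: real assume "e > 0"
    have "(\<lambda>n. (d + 1 / Suc n)\<^sup>2) \<longlonglongrightarrow> (d + 0)\<^sup>2"
      by (intro tendsto_intros LIMSEQ_Suc[OF lim_1_over_n])
    hence "\<forall>\<^sub>F n in sequentially. (d + 1 / Suc n)\<^sup>2 < d\<^sup>2 + e\<^sup>2 / 4"
      using \<open>e > 0\<close> by (intro order_tendstoD) auto
    then obtain M where M: "\<And>n. n \<ge> M \<Longrightarrow> (d + 1 / Suc n)\<^sup>2 < d\<^sup>2 + e\<^sup>2 / 4"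
      by (auto simp: eventually_sequentially)
    have Mle: "(norm (x - y n))\<^sup>2 < d\<^sup>2 + e\<^sup>2 / 4" if "n \<ge> M" for n
      using power_mono[OF less_imp_le[OF yd[of n]], of 2] M[OF that] by simp
    hence "(norm (y m - y n))\<^sup>2 < e\<^sup>2" if "m \<ge> M" "n \<ge> M" for m n
      using par[of m n] that(1)[THEN Mle] that(2)[THEN Mle] by simp
    hence "norm (y m - y n) < e" if "m \<ge> M" "n \<ge> M" for m n
      using that \<open>e > 0\<close> power_less_imp_less_base by fastforce
    thus "\<exists>M. \<forall>m\<ge>M. \<forall>n\<ge>M. dist (y m) (y n) < e" by (auto simp: dist_norm)
  qed
  then obtain l where l: "y \<longlonglongrightarrow> l" using Cauchy_convergent_iff convergent_def by blast
  have lS: "l \<in> S" using S(2) l yS closed_sequentially by blast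
  have "norm (x - l) \<le> d + 0"
  proof (rule LIMSEQ_le)
    show "(\<lambda>n. norm (x - y n)) \<longlonglongrightarrow> norm (x - l)" by (intro tendsto_intros l)
    show "(\<lambda>n. d + 1 / Suc n) \<longlonglongrightarrow> d + 0" by (intro tendsto_intros LIMSEQ_Suc[OF lim_1_over_n])
  qed (use yd less_imp_le in blast)
  hence ld: "norm (x - l) = d" using dle[OF lS] by simp
  have "inner (x - l) z = 0" if z: "z \<in> S" for z
  proof (cases "z = 0")
    case False
    \<comment> \<open>The minimizer of the quadratic polynomial t -> norm(x - l - t z)^2; the
      competitor \<open>l + t *\<^sub>R z\<close> would be strictly closer to \<open>x\<close>
      unless the inner product vanishes.\<close>
    define t where "t = inner (x - l) z / (norm z)\<^sup>2"
    have "l + t *\<^sub>R z \<in> S" using S(1) lS z by (intro subspace_scale subspace_add)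
    hence "(norm (x - l))\<^sup>2 \<le> (norm (x - (l + t *\<^sub>R z)))\<^sup>2"
      using dle ld by (intro power_mono) auto
    also have "x - (l + t *\<^sub>R z) = (x - l) - t *\<^sub>R z" by simp
    also have "(norm \<dots>)\<^sup>2 = (norm (x - l))\<^sup>2 - 2 * t * inner (x - l) z + t\<^sup>2 * (norm z)\<^sup>2"
      unfolding power2_norm_eq_inner inner_diff_left inner_diff_right
      by (simp add: inner_commute power2_eq_square algebra_simps)
    also have "\<dots> = (norm (x - l))\<^sup>2 - (inner (x - l) z)\<^sup>2 / (norm z)\<^sup>2"
      using False by (simp add: t_def power2_eq_square field_simps)
    finally show ?thesis using False by (simp add: divide_le_0_iff)
  qed simp
  thus ?thesis using lS by blast
qed

lemma cinner_eq_0_iff: "cinner (x::'a::complex_inner) y = 0 \<longleftrightarrow> inner x y = 0 \<and> inner x ((- \<i>) *\<^sub>C y) = 0"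
  by (subst cinner_eq_inner) (simp add: complex_eq_iff)

text \<open>The real projection is already the complex one: the imaginary part of
  \<open>cinner\<close> is a real inner product with a complex multiple of \<open>z\<close>, and
  that multiple stays in \<open>S\<close>.\<close>

lemma ex_cinner_projection:
  fixes S :: "'a::chilbert_space set"
  assumes S: "csubspace S" "closed S"
  shows "\<exists>y\<in>S. \<forall>z\<in>S. cinner (x - y) z = 0"
proof -
  obtain y where y: "y \<in> S" "\<And>z. z \<in> S \<Longrightarrow> inner (x - y) z = 0"
    using ex_orthogonal_projection[OF csubspace_imp_subspace[OF S(1)] S(2)] by blast
  have "cinner (x - y) z = 0" if "z \<in> S" for z
    unfolding cinner_eq_0_iff using y(2) cvec.subspace_scale[OF S(1) that] that by blast
  with y(1) show ?thesis by blast
qed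

lemma cinner_0_right [simp]: "cinner x 0 = 0" and cinner_0_left [simp]: "cinner 0 (x::'a::complex_inner) = 0"
  using cinner_scaleC_right[of x 0 0] cinner_scaleC_left[of 0 0 x] by auto

lemma cinner_diff_right: "cinner x (y - z) = cinner x y - cinner x (z::'a::complex_inner)"
  using cinner_add_right[of x "y - z" z] by simp
lemma cinner_diff_left: "cinner (x - y) z = cinner x z - cinner y (z::'a::complex_inner)"
  using cinner_add_left[of "x - y" y z] by simp

lemma tendsto_cinner:
  fixes f g :: "_ \<Rightarrow> 'a::complex_inner"
  assumes "(f \<longlongrightarrow> a) F" "(g \<longlongrightarrow> b) F"
  shows "((\<lambda>n. cinner (f n) (g n)) \<longlongrightarrow> cinner a b) F"
  unfolding cinner_eq_inner
  by (intro tendsto_Complex tendsto_inner assms bounded_linear.tendsto[OF bounded_linear_scaleC])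

lemma csubspace_closure:
  assumes "csubspace (S::'a::complex_inner set)"
  shows "csubspace (closure S)"
  unfolding cvec.subspace_def
proof (intro conjI ballI allI)
  show "0 \<in> closure S" using assms closure_subset cvec.subspace_0 by blast
next
  fix x y assume "x \<in> closure S" "y \<in> closure S"
  then obtain f g where "\<And>n::nat. f n \<in> S" "f \<longlonglongrightarrow> x" "\<And>n::nat. g n \<in> S" "g \<longlonglongrightarrow> y"
    unfolding closure_sequential by blast
  thus "x + y \<in> closure S"
    unfolding closure_sequential
    by (intro exI[of _ "\<lambda>n. f n + g n"]) (auto intro!: tendsto_intros cvec.subspace_add assms)
next
  fix c x assume "x \<in> closure S"
  then obtain f where "\<And>n::nat. f n \<in> S" "f \<longlonglongrightarrow> x"
    unfolding closure_sequential by blast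
  thus "c *\<^sub>C x \<in> closure S"
    unfolding closure_sequential
    by (intro exI[of _ "\<lambda>n. c *\<^sub>C f n"])
       (auto intro!: bounded_linear.tendsto[OF bounded_linear_scaleC] cvec.subspace_scale assms)
qed

lemma ex_orthogonal_vector:
  fixes S :: "'a::chilbert_space set"
  assumes S: "csubspace S" "closed S" "S \<noteq> UNIV"
  shows "\<exists>x. norm x = 1 \<and> (\<forall>z\<in>S. cinner x z = 0)"
proof -
  obtain x where "x \<notin> S" using S(3) by auto
  moreover obtain y where y: "y \<in> S" "\<forall>z\<in>S. cinner (x - y) z = 0"
    using ex_cinner_projection[OF S(1,2)] by blast
  ultimately have "x - y \<noteq> 0" by auto
  thus ?thesis using y(2)
    by (intro exI[of _ "complex_of_real (1 / norm (x - y)) *\<^sub>C (x - y)"])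
       (simp add: cinner_scaleC_left norm_scaleC norm_divide)
qed

text \<open>\<open>has_trace_norm\<close> quantifies over all orthonormal bases, so it determines a
  number only if there is one. A maximal orthonormal set, from Zorn's lemma, has dense span, since
  otherwise a unit vector orthogonal to its closed span could be added.\<close>

lemma ex_orthonormal_basis: "\<exists>E::'a::chilbert_space set. orthonormal_basis E"
proof -
  define ON where "ON = {E::'a set. \<forall>e\<in>E. \<forall>f\<in>E. cinner e f = (if e = f then 1 else 0)}"
  have "\<exists>M\<in>ON. \<forall>X\<in>ON. M \<subseteq> X \<longrightarrow> X = M"
  proof (rule subset_Zorn')
    fix C assume C: "subset.chain ON C"
    have "cinner e f = (if e = f then 1 else 0)" if ef: "e \<in> \<Union>C" "f \<in> \<Union>C" for e f
    proof -
      obtain X Y where XY: "X \<in> C" "Y \<in> C" "e \<in> X" "f \<in> Y" using ef by blast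
      then have "X \<subseteq> Y \<or> Y \<subseteq> X" using C by (auto simp: subset_chain_def)
      then obtain Z where "Z \<in> C" "e \<in> Z" "f \<in> Z" using XY by blast
      moreover have "Z \<in> ON" using C \<open>Z \<in> C\<close> by (auto simp: subset_chain_def)
      ultimately show ?thesis by (auto simp: ON_def)
    qed
    thus "\<Union>C \<in> ON" by (auto simp: ON_def)
  qed
  then obtain M where M: "M \<in> ON" and max: "\<And>X. X \<in> ON \<Longrightarrow> M \<subseteq> X \<Longrightarrow> X = M" by blast
  have "closure (cspan M) = UNIV"
  proof (rule ccontr)
    assume "closure (cspan M) \<noteq> UNIV"
    then obtain x where x: "norm x = 1" "\<And>z. z \<in> closure (cspan M) \<Longrightarrow> cinner x z = 0"
      using ex_orthogonal_vector[of "closure (cspan M)"] csubspace_closure[OF cvec.subspace_span]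
      by auto
    have xM: "cinner x z = 0" if "z \<in> M" for z
      using x(2) that cvec.span_base[of z M] closure_subset[of "cspan M"] by blast
    have "cinner x x = 1"
      by (simp add: complex_eq_iff x Re_cinner power2_norm_eq_inner[symmetric])
         (metis cinner_commute cnj.simps(2) equal_neg_zero)
    moreover have "cinner z x = 0" if "z \<in> M" for z
      using xM[OF that] cinner_commute[of z x] by simp
    ultimately have "insert x M \<in> ON" using M xM unfolding ON_def by auto
    hence "x \<in> M" using max by blast
    with xM[of x] \<open>cinner x x = 1\<close> show False by simp
  qed
  with M show ?thesis unfolding ON_def orthonormal_basis_def by blast
qed

section \<open>Trace class operators are compact\<close>

lemma selfadjoint_op_inner: "selfadjoint_op T \<Longrightarrow> inner x (T y) = inner (T x) y"
  by (metis Re_cinner selfadjoint_op_def)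

lemma positive_op_inner: "positive_op P \<Longrightarrow> 0 \<le> inner x (P x)"
  by (simp add: positive_op_def Re_cinner)

lemma positive_op_selfadjoint: "positive_op P \<Longrightarrow> selfadjoint_op P"
  by (simp add: positive_op_def)

lemma positive_op_cauchy_schwarz:
  assumes P: "positive_op P"
  shows "(inner x (P y))\<^sup>2 \<le> inner x (P x) * inner y (P y)"
proof -
  have sym: "inner y (P x) = inner x (P y)"
    using selfadjoint_op_inner[OF positive_op_selfadjoint[OF P]] by (metis inner_commute)
  have q: "0 \<le> inner x (P x) + 2 * t * inner x (P y) + t\<^sup>2 * inner y (P y)" for t
    using positive_op_inner[OF P, of "x + t *\<^sub>R y"]
    by (simp add: blinfun.add_right blinfun.scaleR_right inner_add_left inner_add_right sym
        power2_eq_square algebra_simps)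
  show ?thesis
  proof (cases "inner y (P y) = 0")
    case True
    have "inner x (P y) = 0"
    proof (rule ccontr)
      assume "inner x (P y) \<noteq> 0"
      \<comment> \<open>Without quadratic term the form is affine in \<open>t\<close>, and at this
        \<open>t\<close> it would be -1.\<close>
      with q[of "- (inner x (P x) + 1) / (2 * inner x (P y))"] True show False by (simp add: field_simps)
    qed
    thus ?thesis by (simp add: True)
  next
    case False
    hence pos: "inner y (P y) > 0" using positive_op_inner[OF P, of y] by simp
    have "0 \<le> inner y (P y) * (inner x (P x) + 2 * (- inner x (P y) / inner y (P y)) * inner x (P y)
        + (- inner x (P y) / inner y (P y))\<^sup>2 * inner y (P y))"
      by (rule mult_nonneg_nonneg[OF less_imp_le[OF pos] q])
    also have "\<dots> = inner x (P x) * inner y (P y) - (inner x (P y))\<^sup>2"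
      using pos by (simp add: field_simps power2_eq_square)
    finally show ?thesis by simp
  qed
qed

text \<open>Cauchy-Schwarz for the form of \<open>P\<close>, applied to \<open>P x\<close> and
  \<open>x\<close>, followed by cancelling norm(P x)^2. It lets smallness of the form control
  \<open>P x\<close> without a square root of \<open>P\<close>.\<close>

lemma positive_op_norm_sq_le:
  assumes P: "positive_op P"
  shows "(norm (P x))\<^sup>2 \<le> norm P * inner x (P x)"
proof (cases "P x = 0")
  case False
  have "(norm (P x))\<^sup>2 * (norm (P x))\<^sup>2 = (inner (P x) (P x))\<^sup>2"
    unfolding power2_norm_eq_inner[symmetric] by (simp add: power2_eq_square)
  also have "\<dots> \<le> inner (P x) (P (P x)) * inner x (P x)"
    by (rule positive_op_cauchy_schwarz[OF P])
  also have "\<dots> \<le> (norm P * (norm (P x))\<^sup>2) * inner x (P x)"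
  proof (rule mult_right_mono)
    have "inner (P x) (P (P x)) \<le> norm (P x) * norm (P (P x))" by (rule norm_cauchy_schwarz)
    also have "\<dots> \<le> norm (P x) * (norm P * norm (P x))" by (intro mult_left_mono norm_blinfun) simp
    finally show "inner (P x) (P (P x)) \<le> norm P * (norm (P x))\<^sup>2"
      by (simp add: power2_eq_square mult_ac)
  qed (rule positive_op_inner[OF P])
  finally have "(norm (P x))\<^sup>2 * (norm (P x))\<^sup>2 \<le> (norm (P x))\<^sup>2 * (norm P * inner x (P x))"
    by (simp add: mult_ac)
  thus ?thesis using False by (subst (asm) mult_le_cancel_left_pos) auto
qed (use positive_op_inner[OF P, of x] in simp)

text \<open>With \<open>D = P - Q\<close> one has \<open>P D = - D Q\<close>, so that \<open>(D x, P D x) = - (D\<^sup>2 x, Q x)\<close>, which is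
  close to \<open>- \<parallel>D\<parallel>\<^sup>2 (x, Q x)\<close> if \<open>x\<close> almost realizes the norm of \<open>D\<close>. Both sides then nearly vanish.\<close>

lemma positive_sqrt_unique_aux:
  assumes P: "positive_op P" and Q: "positive_op Q" and PQ: "\<And>x. P (P x) = Q (Q x)"
    and x: "\<And>n::nat. norm (x n) = 1" and xd: "(\<lambda>n. norm ((P - Q) (x n))) \<longlonglongrightarrow> norm (P - Q)"
    and "P \<noteq> Q"
  shows "(\<lambda>n. Q (x n)) \<longlonglongrightarrow> 0"
proof -
  define D where "D = P - Q"
  define d where "d = norm D"
  have dpos: "d > 0" using \<open>P \<noteq> Q\<close> by (simp add: d_def D_def)
  have sD: "inner u (D v) = inner (D u) v" for u v
    using selfadjoint_op_inner[OF positive_op_selfadjoint[OF P]]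
      selfadjoint_op_inner[OF positive_op_selfadjoint[OF Q]]
    by (simp add: D_def blinfun.diff_left inner_diff_left inner_diff_right)
  have PD: "P (D v) = - D (Q v)" for v
    by (simp add: D_def blinfun.diff_left blinfun.diff_right PQ)
  define z where "z n = D (D (x n)) - d\<^sup>2 *\<^sub>R x n" for n
  \<comment> \<open>In the expanded square the first term is at most d^4, and by symmetry the cross
    term contains (D^2 x, x) = norm(D x)^2. Vectors that almost realize the norm of \<open>D\<close>
    are therefore approximate eigenvectors of D^2 for d^2.\<close>
  have zle: "(norm (z n))\<^sup>2 \<le> 2 * d^4 - 2 * d\<^sup>2 * (norm (D (x n)))\<^sup>2" for n
  proof -
    have "norm (D (D (x n))) \<le> d * norm (D (x n))" unfolding d_def by (rule norm_blinfun)
    also have "\<dots> \<le> d * (d * norm (x n))"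
      unfolding d_def by (intro mult_left_mono norm_blinfun) auto
    finally have "norm (D (D (x n))) \<le> d * d" by (simp add: x)
    hence "(norm (D (D (x n))))\<^sup>2 \<le> (d * d)\<^sup>2" by (intro power_mono) auto
    moreover have "(d * d)\<^sup>2 = d^4" by (simp add: power2_eq_square power4_eq_xxxx mult.assoc)
    moreover have "(norm (z n))\<^sup>2 = (norm (D (D (x n))))\<^sup>2 - 2 * d\<^sup>2 * inner (D (D (x n))) (x n)
        + d^4 * (norm (x n))\<^sup>2"
      unfolding z_def power2_norm_eq_inner
      by (simp add: inner_diff_left inner_diff_right inner_commute power2_eq_square power4_eq_xxxx algebra_simps)
    moreover have "inner (D (D (x n))) (x n) = (norm (D (x n)))\<^sup>2"
      by (simp add: sD[symmetric] power2_norm_eq_inner)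
    ultimately show ?thesis by (simp add: x)
  qed
  have xd': "(\<lambda>n. norm (D (x n))) \<longlonglongrightarrow> d" using xd by (simp add: D_def d_def)
  have "(\<lambda>n. 2 * d^4 - 2 * d\<^sup>2 * (norm (D (x n)))\<^sup>2) \<longlonglongrightarrow> 2 * d^4 - 2 * d\<^sup>2 * d\<^sup>2"
    by (intro tendsto_intros xd')
  also have "2 * d^4 - 2 * d\<^sup>2 * d\<^sup>2 = 0" by (simp add: power2_eq_square power4_eq_xxxx)
  finally have "(\<lambda>n. (norm (z n))\<^sup>2) \<longlonglongrightarrow> 0"
    by (rule Lim_null_comparison[rotated]) (use zle in auto)
  hence z0: "(\<lambda>n. norm (z n)) \<longlonglongrightarrow> 0" by (simp add: power_tendsto_0_iff)
  have Qle: "d\<^sup>2 * inner (x n) (Q (x n)) \<le> norm (z n) * norm Q" for n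
  proof -
    have "0 \<le> inner (D (x n)) (P (D (x n)))" by (rule positive_op_inner[OF P])
    also have "\<dots> = - inner (D (D (x n))) (Q (x n))" by (simp add: PD sD)
    also have "\<dots> = - d\<^sup>2 * inner (x n) (Q (x n)) - inner (z n) (Q (x n))"
      by (simp add: z_def inner_diff_left)
    finally have "d\<^sup>2 * inner (x n) (Q (x n)) \<le> - inner (z n) (Q (x n))" by simp
    also have "\<dots> \<le> norm (z n) * norm (Q (x n))"
      using Cauchy_Schwarz_ineq2[of "z n" "Q (x n)"] by linarith
    also have "\<dots> \<le> norm (z n) * norm Q"
      using norm_blinfun[of Q "x n"] x by (intro mult_left_mono) auto
    finally show ?thesis .
  qed
  have Q2: "(norm (Q (x n)))\<^sup>2 \<le> norm Q * (norm (z n) * norm Q / d\<^sup>2)" for n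
  proof -
    have "inner (x n) (Q (x n)) \<le> norm (z n) * norm Q / d\<^sup>2"
      using Qle[of n] dpos by (simp add: field_simps)
    from mult_left_mono[OF this, of "norm Q"] positive_op_norm_sq_le[OF Q, of "x n"]
    show ?thesis by simp
  qed
  have "(\<lambda>n. norm Q * (norm (z n) * norm Q / d\<^sup>2)) \<longlonglongrightarrow> norm Q * (0 * norm Q / d\<^sup>2)"
    by (intro tendsto_intros z0) (use dpos in auto)
  hence "(\<lambda>n. (norm (Q (x n)))\<^sup>2) \<longlonglongrightarrow> 0"
    using Q2 by (intro Lim_null_comparison[of "\<lambda>n. (norm (Q (x n)))\<^sup>2" _ sequentially]) auto
  thus ?thesis by (simp add: power_tendsto_0_iff tendsto_norm_zero_iff)
qed

lemma ex_norming_sequence: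
  fixes T :: "'a::real_normed_vector \<Rightarrow>\<^sub>L 'b::real_normed_vector"
  assumes "T \<noteq> 0"
  shows "\<exists>x. (\<forall>n::nat. norm (x n) = 1) \<and> (\<lambda>n. norm (T (x n))) \<longlonglongrightarrow> norm T"
proof -
  have "\<exists>x. norm x = 1 \<and> norm T - 1 / real (Suc n) \<le> norm (T x)" for n
  proof (rule ccontr)
    assume "\<not> ?thesis"
    hence *: "norm (T x) \<le> norm T - 1 / real (Suc n)" if "norm x = 1" for x using that by force
    obtain v where v: "T v \<noteq> 0" using assms blinfun_eqI[of T 0] by auto
    hence "v \<noteq> 0" by auto
    hence ge0: "0 \<le> norm T - 1 / real (Suc n)"
      using order.trans[OF norm_ge_zero *[of "(1 / norm v) *\<^sub>R v"]] by simp
    have "norm T \<le> norm T - 1 / real (Suc n)"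
    proof (rule norm_blinfun_bound[OF ge0])
      fix x
      show "norm (T x) \<le> (norm T - 1 / real (Suc n)) * norm x"
      proof (cases "x = 0")
        case False
        have "norm (T ((1 / norm x) *\<^sub>R x)) \<le> norm T - 1 / real (Suc n)"
          using False by (intro *) simp
        thus ?thesis using False by (simp add: blinfun.scaleR_right field_simps)
      qed simp
    qed
    thus False by simp
  qed
  then obtain x where x: "\<And>n. norm (x n) = 1" "\<And>n. norm T - 1 / real (Suc n) \<le> norm (T (x n))"
    by metis
  have "(\<lambda>n. norm (T (x n))) \<longlonglongrightarrow> norm T"
  proof (rule tendsto_sandwich)
    have "(\<lambda>n. norm T - 1 / real (Suc n)) \<longlonglongrightarrow> norm T - 0"
      by (intro tendsto_intros LIMSEQ_Suc[OF lim_1_over_n])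
    thus "(\<lambda>n. norm T - 1 / real (Suc n)) \<longlonglongrightarrow> norm T" by simp
    show "\<forall>\<^sub>F n in sequentially. norm (T (x n)) \<le> norm T"
      using norm_blinfun[of T "x n" for n] x(1) by (auto intro!: always_eventually)
  qed (use x(2) in auto)
  with x(1) show ?thesis by blast
qed

text \<open>The hypotheses are symmetric in \<open>P\<close> and \<open>Q\<close>, so along one
  norming sequence of the difference both \<open>P\<close> and \<open>Q\<close> tend to 0; the norm
  of the difference is then 0. No functional calculus enters.\<close>

lemma positive_sqrt_unique:
  assumes P: "positive_op P" and Q: "positive_op Q" and PQ: "P o\<^sub>L P = Q o\<^sub>L Q"
  shows "P = Q"
proof (rule ccontr)
  assume "P \<noteq> Q"
  have PQ': "P (P x) = Q (Q x)" for x using PQ by (metis blinfun_apply_blinfun_compose)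
  obtain x where x: "\<And>n::nat. norm (x n) = 1" "(\<lambda>n. norm ((P - Q) (x n))) \<longlonglongrightarrow> norm (P - Q)"
    using ex_norming_sequence[of "P - Q"] \<open>P \<noteq> Q\<close> by auto
  have "(\<lambda>n. norm ((Q - P) (x n))) \<longlonglongrightarrow> norm (Q - P)"
    using x(2) by (simp add: blinfun.diff_left norm_minus_commute)
  hence "(\<lambda>n. P (x n)) \<longlonglongrightarrow> 0"
    using positive_sqrt_unique_aux[OF Q P PQ'[symmetric] x(1)] \<open>P \<noteq> Q\<close> by auto
  moreover have "(\<lambda>n. Q (x n)) \<longlonglongrightarrow> 0"
    using positive_sqrt_unique_aux[OF P Q PQ' x(1,2) \<open>P \<noteq> Q\<close>] .
  ultimately have "(\<lambda>n. norm (P (x n) - Q (x n))) \<longlonglongrightarrow> norm (0 - 0 :: 'a)"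
    by (intro tendsto_intros)
  with x(2) have "norm (P - Q) = 0"
    by (intro LIMSEQ_unique[OF x(2)]) (simp add: blinfun.diff_left)
  with \<open>P \<noteq> Q\<close> show False by simp
qed

lemma is_adjoint_op_unique: "is_adjoint_op S T \<Longrightarrow> is_adjoint_op S' T \<Longrightarrow> S = S'"
proof (rule blinfun_eqI)
  fix x assume S: "is_adjoint_op S T" "is_adjoint_op S' T"
  have "inner (S x) y = inner (S' x) y" for y
    using S[unfolded is_adjoint_op_def, rule_format, of x y] by (simp flip: Re_cinner)
  thus "S x = S' x" using vector_eq_rdot by blast
qed

lemma is_abs_op_unique: "is_abs_op P T \<Longrightarrow> is_abs_op Q T \<Longrightarrow> P = Q"
  unfolding is_abs_op_def by (metis is_adjoint_op_unique positive_sqrt_unique)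

lemma has_trace_norm_unique:
  fixes T :: "'a::chilbert_space \<Rightarrow>\<^sub>L 'a"
  assumes "has_trace_norm T s" "has_trace_norm T s'"
  shows "s = s'"
proof -
  obtain E :: "'a set" where "orthonormal_basis E" using ex_orthonormal_basis by blast
  thus ?thesis using assms is_abs_op_unique has_sum_unique unfolding has_trace_norm_def by metis
qed

lemma trace_class_has_trace_norm:
  "trace_class (T :: 'a::chilbert_space \<Rightarrow>\<^sub>L 'a) \<Longrightarrow> has_trace_norm T (trace_norm T)"
  unfolding trace_norm_def trace_class_def by (metis has_trace_norm_unique theI)

text \<open>Both squares equal the form of P^2 = T^* T. Norm bounds and complete continuity
  therefore pass from the positive operator to \<open>T\<close> without a polar
  decomposition.\<close>

lemma norm_is_abs_op:
  assumes "is_abs_op P T"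
  shows "norm (P x) = norm (T x)"
proof -
  obtain S where S: "is_adjoint_op S T" "P o\<^sub>L P = S o\<^sub>L T" and P: "positive_op P"
    using assms by (auto simp: is_abs_op_def)
  have "inner (P x) (P x) = inner (P (P x)) x"
    using selfadjoint_op_inner[OF positive_op_selfadjoint[OF P]] by metis
  also have "P (P x) = S (T x)" using S(2) by (metis blinfun_apply_blinfun_compose)
  also have "inner (S (T x)) x = inner (T x) (T x)"
    using S(1) unfolding is_adjoint_op_def by (metis Re_cinner)
  finally show ?thesis by (simp add: norm_eq_sqrt_inner)
qed

lemma scaleC_eq_scaleR: "c *\<^sub>C (x::'a::complex_inner) = Re c *\<^sub>R x + Im c *\<^sub>R (\<i> *\<^sub>C x)"
proof -
  have "c = of_real (Re c) + of_real (Im c) * \<i>" by (simp add: complex_eq_iff)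
  hence "c *\<^sub>C x = (of_real (Re c) + of_real (Im c) * \<i>) *\<^sub>C x" by (rule arg_cong)
  also have "\<dots> = Re c *\<^sub>R x + Im c *\<^sub>R (\<i> *\<^sub>C x)"
    by (simp only: scaleC_add_left scaleC_scaleC[symmetric] scaleC_of_real)
  finally show ?thesis .
qed

lemma tendsto_scaleC:
  assumes "(f \<longlongrightarrow> c) F"
  shows "((\<lambda>n. f n *\<^sub>C (x::'a::complex_inner)) \<longlongrightarrow> c *\<^sub>C x) F"
proof -
  have "((\<lambda>n. Re (f n) *\<^sub>R x + Im (f n) *\<^sub>R (\<i> *\<^sub>C x)) \<longlongrightarrow> Re c *\<^sub>R x + Im c *\<^sub>R (\<i> *\<^sub>C x)) F"
    by (intro tendsto_intros assms)
  thus ?thesis by (simp only: scaleC_eq_scaleR[symmetric])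
qed

lemma inner_ii_scaleC: "inner x ((- \<i>) *\<^sub>C y) = inner (\<i> *\<^sub>C x) (y::'a::complex_inner)"
  unfolding Re_cinner[symmetric] cinner_scaleC_left cinner_scaleC_right by simp

lemma cinner_orthonormal_sum:
  fixes f :: "'i \<Rightarrow> 'a::complex_inner"
  assumes I: "finite I" and f: "\<And>i j. i \<in> I \<Longrightarrow> j \<in> I \<Longrightarrow> cinner (f i) (f j) = (if i = j then 1 else 0)"
    and i: "i \<in> I"
  shows "cinner (f i) (\<Sum>j\<in>I. c j *\<^sub>C f j) = c i"
proof -
  have "cinner e (\<Sum>j\<in>J. g j) = (\<Sum>j\<in>J. cinner e (g j))" for e J and g :: "'i \<Rightarrow> 'a"
    by (induction J rule: infinite_finite_induct) (auto simp: cinner_add_right)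
  hence "cinner (f i) (\<Sum>j\<in>I. c j *\<^sub>C f j) = (\<Sum>j\<in>I. if j = i then c i else 0)"
    using i by (auto simp: cinner_scaleC_right f intro!: sum.cong)
  thus ?thesis using i I by simp
qed

lemma norm_orthonormal_sum:
  fixes f :: "'i \<Rightarrow> 'a::complex_inner"
  assumes I: "finite I" and f: "\<And>i j. i \<in> I \<Longrightarrow> j \<in> I \<Longrightarrow> cinner (f i) (f j) = (if i = j then 1 else 0)"
  shows "(norm (\<Sum>i\<in>I. c i *\<^sub>C f i))\<^sup>2 = (\<Sum>i\<in>I. (cmod (c i))\<^sup>2)"
proof -
  let ?x = "\<Sum>i\<in>I. c i *\<^sub>C f i"
  have "(norm ?x)\<^sup>2 = (\<Sum>i\<in>I. inner (c i *\<^sub>C f i) ?x)"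
    by (simp only: power2_norm_eq_inner inner_sum_left)
  also have "\<dots> = (\<Sum>i\<in>I. (cmod (c i))\<^sup>2)"
  proof (rule sum.cong)
    fix i assume "i \<in> I"
    have coeff: "cinner (f i) ?x = c i"
      by (rule cinner_orthonormal_sum[where f = f, OF I _ \<open>i \<in> I\<close>]) (rule f)
    have "cinner (c i *\<^sub>C f i) ?x = of_real ((cmod (c i))\<^sup>2)"
      unfolding cinner_scaleC_left coeff
      by (metis complex_norm_square mult.commute)
    thus "inner (c i *\<^sub>C f i) ?x = (cmod (c i))\<^sup>2" by (metis Re_cinner Re_complex_of_real)
  qed simp
  finally show ?thesis .
qed

text \<open>Boundedness is built in, so the uniform boundedness principle is not invoked. Real inner
  products determine complex ones, because the imaginary part is a real product with
  \<open>\<i> *\<^sub>C h\<close>.\<close>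

definition weakly_null :: "(nat \<Rightarrow> 'a::real_inner) \<Rightarrow> bool" where
  "weakly_null u \<longleftrightarrow> (\<exists>M. \<forall>n. norm (u n) \<le> M) \<and> (\<forall>h. (\<lambda>n. inner h (u n)) \<longlonglongrightarrow> 0)"

text \<open>On a Hilbert space this is compactness. The sequential form is the one that the
  contradiction argument applies, and it passes to norm limits and to dominated scalar
  integrals.\<close>

definition completely_continuous :: "('a::real_inner \<Rightarrow>\<^sub>L 'a) \<Rightarrow> bool" where
  "completely_continuous C \<longleftrightarrow> (\<forall>u. weakly_null u \<longrightarrow> (\<lambda>n. C (u n)) \<longlonglongrightarrow> 0)"

lemma weakly_null_cinner:
  assumes "weakly_null (u :: nat \<Rightarrow> 'a::complex_inner)"
  shows "(\<lambda>n. cinner h (u n)) \<longlonglongrightarrow> 0"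
proof -
  have "(\<lambda>n. Complex (inner h (u n)) (inner (\<i> *\<^sub>C h) (u n))) \<longlonglongrightarrow> Complex 0 0"
    using assms by (intro tendsto_Complex) (auto simp: weakly_null_def)
  thus ?thesis unfolding cinner_eq_inner inner_ii_scaleC zero_complex.code .
qed

section \<open>A positive operator of finite trace is compact\<close>

context
  fixes E :: "'a::chilbert_space set" and P :: "'a \<Rightarrow>\<^sub>L 'a" and s :: real
  assumes E: "orthonormal_basis E" and P: "positive_op P"
    and s: "((\<lambda>e. Re (cinner e (P e))) has_sum s) E"
begin

text \<open>This is the norm of the square root of \<open>P\<close> applied to \<open>x\<close>,
  expressed by the form so that the root need not be constructed.\<close>

definition op_seminorm :: "'a \<Rightarrow> real" where "op_seminorm x = sqrt (inner x (P x))"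

lemma op_seminorm_sq: "(op_seminorm x)\<^sup>2 = inner x (P x)"
  using positive_op_inner[OF P] by (simp add: op_seminorm_def)

lemma op_seminorm_nonneg: "op_seminorm x \<ge> 0"
  using positive_op_inner[OF P] by (simp add: op_seminorm_def)

lemma op_seminorm_add: "op_seminorm (x + y) \<le> op_seminorm x + op_seminorm y"
proof (rule power2_le_imp_le)
  have "inner x (P y) \<le> op_seminorm x * op_seminorm y"
  proof (rule power2_le_imp_le)
    show "(inner x (P y))\<^sup>2 \<le> (op_seminorm x * op_seminorm y)\<^sup>2"
      using positive_op_cauchy_schwarz[OF P] by (simp add: power_mult_distrib op_seminorm_sq)
  qed (simp add: op_seminorm_nonneg)
  moreover have "inner y (P x) = inner x (P y)"
    using selfadjoint_op_inner[OF positive_op_selfadjoint[OF P]] by (metis inner_commute)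
  ultimately show "(op_seminorm (x + y))\<^sup>2 \<le> (op_seminorm x + op_seminorm y)\<^sup>2"
    unfolding power2_sum op_seminorm_sq by (simp add: blinfun.add_right inner_add_left inner_add_right)
qed (simp add: op_seminorm_nonneg)

lemma op_seminorm_scaleC: "op_seminorm (c *\<^sub>C x) = cmod c * op_seminorm x"
proof -
  have "P (c *\<^sub>C x) = c *\<^sub>C P x"
    using P by (auto simp: positive_op_def selfadjoint_op_def clinear_op_def)
  hence "cinner (c *\<^sub>C x) (P (c *\<^sub>C x)) = (c * cnj c) * cinner x (P x)"
    by (simp add: cinner_scaleC_left cinner_scaleC_right)
  hence "inner (c *\<^sub>C x) (P (c *\<^sub>C x)) = (cmod c)\<^sup>2 * inner x (P x)"
    by (simp add: complex_norm_square[symmetric] flip: Re_cinner)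
  thus ?thesis by (simp add: op_seminorm_def real_sqrt_mult)
qed

lemma op_seminorm_sum: "op_seminorm (sum f I) \<le> (\<Sum>i\<in>I. op_seminorm (f i))"
proof (induction I rule: infinite_finite_induct)
  case (insert i I)
  thus ?case using op_seminorm_add[of "f i" "sum f I"] by simp
qed (auto simp: op_seminorm_def)

lemma cinner_basis_sum:
  assumes "finite t" "t \<subseteq> E" "e \<in> t"
  shows "cinner e (\<Sum>f\<in>t. r f *\<^sub>C f) = r e"
proof (rule cinner_orthonormal_sum[where f = "\<lambda>f. f", OF assms(1) _ assms(3)])
  show "cinner e f = (if e = f then 1 else 0)" if "e \<in> t" "f \<in> t" for e f
    using E assms(2) that unfolding orthonormal_basis_def by blast
qed

lemma norm_basis_sum:
  assumes "finite t" "t \<subseteq> E"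
  shows "(norm (\<Sum>f\<in>t. r f *\<^sub>C f))\<^sup>2 = (\<Sum>f\<in>t. (cmod (r f))\<^sup>2)"
proof (rule norm_orthonormal_sum[where f = "\<lambda>f. f", OF assms(1)])
  show "cinner e f = (if e = f then 1 else 0)" if "e \<in> t" "f \<in> t" for e f
    using E assms(2) that unfolding orthonormal_basis_def by blast
qed

text \<open>The triangle inequality for the seminorm and Cauchy-Schwarz for finite sums separate the
  coefficients, whose squares sum to the squared norm, from the diagonal entries of
  \<open>P\<close>.\<close>

lemma op_seminorm_basis_sum:
  assumes "finite t" "t \<subseteq> E"
  shows "(op_seminorm (\<Sum>f\<in>t. r f *\<^sub>C f))\<^sup>2 \<le> (norm (\<Sum>f\<in>t. r f *\<^sub>C f))\<^sup>2 * (\<Sum>f\<in>t. inner f (P f))"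
proof -
  have "op_seminorm (\<Sum>f\<in>t. r f *\<^sub>C f) \<le> (\<Sum>f\<in>t. \<bar>cmod (r f)\<bar> * \<bar>op_seminorm f\<bar>)"
    using op_seminorm_sum[of "\<lambda>f. r f *\<^sub>C f" t] by (simp add: op_seminorm_scaleC op_seminorm_nonneg)
  also have "\<dots> \<le> L2_set (\<lambda>f. cmod (r f)) t * L2_set op_seminorm t"
    by (rule L2_set_mult_ineq)
  finally have "(op_seminorm (\<Sum>f\<in>t. r f *\<^sub>C f))\<^sup>2 \<le> (L2_set (\<lambda>f. cmod (r f)) t * L2_set op_seminorm t)\<^sup>2"
    by (intro power_mono op_seminorm_nonneg)
  thus ?thesis
    by (simp add: norm_basis_sum[OF assms] power_mult_distrib L2_set_def sum_nonneg op_seminorm_sq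
        positive_op_inner[OF P])
qed

text \<open>Removing the coordinates in \<open>F\<close> leaves only the rest of the trace to
  control the form. For finite combinations of basis vectors this is the bound on coordinate
  subspaces; both sides are continuous, and such combinations are dense.\<close>

lemma op_seminorm_tail_le:
  assumes F: "finite F" "F \<subseteq> E"
  defines "\<pi> \<equiv> \<lambda>x. \<Sum>e\<in>F. cinner e x *\<^sub>C e"
  shows "inner (x - \<pi> x) (P (x - \<pi> x)) \<le> (norm (x - \<pi> x))\<^sup>2 * (s - (\<Sum>e\<in>F. inner e (P e)))"
proof -
  have *: "inner (x - \<pi> x) (P (x - \<pi> x)) \<le> (norm (x - \<pi> x))\<^sup>2 * (s - (\<Sum>e\<in>F. inner e (P e)))"
    if x: "x \<in> cspan E" for x
  proof -
    obtain t r where t: "finite t" "t \<subseteq> E" "x = (\<Sum>a\<in>t. r a *\<^sub>C a)"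
      using x unfolding cvec.span_explicit by blast
    \<comment> \<open>Coefficients are padded by zeros so that the vector and its projection to
      \<open>F\<close> are sums over a common index set.\<close>
    define t' where "t' = t \<union> F"
    define r' where "r' = (\<lambda>a. if a \<in> t then r a else 0)"
    have t': "finite t'" "t' \<subseteq> E" using t F by (auto simp: t'_def)
    have x': "x = (\<Sum>a\<in>t'. r' a *\<^sub>C a)"
      unfolding t(3) t'_def r'_def using t F
      by (intro sum.mono_neutral_cong_left) auto
    have "\<pi> x = (\<Sum>a\<in>F. r' a *\<^sub>C a)"
      unfolding \<pi>_def x' using cinner_basis_sum[OF t', of _ r'] by (intro sum.cong) (auto simp: t'_def)
    moreover have "x = (\<Sum>a\<in>t'-F. r' a *\<^sub>C a) + (\<Sum>a\<in>F. r' a *\<^sub>C a)"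
      unfolding x' by (rule sum.subset_diff) (auto simp: t'(1), auto simp: t'_def)
    ultimately have d: "x - \<pi> x = (\<Sum>a\<in>t'-F. r' a *\<^sub>C a)" by simp
    have "(op_seminorm (x - \<pi> x))\<^sup>2 \<le> (norm (x - \<pi> x))\<^sup>2 * (\<Sum>f\<in>t'-F. inner f (P f))"
      unfolding d by (rule op_seminorm_basis_sum) (use t' in auto)
    also have "(\<Sum>f\<in>t'-F. inner f (P f)) = (\<Sum>f\<in>t'. inner f (P f)) - (\<Sum>f\<in>F. inner f (P f))"
      by (rule sum_diff) (use t' in \<open>auto simp: t'_def\<close>)
    also have "(\<Sum>f\<in>t'. inner f (P f)) \<le> s"
    proof -
      have hs: "((\<lambda>e. inner e (P e)) has_sum s) E" using s by (simp add: Re_cinner)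
      show ?thesis
        using finite_sum_le_has_sum[OF hs t'] positive_op_inner[OF P] by simp
    qed
    hence "(norm (x - \<pi> x))\<^sup>2 * ((\<Sum>f\<in>t'. inner f (P f)) - (\<Sum>f\<in>F. inner f (P f)))
      \<le> (norm (x - \<pi> x))\<^sup>2 * (s - (\<Sum>f\<in>F. inner f (P f)))" by (intro mult_left_mono) auto
    finally show ?thesis by (simp add: op_seminorm_sq)
  qed
  have "x \<in> closure (cspan E)" using E by (simp add: orthonormal_basis_def)
  then obtain y where y: "\<And>n::nat. y n \<in> cspan E" "y \<longlonglongrightarrow> x"
    unfolding closure_sequential by blast
  have d: "(\<lambda>n. y n - \<pi> (y n)) \<longlonglongrightarrow> x - \<pi> x"
    unfolding \<pi>_def by (intro tendsto_intros tendsto_scaleC tendsto_cinner y)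
  show ?thesis
  proof (rule LIMSEQ_le)
    show "(\<lambda>n. inner (y n - \<pi> (y n)) (P (y n - \<pi> (y n)))) \<longlonglongrightarrow> inner (x - \<pi> x) (P (x - \<pi> x))"
      by (intro tendsto_intros d)
    show "(\<lambda>n. (norm (y n - \<pi> (y n)))\<^sup>2 * (s - (\<Sum>e\<in>F. inner e (P e))))
        \<longlonglongrightarrow> (norm (x - \<pi> x))\<^sup>2 * (s - (\<Sum>e\<in>F. inner e (P e)))"
      by (intro tendsto_intros d)
  qed (use *[OF y(1)] in blast)
qed

lemma positive_op_le_trace: "inner x (P x) \<le> (norm x)\<^sup>2 * s"
  using op_seminorm_tail_le[of "{}" x] by simp

lemma trace_nonneg: "s \<ge> 0"
  by (rule has_sum_nonneg[OF s]) (simp add: Re_cinner positive_op_inner[OF P])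

text \<open>The form is at most the trace times norm(x)^2, so norm(P)^2 <= norm(P) s, and one factor
  cancels.\<close>

lemma norm_le_trace: "norm P \<le> s"
proof (cases "norm P = 0")
  case False
  have "norm P \<le> sqrt (norm P * s)"
  proof (rule norm_blinfun_bound)
    fix x
    have "(norm (P x))\<^sup>2 \<le> norm P * ((norm x)\<^sup>2 * s)"
      by (rule order.trans[OF positive_op_norm_sq_le[OF P]])
         (intro mult_left_mono positive_op_le_trace norm_ge_zero)
    hence "sqrt ((norm (P x))\<^sup>2) \<le> sqrt (norm P * s * (norm x)\<^sup>2)"
      by (intro real_sqrt_le_mono) (simp add: mult_ac)
    thus "norm (P x) \<le> sqrt (norm P * s) * norm x" by (simp add: real_sqrt_mult)
  qed (use trace_nonneg in simp)
  hence "(norm P)\<^sup>2 \<le> (sqrt (norm P * s))\<^sup>2" by (intro power_mono) auto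
  hence "norm P * norm P \<le> norm P * s" using trace_nonneg by (simp add: power2_eq_square)
  thus ?thesis using False by simp
qed (use trace_nonneg in simp)

text \<open>A finite set \<open>F\<close> of basis vectors carries all but a small part of the
  trace. The projection to \<open>F\<close> involves finitely many coefficients, each tending to 0;
  the complementary part is bounded, and its form is small because the remaining trace is.\<close>

lemma completely_continuous_positive: "completely_continuous P"
  unfolding completely_continuous_def
proof (intro allI impI)
  fix u :: "nat \<Rightarrow> 'a" assume u: "weakly_null u"
  then obtain M where M: "\<And>n. norm (u n) \<le> M" by (auto simp: weakly_null_def)
  hence M0: "M \<ge> 0" using order.trans[OF norm_ge_zero M[of 0]] by simp
  have "(\<lambda>n. op_seminorm (u n)) \<longlonglongrightarrow> 0"
  proof (rule LIMSEQ_I)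
    fix \<epsilon> :: real assume e: "\<epsilon> > 0"
    \<comment> \<open>Chosen so that (M + 1)^2 \<delta> = (\<epsilon>/2)^2. The vectors have norm at
      most \<open>M\<close> and their projections eventually norm below 1, hence the complementary
      parts have norm at most M + 1.\<close>
    define \<delta> where "\<delta> = (\<epsilon> / 2 / (M + 1))\<^sup>2"
    have Meq: "(M + 1) * (\<epsilon> / 2 / (M + 1)) = \<epsilon> / 2" using M0 by (simp add: field_simps)
    have "\<delta> > 0" using e M0 by (simp add: \<delta>_def)
    have "((\<lambda>e. inner e (P e)) has_sum s) E" using s by (simp add: Re_cinner)
    hence "(sum (\<lambda>e. inner e (P e)) \<longlongrightarrow> s) (finite_subsets_at_top E)" by (simp add: has_sum_def)
    hence "\<forall>\<^sub>F F in finite_subsets_at_top E. sum (\<lambda>e. inner e (P e)) F > s - \<delta>"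
      using \<open>\<delta> > 0\<close> by (intro order_tendstoD) auto
    then obtain F where "finite F \<and> F \<subseteq> E \<and>
        (\<forall>Y. finite Y \<and> F \<subseteq> Y \<and> Y \<subseteq> E \<longrightarrow> sum (\<lambda>e. inner e (P e)) Y > s - \<delta>)"
      unfolding eventually_finite_subsets_at_top by (elim exE)
    hence F: "finite F" "F \<subseteq> E" "sum (\<lambda>e. inner e (P e)) F > s - \<delta>" by simp_all
    define \<pi> where "\<pi> = (\<lambda>x. \<Sum>e\<in>F. cinner e x *\<^sub>C e)"
    have "(\<lambda>n. \<Sum>e\<in>F. cinner e (u n) *\<^sub>C e) \<longlonglongrightarrow> (\<Sum>e\<in>F. 0 *\<^sub>C e)"
      by (intro tendsto_sum tendsto_scaleC weakly_null_cinner u)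
    hence \<pi>0: "(\<lambda>n. \<pi> (u n)) \<longlonglongrightarrow> 0" by (simp add: \<pi>_def)
    have "(\<lambda>n. op_seminorm (\<pi> (u n))) \<longlonglongrightarrow> sqrt (inner 0 (P 0))"
      unfolding op_seminorm_def by (intro tendsto_intros \<pi>0)
    hence "\<forall>\<^sub>F n in sequentially. op_seminorm (\<pi> (u n)) < \<epsilon> / 2"
      using e by (intro order_tendstoD) auto
    moreover have "\<forall>\<^sub>F n in sequentially. norm (\<pi> (u n)) < 1"
      using tendsto_norm[OF \<pi>0] by (intro order_tendstoD) auto
    ultimately have "\<forall>\<^sub>F n in sequentially. norm (op_seminorm (u n) - 0) < \<epsilon>"
    proof eventually_elim
      case (elim n)
      have nm: "norm (u n - \<pi> (u n)) \<le> M + 1"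
        using norm_triangle_ineq4[of "u n" "\<pi> (u n)"] M[of n] elim(2) by linarith
      have "(op_seminorm (u n - \<pi> (u n)))\<^sup>2 \<le> (norm (u n - \<pi> (u n)))\<^sup>2 * (s - (\<Sum>e\<in>F. inner e (P e)))"
        unfolding op_seminorm_sq \<pi>_def by (rule op_seminorm_tail_le[OF F(1,2)])
      also have "\<dots> \<le> (M + 1)\<^sup>2 * \<delta>"
      proof (cases "s - (\<Sum>e\<in>F. inner e (P e)) \<ge> 0")
        case True
        thus ?thesis using nm F(3) by (intro mult_mono power_mono) auto
      next
        case False
        hence "(norm (u n - \<pi> (u n)))\<^sup>2 * (s - (\<Sum>e\<in>F. inner e (P e))) \<le> 0"
          by (intro mult_nonneg_nonpos) auto
        also have "0 \<le> (M + 1)\<^sup>2 * \<delta>" using \<open>\<delta> > 0\<close> by simp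
        finally show ?thesis .
      qed
      also have "\<dots> = (\<epsilon> / 2)\<^sup>2"
        unfolding \<delta>_def power_mult_distrib[symmetric] Meq ..
      finally have "op_seminorm (u n - \<pi> (u n)) \<le> \<epsilon> / 2"
        by (rule power2_le_imp_le) (use e in simp)
      moreover have "op_seminorm (u n) \<le> op_seminorm (\<pi> (u n)) + op_seminorm (u n - \<pi> (u n))"
        using op_seminorm_add[of "\<pi> (u n)" "u n - \<pi> (u n)"] by simp
      ultimately show ?case using elim(1) op_seminorm_nonneg[of "u n"] by simp
    qed
    thus "\<exists>N. \<forall>n\<ge>N. norm (op_seminorm (u n) - 0) < \<epsilon>" by (simp add: eventually_sequentially)
  qed
  hence "(\<lambda>n. norm P * (op_seminorm (u n))\<^sup>2) \<longlonglongrightarrow> norm P * 0\<^sup>2" by (intro tendsto_intros)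
  hence lim: "(\<lambda>n. norm P * (op_seminorm (u n))\<^sup>2) \<longlonglongrightarrow> 0" by simp
  have "(\<lambda>n. (norm (P (u n)))\<^sup>2) \<longlonglongrightarrow> 0"
    by (rule Lim_null_comparison[OF _ lim]) (simp add: op_seminorm_sq positive_op_norm_sq_le[OF P])
  thus "(\<lambda>n. P (u n)) \<longlonglongrightarrow> 0" by (simp add: power_tendsto_0_iff tendsto_norm_zero_iff)
qed

end

text \<open>These two facts are all that the later sections use about trace class operators.\<close>

lemma
  fixes T :: "'a::chilbert_space \<Rightarrow>\<^sub>L 'a"
  assumes "trace_class T"
  shows norm_le_trace_norm: "norm T \<le> trace_norm T"
    and trace_class_completely_continuous: "completely_continuous T"
proof -
  obtain E :: "'a set" where E: "orthonormal_basis E" using ex_orthonormal_basis by blast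
  obtain P where P: "is_abs_op P T" "((\<lambda>e. Re (cinner e (P e))) has_sum trace_norm T) E"
    using trace_class_has_trace_norm[OF assms] E unfolding has_trace_norm_def by blast
  have pos: "positive_op P" using P(1) by (simp add: is_abs_op_def)
  note eq = norm_is_abs_op[OF P(1)]
  have "norm T \<le> norm P"
    by (rule norm_blinfun_bound) (auto simp: eq[symmetric] norm_blinfun)
  with norm_le_trace[OF E pos P(2)] show "norm T \<le> trace_norm T" by linarith
  show "completely_continuous T"
    unfolding completely_continuous_def
  proof (intro allI impI)
    fix u :: "nat \<Rightarrow> 'a" assume "weakly_null u"
    hence "(\<lambda>n. P (u n)) \<longlonglongrightarrow> 0"
      using completely_continuous_positive[OF E pos P(2)] by (simp add: completely_continuous_def)
    hence "(\<lambda>n. norm (T (u n))) \<longlonglongrightarrow> 0" unfolding eq[symmetric] by (rule tendsto_norm_zero)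
    thus "(\<lambda>n. T (u n)) \<longlonglongrightarrow> 0" by (rule tendsto_norm_zero_cancel)
  qed
qed

section \<open>Operators and relations with closed range\<close>

lemma Cauchy_if_dominated:
  fixes x :: "nat \<Rightarrow> 'a::real_normed_vector" and y :: "nat \<Rightarrow> 'b::real_normed_vector"
  assumes le: "\<And>m n. norm (x m - x n) \<le> C * norm (y m - y n)" and y: "Cauchy y"
  shows "Cauchy x"
proof (rule metric_CauchyI)
  fix e :: real assume "e > 0"
  hence "e / (\<bar>C\<bar> + 1) > 0" by simp
  then obtain M where M: "\<And>m n. m \<ge> M \<Longrightarrow> n \<ge> M \<Longrightarrow> dist (y m) (y n) < e / (\<bar>C\<bar> + 1)"
    using y unfolding Cauchy_def by metis
  have "dist (x m) (x n) < e" if "m \<ge> M" "n \<ge> M" for m n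
  proof -
    note le[of m n]
    also have "C * norm (y m - y n) \<le> (\<bar>C\<bar> + 1) * norm (y m - y n)" by (intro mult_right_mono) auto
    also have "\<dots> < (\<bar>C\<bar> + 1) * (e / (\<bar>C\<bar> + 1))"
      using M[OF that] by (intro mult_strict_left_mono) (auto simp: dist_norm)
    finally show ?thesis by (simp add: dist_norm)
  qed
  thus "\<exists>M. \<forall>m\<ge>M. \<forall>n\<ge>M. dist (x m) (x n) < e" by blast
qed

lemma bounded_below_if_resolvent:
  fixes T :: "'a::complex_inner \<Rightarrow>\<^sub>L 'a"
  assumes "0 \<in> resolvent_set T"
  shows "\<exists>c>0. \<forall>x. norm (T x) \<ge> c * norm x"
proof -
  obtain R :: "'a \<Rightarrow>\<^sub>L 'a" where R: "\<And>x. R (T x - 0 *\<^sub>C x) = x" using assms by (auto simp: resolvent_set_def)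
  have "norm x \<le> (norm R + 1) * norm (T x)" for x
  proof -
    have "norm x \<le> norm R * norm (T x)" using norm_blinfun[of R "T x"] R[of x] by simp
    thus ?thesis by (simp add: algebra_simps add_increasing)
  qed
  moreover have "norm R + 1 > 0" using norm_ge_zero[of R] by linarith
  ultimately show ?thesis
    by (intro exI[of _ "1 / (norm R + 1)"]) (simp add: divide_le_eq mult.commute)
qed

text \<open>The lower bound gives injectivity and a closed range. A vector orthogonal to the range
  lies in the kernel by self-adjointness, hence is 0, so the range is everything; the inverse has
  norm at most 1/c.\<close>

lemma resolvent_if_bounded_below:
  fixes T :: "'a::chilbert_space \<Rightarrow>\<^sub>L 'a"
  assumes T: "selfadjoint_op T" and c: "c > 0" "\<And>x. norm (T x) \<ge> c * norm x"
  shows "0 \<in> resolvent_set T"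
proof -
  have cl: "T (a *\<^sub>C x) = a *\<^sub>C T x" for a x
    using T by (auto simp: selfadjoint_op_def clinear_op_def)
  have inj: "x = y" if "T x = T y" for x y
    using c(2)[of "x - y"] that c(1) by (simp add: blinfun.diff_right mult_le_0_iff)
  have "closed (range T)"
  proof (unfold closed_sequential_limits, intro allI impI, elim conjE)
    fix y l assume y: "\<forall>n. y n \<in> range T" "y \<longlonglongrightarrow> l"
    hence "\<forall>n. \<exists>x. y n = T x" by auto
    then obtain x where x: "\<And>n. y n = T (x n)" by metis
    have "norm (x m - x n) \<le> 1 / c * norm (y m - y n)" for m n
      using c(2)[of "x m - x n"] c(1) by (simp add: x blinfun.diff_right field_simps)
    hence "Cauchy x" using LIMSEQ_imp_Cauchy[OF y(2)] by (rule Cauchy_if_dominated)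
    then obtain k where "x \<longlonglongrightarrow> k" using Cauchy_convergent_iff convergent_def by blast
    hence "(\<lambda>n. T (x n)) \<longlonglongrightarrow> T k" by (intro tendsto_intros)
    hence "l = T k" using y(2) LIMSEQ_unique by (auto simp: x[symmetric])
    thus "l \<in> range T" by blast
  qed
  moreover have "csubspace (range T)"
    unfolding cvec.subspace_def
  proof (intro conjI ballI allI)
    show "0 \<in> range T" using rangeI[of T 0] by (simp add: blinfun.zero_right)
    show "x + y \<in> range T" if "x \<in> range T" "y \<in> range T" for x y
      using that by (auto simp: blinfun.add_right[symmetric])
    show "a *\<^sub>C x \<in> range T" if "x \<in> range T" for a x
      using that by (auto simp: cl[symmetric])
  qed
  ultimately have "range T = UNIV"
  proof (rule_tac ccontr)
    assume "closed (range T)" "csubspace (range T)" "range T \<noteq> UNIV"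
    then obtain x where x: "norm x = 1" "\<And>z. cinner x (T z) = 0"
      using ex_orthogonal_vector[of "range T"] by auto
    have "cinner (T x) z = 0" for z using T x(2) by (metis selfadjoint_op_def)
    hence "inner (T x) (T x) = 0" by (simp flip: Re_cinner)
    hence "T x = 0" by simp
    with c(1) c(2)[of x] x(1) show False by simp
  qed
  then have surj: "\<exists>x. T x = y" for y by (metis \<open>range T = UNIV\<close> rangeE UNIV_I)
  define R where "R = (\<lambda>y. SOME x. T x = y)"
  have TR: "T (R y) = y" for y unfolding R_def using someI_ex[OF surj] .
  have RT: "R (T x) = x" for x by (rule inj) (rule TR)
  have "bounded_linear R"
  proof (rule bounded_linear_intro)
    show "R (x + y) = R x + R y" for x y by (rule inj) (simp add: TR blinfun.add_right)
    show "R (r *\<^sub>R x) = r *\<^sub>R R x" for r x by (rule inj) (simp add: TR blinfun.scaleR_right)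
    show "norm (R x) \<le> norm x * (1 / c)" for x
      using c(2)[of "R x"] c(1) by (simp add: TR field_simps)
  qed
  hence R': "blinfun_apply (Blinfun R) = R" by (rule bounded_linear_Blinfun_apply)
  have "clinear_op (Blinfun R)"
    unfolding clinear_op_def R' by (intro allI, rule inj) (simp add: TR cl)
  thus ?thesis unfolding resolvent_set_def
    by (intro CollectI exI[of _ "Blinfun R"]) (simp add: R' TR RT)
qed

lemma approx_kernel_if_spectrum:
  fixes T :: "'a::chilbert_space \<Rightarrow>\<^sub>L 'a"
  assumes T: "selfadjoint_op T" "0 \<in> spectrum T" and e: "\<epsilon> > 0"
  shows "\<exists>x. norm x = 1 \<and> norm (T x) < \<epsilon>"
proof (rule ccontr)
  assume *: "\<not> ?thesis"
  have "norm (T x) \<ge> \<epsilon> * norm x" for x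
  proof (cases "x = 0")
    case False
    hence "norm (T ((1 / norm x) *\<^sub>R x)) \<ge> \<epsilon>" using *[unfolded not_ex, rule_format, of "(1 / norm x) *\<^sub>R x"] by simp
    thus ?thesis using False by (simp add: blinfun.scaleR_right field_simps)
  qed simp
  thus False using resolvent_if_bounded_below[OF T(1) e] T(2) by (simp add: spectrum_def)
qed

text \<open>The open mapping theorem for a closed linear relation. Baire's theorem on the closed
  range provides approximate preimages of proportional norm; correcting the residual again and again
  sums them to an exact preimage, which belongs to the relation because it is closed.\<close>

lemma open_mapping_graph:
  fixes T :: "('a::banach \<times> 'b::banach) set"
  assumes T: "subspace T" "closed T" "closed (Range T)"
  shows "\<exists>c>0. \<forall>y\<in>Range T. \<exists>x. (x, y) \<in> T \<and> norm x \<le> c * norm y"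
proof -
  define R where "R = Range T"
  have R: "subspace R"
    unfolding R_def Range_snd by (rule linear_subspace_image[OF linear_snd T(1)])
  define E where "E n = {y. \<exists>x. (x, y) \<in> T \<and> norm x \<le> real n}" for n :: nat
  have ER: "E n \<subseteq> R" for n by (auto simp: E_def R_def)
  have UE: "(\<Union>n. E n) = R"
    unfolding E_def R_def using real_arch_simple by fastforce
  let ?X = "top_of_set R"
  have "\<exists>n. ?X interior_of (?X closure_of E n) \<noteq> {}"
  proof (rule ccontr)
    assume *: "\<not> ?thesis"
    have "?X interior_of \<Union>(range (\<lambda>n. ?X closure_of E n)) = {}"
    proof (rule Baire_category_alt)
      show "completely_metrizable_space ?X \<or> locally_compact_space ?X \<and> regular_space ?X"
        using T(3) unfolding R_def
        by (metis closed_closedin completely_metrizable_space_closedin completely_metrizable_space_euclidean)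
    qed (use * in auto)
    moreover have "\<Union>(range (\<lambda>n. ?X closure_of E n)) = topspace ?X"
    proof
      show "\<Union>(range (\<lambda>n. ?X closure_of E n)) \<subseteq> topspace ?X"
        using closure_of_subset_topspace by fastforce
      show "topspace ?X \<subseteq> \<Union>(range (\<lambda>n. ?X closure_of E n))"
        using UE closure_of_subset[of "E n" ?X for n] ER by fastforce
    qed
    ultimately have "topspace ?X = {}" using interior_of_topspace by metis
    thus False using subspace_0[OF R] by auto
  qed
  then obtain n y0 where "y0 \<in> ?X interior_of (?X closure_of E n)" by blast
  then obtain U where U: "openin ?X U" "y0 \<in> U" "U \<subseteq> ?X closure_of E n"
    by (auto simp: interior_of_def)
  obtain e where e: "e > 0" "ball y0 e \<inter> R \<subseteq> U" and y0R: "y0 \<in> R"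
    using U(1,2) unfolding openin_contains_ball by blast
  have cl: "y \<in> closure (E n)" if "y \<in> R" "dist y0 y < e" for y
  proof -
    have "y \<in> ?X closure_of E n" using that e(2) U(3) by auto
    thus ?thesis using ER[of n] by (simp add: closure_of_subtopology Int_absorb1 euclidean_closure_of)
  qed
  \<comment> \<open>Two preimages of norm at most \<open>n\<close> differ by at most 2n, and
    dividing by a = e / (2 norm y) yields the factor 4n/e.\<close>
  define K where "K = 4 * real n / e"
  have K0: "K \<ge> 0" using e by (simp add: K_def)
  have "\<exists>xy\<in>T. norm (fst xy) \<le> K * norm y \<and> norm (y - snd xy) \<le> norm y / 2" if y: "y \<in> R" for y
  proof (cases "y = 0")
    case True
    thus ?thesis using subspace_0[OF T(1)] by (intro bexI[of _ 0]) auto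
  next
    case False
    \<comment> \<open>The point \<open>y0 + a *\<^sub>R y\<close> is at distance e/2 from
      \<open>y0\<close>, inside the ball where the image of the n-ball is dense. Two approximations
      with error e/8 then leave a residual of at most e/4 = a norm(y)/2.\<close>
    define a where "a = e / 2 / norm y"
    have a: "a > 0" using e False by (simp add: a_def)
    have an: "a * norm y = e / 2" using False by (simp add: a_def)
    have wR: "y0 + a *\<^sub>R y \<in> R" using R y y0R by (intro subspace_add subspace_scale)
    have "y0 + a *\<^sub>R y \<in> closure (E n)"
      by (rule cl[OF wR]) (use a an e(1) in \<open>simp add: dist_norm\<close>)
    then obtain p where p: "p \<in> E n" "dist p (y0 + a *\<^sub>R y) < e / 8"
      using e(1) unfolding closure_approachable by (meson divide_pos_pos zero_less_numeral)
    have "y0 \<in> closure (E n)" by (rule cl[OF y0R]) (use e in simp)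
    then obtain q where q: "q \<in> E n" "dist q y0 < e / 8"
      using e(1) unfolding closure_approachable by (meson divide_pos_pos zero_less_numeral)
    obtain xp xq where x: "(xp, p) \<in> T" "norm xp \<le> n" "(xq, q) \<in> T" "norm xq \<le> n"
      using p(1) q(1) by (auto simp: E_def)
    have mem: "(1 / a) *\<^sub>R ((xp, p) - (xq, q)) \<in> T"
      using T(1) x by (intro subspace_scale subspace_diff)
    have n1: "norm ((1 / a) *\<^sub>R (xp - xq)) \<le> K * norm y"
    proof -
      have "norm (xp - xq) \<le> 2 * n" using x norm_triangle_ineq4[of xp xq] by linarith
      hence "norm (xp - xq) / a \<le> 2 * n / a" using a by (intro divide_right_mono) auto
      also have "\<dots> = K * norm y" using False e by (simp add: a_def K_def)
      finally show ?thesis using a by simp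
    qed
    have n2: "norm (y - (1 / a) *\<^sub>R (p - q)) \<le> norm y / 2"
    proof -
      have "norm (a *\<^sub>R y - (p - q)) = norm ((y0 + a *\<^sub>R y - p) - (y0 - q))" by (simp add: algebra_simps)
      also have "\<dots> \<le> norm (y0 + a *\<^sub>R y - p) + norm (y0 - q)" by (rule norm_triangle_ineq4)
      also have "\<dots> \<le> e / 4" using p(2) q(2) by (simp add: dist_norm norm_minus_commute)
      also have "\<dots> = a * (norm y / 2)" using an by simp
      finally have "norm (a *\<^sub>R y - (p - q)) / a \<le> norm y / 2" using a by (simp add: field_simps)
      moreover have "y - (1 / a) *\<^sub>R (p - q) = (1 / a) *\<^sub>R (a *\<^sub>R y - (p - q))"
        using a by (simp add: algebra_simps)
      ultimately show ?thesis using a by simp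
    qed
    show ?thesis using mem n1 n2 by (intro bexI[OF _ mem]) auto
  qed
  then obtain f where f: "\<And>y. y \<in> R \<Longrightarrow> f y \<in> T" "\<And>y. y \<in> R \<Longrightarrow> norm (fst (f y)) \<le> K * norm y"
      "\<And>y. y \<in> R \<Longrightarrow> norm (y - snd (f y)) \<le> norm y / 2" by metis
  \<comment> \<open>The residuals \<open>r k\<close> at least halve at every step, so the geometric
    series gives the factor 2K. The additional 1 keeps the constant positive when n = 0.\<close>
  have "\<exists>x. (x, y) \<in> T \<and> norm x \<le> (2 * K + 1) * norm y" if y: "y \<in> R" for y
  proof -
    define r where "r k = ((\<lambda>z. z - snd (f z)) ^^ k) y" for k
    have rS: "r (Suc k) = r k - snd (f (r k))" for k by (simp add: r_def)
    have snd_R: "z \<in> R \<Longrightarrow> snd (f z) \<in> R" for z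
      using f(1)[of z] unfolding R_def by (metis Range.intros prod.collapse)
    have rR: "r k \<in> R" for k
    proof (induction k)
      case 0 show ?case by (simp add: r_def y)
    next
      case (Suc k) thus ?case unfolding rS by (intro subspace_diff[OF R] snd_R)
    qed
    have rle: "norm (r k) \<le> norm y * (1/2)^k" for k
    proof (induction k)
      case 0 show ?case by (simp add: r_def)
    next
      case (Suc k) thus ?case unfolding rS using f(3)[OF rR[of k]] by simp
    qed
    define x where "x k = fst (f (r k))" for k
    have xle: "norm (x k) \<le> K * norm y * (1/2)^k" for k
    proof -
      have "norm (x k) \<le> K * norm (r k)" unfolding x_def by (rule f(2)[OF rR])
      also have "\<dots> \<le> K * (norm y * (1/2)^k)" by (intro mult_left_mono rle K0)
      finally show ?thesis by (simp add: mult.assoc)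
    qed
    have sg: "summable (\<lambda>k. K * norm y * (1/2::real)^k)"
      by (intro summable_mult summable_geometric) simp
    have sn: "summable (\<lambda>k. norm (x k))"
      by (rule summable_comparison_test'[OF sg, of 0]) (use xle in auto)
    hence sx: "summable x" by (rule summable_norm_cancel)
    have "norm (suminf x) \<le> (\<Sum>k. norm (x k))" by (rule summable_norm[OF sn])
    also have "\<dots> \<le> (\<Sum>k. K * norm y * (1/2)^k)" by (intro suminf_le xle sn sg)
    also have "\<dots> = K * norm y * 2" by (subst suminf_mult) (auto simp: suminf_geometric summable_geometric)
    also have "\<dots> \<le> (2 * K + 1) * norm y" by (simp add: algebra_simps)
    finally have bound: "norm (suminf x) \<le> (2 * K + 1) * norm y" .
    have part: "((\<Sum>i<k. x i), y - r k) \<in> T" for k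
    proof (induction k)
      case 0 show ?case using subspace_0[OF T(1)] by (simp add: r_def zero_prod_def)
    next
      case (Suc k)
      have "((\<Sum>i<k. x i), y - r k) + f (r k) \<in> T" by (intro subspace_add[OF T(1)] Suc f(1) rR)
      moreover have "((\<Sum>i<k. x i), y - r k) + f (r k) = ((\<Sum>i<Suc k. x i), y - r (Suc k))"
        by (simp add: prod_eq_iff x_def rS)
      ultimately show ?case by simp
    qed
    have "(\<lambda>k. norm y * (1/2::real)^k) \<longlonglongrightarrow> norm y * 0" by (intro tendsto_intros LIMSEQ_power_zero) simp
    hence "r \<longlonglongrightarrow> 0"
      by (intro Lim_null_comparison[OF always_eventually, of r]) (use rle in auto)
    hence "(\<lambda>k. ((\<Sum>i<k. x i), y - r k)) \<longlonglongrightarrow> (suminf x, y - 0)"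
      by (intro tendsto_intros summable_LIMSEQ sx)
    hence "(suminf x, y) \<in> T" using closed_sequentially[OF T(2) part] by simp
    with bound show ?thesis by blast
  qed
  thus ?thesis using K0 unfolding R_def by (intro exI[of _ "2 * K + 1"]) auto
qed

section \<open>Kernels and closed ranges of linear relations\<close>

definition complex_linear_relation :: "('a::complex_inner \<times> 'a) set \<Rightarrow> bool" where
  "complex_linear_relation T \<longleftrightarrow> (0, 0) \<in> T \<and>
     (\<forall>x y x' y'. (x, y) \<in> T \<longrightarrow> (x', y') \<in> T \<longrightarrow> (x + x', y + y') \<in> T) \<and>
     (\<forall>c x y. (x, y) \<in> T \<longrightarrow> (c *\<^sub>C x, c *\<^sub>C y) \<in> T)"

lemma complex_linear_relationD:
  assumes "complex_linear_relation T"
  shows "(0, 0) \<in> T" "(x, y) \<in> T \<Longrightarrow> (x', y') \<in> T \<Longrightarrow> (x + x', y + y') \<in> T"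
    "(x, y) \<in> T \<Longrightarrow> (c *\<^sub>C x, c *\<^sub>C y) \<in> T"
    "(x, y) \<in> T \<Longrightarrow> (x', y') \<in> T \<Longrightarrow> (x - x', y - y') \<in> T"
proof -
  show "(0, 0) \<in> T" and add: "(x, y) \<in> T \<Longrightarrow> (x', y') \<in> T \<Longrightarrow> (x + x', y + y') \<in> T"
    and sc: "(x, y) \<in> T \<Longrightarrow> (c *\<^sub>C x, c *\<^sub>C y) \<in> T" for x y x' y' c
    using assms by (auto simp: complex_linear_relation_def)
  have m: "(-1) *\<^sub>C v = - v" for v :: 'a using scaleC_of_real[of "-1" v] by simp
  show "(x - x', y - y') \<in> T" if "(x, y) \<in> T" "(x', y') \<in> T"
    using add[OF that(1) sc[OF that(2), of "-1"]] by (simp add: m)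
qed

lemma subspace_complex_linear_relation: "complex_linear_relation T \<Longrightarrow> subspace T"
  using complex_linear_relationD(1,2)[of T] complex_linear_relationD(3)[of T _ _ "of_real _"]
  unfolding subspace_def by (auto simp: zero_prod_def scaleC_of_real)

lemma csubspace_Range: "complex_linear_relation T \<Longrightarrow> csubspace (Range T)"
  unfolding cvec.subspace_def by (blast intro: complex_linear_relationD(1,2,3))

text \<open>For \<open>T\<close>, subtract from \<open>x\<close> a short preimage of
  \<open>y\<close>. For the adjoint, the projection \<open>p\<close> of \<open>y\<close> to the
  closed range has a short preimage x, and norm(p)^2 = Re (z, x) bounds \<open>p\<close>, while
  \<open>y - p\<close> is in the adjoint kernel. One constant serves both, without the closed range
  theorem.\<close>

lemma closed_range_ker_dist:
  fixes T :: "('a::chilbert_space \<times> 'a) set"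
  assumes T: "complex_linear_relation T" "closed T" "closed (Range T)"
  shows "\<exists>c>0. \<forall>(x, y)\<in>T. \<exists>k\<in>op_ker T. norm (x - k) \<le> c * norm y"
    and "\<exists>c>0. \<forall>(y, z)\<in>op_adjoint T. \<exists>k\<in>op_ker (op_adjoint T). norm (y - k) \<le> c * norm z"
proof -
  obtain c where c: "c > 0" "\<And>y. y \<in> Range T \<Longrightarrow> \<exists>x. (x, y) \<in> T \<and> norm x \<le> c * norm y"
    using open_mapping_graph[OF subspace_complex_linear_relation[OF T(1)] T(2,3)] by blast
  have "\<exists>k\<in>op_ker T. norm (x - k) \<le> c * norm y" if xy: "(x, y) \<in> T" for x y
  proof -
    obtain x' where x': "(x', y) \<in> T" "norm x' \<le> c * norm y" using c(2) xy by blast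
    have "(x - x', 0) \<in> T" using complex_linear_relationD(4)[OF T(1) xy x'(1)] by simp
    thus ?thesis using x'(2) by (intro bexI[of _ "x - x'"]) (auto simp: op_ker_def)
  qed
  with c(1) show "\<exists>c>0. \<forall>(x, y)\<in>T. \<exists>k\<in>op_ker T. norm (x - k) \<le> c * norm y" by blast
  have "\<exists>k\<in>op_ker (op_adjoint T). norm (y - k) \<le> c * norm z" if yz: "(y, z) \<in> op_adjoint T" for y z
  proof -
    obtain p where p: "p \<in> Range T" "\<And>w. w \<in> Range T \<Longrightarrow> cinner (y - p) w = 0"
      using ex_cinner_projection[OF csubspace_Range[OF T(1)] T(3)] by blast
    obtain x where x: "(x, p) \<in> T" "norm x \<le> c * norm p" using c(2)[OF p(1)] by blast
    have k: "y - p \<in> op_ker (op_adjoint T)"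
      using p(2) by (auto simp: op_ker_def op_adjoint_def)
    have "cinner p p = cinner y p" using p(2)[OF p(1)] by (simp add: cinner_diff_left)
    also have "\<dots> = cinner z x" using yz x(1) by (auto simp: op_adjoint_def)
    finally have "inner p p = Re (cinner z x)" by (simp flip: Re_cinner)
    hence "norm p * norm p = inner z x" by (simp add: Re_cinner power2_norm_eq_inner flip: power2_eq_square)
    also have "\<dots> \<le> norm z * norm x" by (rule norm_cauchy_schwarz)
    also have "\<dots> \<le> norm z * (c * norm p)" by (intro mult_left_mono x) simp
    finally have *: "norm p * norm p \<le> c * norm z * norm p" by (simp add: mult_ac)
    have "norm p \<le> c * norm z"
      by (cases "norm p = 0") (use * c(1) in auto)
    thus ?thesis using k by (intro bexI[OF _ k]) simp
  qed
  with c(1) show "\<exists>c>0. \<forall>(y, z)\<in>op_adjoint T. \<exists>k\<in>op_ker (op_adjoint T). norm (y - k) \<le> c * norm z"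
    by blast
qed

text \<open>With \<open>N\<close> one more than the size of a spanning set, \<open>N\<close>
  orthonormal vectors that were all closer than 1/N to the space would have \<open>N\<close>
  linearly independent approximants in it.\<close>

lemma finite_dim_orthonormal_far:
  fixes V :: "'a::complex_inner set"
  assumes "finite_dim V"
  shows "\<exists>N>(0::nat). \<forall>f :: nat \<Rightarrow> 'a. (\<forall>i<N. \<forall>j<N. cinner (f i) (f j) = (if i = j then 1 else 0)) \<longrightarrow>
           (\<exists>i<N. \<forall>k\<in>V. norm (f i - k) \<ge> 1 / N)"
proof -
  obtain B where B: "finite B" "V \<subseteq> cspan B" using assms by (auto simp: finite_dim_def)
  define N where "N = Suc (card B)"
  have "\<exists>i<N. \<forall>k\<in>V. norm (f i - k) \<ge> 1 / N"
    if f: "\<forall>i<N. \<forall>j<N. cinner (f i) (f j) = (if i = j then 1 else 0)" for f :: "nat \<Rightarrow> 'a"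
  proof (rule ccontr)
    assume "\<not> ?thesis"
    hence *: "\<forall>i<N. \<exists>k. k \<in> V \<and> norm (f i - k) < 1 / N" by (simp add: not_le Bex_def)
    define k where "k i = (SOME k. k \<in> V \<and> norm (f i - k) < 1 / N)" for i
    have kk: "k i \<in> V \<and> norm (f i - k i) < 1 / N" if "i < N" for i
      unfolding k_def by (rule someI_ex) (rule *[rule_format, OF that])
    have k: "k i \<in> V" "norm (f i - k i) < 1 / N" if "i < N" for i
      using kk[OF that] by simp_all
    have indep: "c i = 0" if c: "(\<Sum>i<N. c i *\<^sub>C k i) = 0" and i: "i < N" for c i
    proof (rule ccontr)
      assume ci: "c i \<noteq> 0"
      \<comment> \<open>For the largest coefficient m one has m <= norm(sum c_i f_i) by
        orthonormality. As sum c_i k_i = 0, this vector is sum c_i (f_i - k_i), of norm less than N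
        m (1/N) = m.\<close>
      define m where "m = Max ((\<lambda>i. cmod (c i)) ` {..<N})"
      have mge: "cmod (c j) \<le> m" if "j < N" for j
        unfolding m_def by (rule Max_ge) (use that in auto)
      have mpos: "m > 0" using mge[OF i] ci by (meson less_le_trans zero_less_norm_iff)
      have "m \<in> (\<lambda>i. cmod (c i)) ` {..<N}" unfolding m_def by (rule Max_in) (use i in auto)
      then obtain j where j: "j < N" "m = cmod (c j)" by auto
      let ?x = "\<Sum>i<N. c i *\<^sub>C f i"
      have "m\<^sup>2 \<le> (\<Sum>i<N. (cmod (c i))\<^sup>2)"
        unfolding j(2) by (rule member_le_sum[of j _ "\<lambda>i. (cmod (c i))\<^sup>2"]) (use j in auto)
      also have "\<dots> = (norm ?x)\<^sup>2" by (rule norm_orthonormal_sum[symmetric]) (use f in auto)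
      finally have "m \<le> norm ?x" by (rule power2_le_imp_le) simp
      also have "?x = (\<Sum>i<N. c i *\<^sub>C (f i - k i))"
        using c by (simp add: cvec.scale_right_diff_distrib sum_subtractf)
      also have "norm \<dots> \<le> (\<Sum>i<N. norm (c i *\<^sub>C (f i - k i)))" by (rule norm_sum)
      also have "\<dots> < (\<Sum>i<N. m * (1 / N))"
      proof (rule sum_strict_mono)
        fix i assume "i \<in> {..<N}"
        hence "cmod (c i) * norm (f i - k i) \<le> m * norm (f i - k i)"
          by (intro mult_right_mono mge) auto
        also have "\<dots> < m * (1 / N)" using \<open>i \<in> {..<N}\<close> by (intro mult_strict_left_mono k mpos) auto
        finally show "norm (c i *\<^sub>C (f i - k i)) < m * (1 / N)" by (simp add: norm_scaleC)
      qed (use i in auto)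
      also have "\<dots> = m" using i by simp
      finally show False by simp
    qed
    \<comment> \<open>The dimension bound counts the set of the \<open>k i\<close>, so coincidences
      have to be excluded; one would give a vanishing combination with coefficients 1 and
      -1.\<close>
    have inj: "inj_on k {..<N}"
    proof (rule inj_onI, rule ccontr)
      fix i j assume ij: "i \<in> {..<N}" "j \<in> {..<N}" "k i = k j" "i \<noteq> j"
      define c :: "nat \<Rightarrow> complex" where "c = (\<lambda>l. if l = i then 1 else if l = j then -1 else 0)"
      have "(\<Sum>l<N. c l *\<^sub>C k l) = (\<Sum>l\<in>{i, j}. c l *\<^sub>C k l)"
        by (rule sum.mono_neutral_right) (use ij in \<open>auto simp: c_def\<close>)
      also have "\<dots> = 0" using ij by (simp add: c_def)
      finally have "c i = 0" using indep ij by auto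
      thus False by (simp add: c_def)
    qed
    have "\<not> cvec.dependent (k ` {..<N})"
    proof
      assume "cvec.dependent (k ` {..<N})"
      then obtain u v where u: "v \<in> k ` {..<N}" "u v \<noteq> 0" "(\<Sum>v\<in>k ` {..<N}. u v *\<^sub>C v) = 0"
        unfolding cvec.dependent_finite[OF finite_imageI[OF finite_lessThan]] by blast
      have "(\<Sum>i<N. u (k i) *\<^sub>C k i) = 0" using u(3) by (simp add: sum.reindex[OF inj])
      from indep[OF this] u(1,2) show False by auto
    qed
    moreover have "k ` {..<N} \<subseteq> cspan B" using k(1) B(2) by auto
    ultimately have "card (k ` {..<N}) \<le> card B"
      using cvec.independent_span_bound[OF B(1)] by blast
    thus False unfolding card_image[OF inj] by (simp add: N_def)
  qed
  thus ?thesis by (intro exI[of _ N]) (auto simp: N_def)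
qed

text \<open>Let q be the component of \<open>y\<close> orthogonal to \<open>R\<close>. If it is not
  0, the sum is the preimage of \<open>R\<close> under the continuous map that removes the component
  along q; otherwise the sum is \<open>R\<close> itself.\<close>

lemma closed_add_line:
  fixes R :: "'a::chilbert_space set"
  assumes R: "csubspace R" "closed R"
  shows "closed {z + c *\<^sub>C y | z c. z \<in> R}"
proof -
  obtain p where p: "p \<in> R" "\<And>z. z \<in> R \<Longrightarrow> cinner (y - p) z = 0"
    using ex_cinner_projection[OF R] by blast
  define q where "q = y - p"
  show ?thesis
  proof (cases "q = 0")
    case True
    hence "y \<in> R" using p(1) by (simp add: q_def)
    have "{z + c *\<^sub>C y | z c. z \<in> R} = R"
    proof (intro equalityI subsetI)
      fix w assume "w \<in> {z + c *\<^sub>C y | z c. z \<in> R}"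
      then obtain z c where "w = z + c *\<^sub>C y" "z \<in> R" by blast
      thus "w \<in> R" using cvec.subspace_add[OF R(1) _ cvec.subspace_scale[OF R(1) \<open>y \<in> R\<close>]] by simp
    next
      fix w assume "w \<in> R"
      moreover have "w = w + 0 *\<^sub>C y" by simp
      ultimately show "w \<in> {z + c *\<^sub>C y | z c. z \<in> R}" by blast
    qed
    thus ?thesis using R by simp
  next
    case False
    hence qq: "cinner q q \<noteq> 0" by (metis Re_cinner inner_eq_zero_iff zero_complex.sel(1))
    define g where "g w = w - (cinner q w / cinner q q) *\<^sub>C q" for w
    have "{z + c *\<^sub>C y | z c. z \<in> R} = {w. g w \<in> R}"
    proof (intro equalityI subsetI)
      fix w assume "w \<in> {z + c *\<^sub>C y | z c. z \<in> R}"
      then obtain z c where w: "w = z + c *\<^sub>C y" and z: "z \<in> R" by blast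
      have "z + c *\<^sub>C y = (z + c *\<^sub>C p) + c *\<^sub>C q" by (simp add: q_def cvec.scale_right_diff_distrib)
      moreover have zp: "z + c *\<^sub>C p \<in> R" using z p R by (intro cvec.subspace_add cvec.subspace_scale)
      moreover have "cinner q (z + c *\<^sub>C p) = 0" using p(2)[OF zp] by (simp add: q_def)
      ultimately have "cinner q (z + c *\<^sub>C y) = c * cinner q q"
        by (simp only: cinner_add_right[of q "z + c *\<^sub>C p"] cinner_scaleC_right add_0_left)
      hence "g (z + c *\<^sub>C y) = z + c *\<^sub>C p"
        unfolding g_def using qq by (simp add: q_def cvec.scale_right_diff_distrib)
      thus "w \<in> {w. g w \<in> R}" using zp by (simp add: w)
    next
      fix w assume "w \<in> {w. g w \<in> R}"
      hence w: "g w \<in> R" by simp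
      define c where "c = cinner q w / cinner q q"
      have "w = (g w - c *\<^sub>C p) + c *\<^sub>C y"
        by (simp add: g_def c_def q_def cvec.scale_right_diff_distrib)
      moreover have "g w - c *\<^sub>C p \<in> R" using w p R by (intro cvec.subspace_diff cvec.subspace_scale)
      ultimately show "w \<in> {z + c *\<^sub>C y | z c. z \<in> R}" by blast
    qed
    moreover have "closed {w. g w \<in> R}"
      unfolding closed_sequential_limits
    proof (intro allI impI, elim conjE)
      fix w l assume w: "\<forall>n. w n \<in> {w. g w \<in> R}" "w \<longlonglongrightarrow> l"
      have "(\<lambda>n. g (w n)) \<longlonglongrightarrow> g l"
        unfolding g_def by (intro tendsto_intros tendsto_scaleC tendsto_cinner w qq)
      thus "l \<in> {w. g w \<in> R}" using closed_sequentially[OF R(2), of "\<lambda>n. g (w n)"] w(1) by simp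
    qed
    ultimately show ?thesis by simp
  qed
qed

text \<open>Induction on the number of functionals. Without functionals the relation is injective
  with a bounded inverse, and its range is closed. Restricting to the kernel of one functional
  removes at most one dimension from the range and from the kernel, so both properties can be lifted
  back.\<close>

lemma closed_Range_if_estimate:
  fixes T :: "('a::chilbert_space \<times> 'a) set"
  assumes "complex_linear_relation T" "closed T"
    and "\<And>x y. (x, y) \<in> T \<Longrightarrow> norm x \<le> C * (norm y + (\<Sum>k<(N::nat). cmod (cinner (v k) x)))"
  shows "closed (Range T) \<and> finite_dim (op_ker T)"
  using assms
proof (induction N arbitrary: T)
  case 0
  have est: "norm x \<le> C * norm y" if "(x, y) \<in> T" for x y using 0(3)[OF that] by simp
  have "op_ker T \<subseteq> {0}" using est by (force simp: op_ker_def)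
  hence "finite_dim (op_ker T)" unfolding finite_dim_def by (intro exI[of _ "{}"]) simp
  moreover have "closed (Range T)"
    unfolding closed_sequential_limits
  proof (intro allI impI, elim conjE)
    fix y l assume y: "\<forall>n. y n \<in> Range T" "y \<longlonglongrightarrow> l"
    hence "\<forall>n. \<exists>x. (x, y n) \<in> T" by blast
    then obtain x where x: "\<And>n. (x n, y n) \<in> T" by metis
    have "norm (x m - x n) \<le> C * norm (y m - y n)" for m n
      by (rule est[OF complex_linear_relationD(4)[OF 0(1) x x]])
    hence "Cauchy x" using LIMSEQ_imp_Cauchy[OF y(2)] by (rule Cauchy_if_dominated)
    then obtain k where "x \<longlonglongrightarrow> k" using Cauchy_convergent_iff convergent_def by blast
    hence "(\<lambda>n. (x n, y n)) \<longlonglongrightarrow> (k, l)" by (intro tendsto_intros y)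
    hence "(k, l) \<in> T" by (rule closed_sequentially[OF 0(2) x])
    thus "l \<in> Range T" by blast
  qed
  ultimately show ?case by blast
next
  case (Suc N)
  note L = complex_linear_relationD[OF Suc.prems(1)]
  define T' where "T' = {(x, y). (x, y) \<in> T \<and> cinner (v N) x = 0}"
  have L': "complex_linear_relation T'"
    unfolding complex_linear_relation_def T'_def
    using L(1,2,3) by (auto simp: cinner_add_right cinner_scaleC_right)
  have "closed T'"
    unfolding closed_sequential_limits
  proof (intro allI impI, elim conjE)
    fix xy l assume xy: "\<forall>n. xy n \<in> T'" "xy \<longlonglongrightarrow> l"
    have "(\<lambda>n. cinner (v N) (fst (xy n))) \<longlonglongrightarrow> cinner (v N) (fst l)"
      by (intro tendsto_cinner tendsto_intros xy)
    moreover have "cinner (v N) (fst (xy n)) = 0" for n using xy(1) by (auto simp: T'_def split_beta)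
    ultimately have "cinner (v N) (fst l) = 0" by (simp add: LIMSEQ_const_iff)
    moreover have "xy n \<in> T" for n using xy(1)[rule_format, of n] by (auto simp: T'_def)
    hence "l \<in> T" by (rule closed_sequentially[OF Suc.prems(2) _ xy(2)])
    ultimately show "l \<in> T'" by (auto simp: T'_def split_beta)
  qed
  hence IH: "closed (Range T') \<and> finite_dim (op_ker T')"
  proof (rule Suc.IH[OF L'])
    show "norm x \<le> C * (norm y + (\<Sum>k<N. cmod (cinner (v k) x)))" if "(x, y) \<in> T'" for x y
      using Suc.prems(3)[of x y] that by (auto simp: T'_def)
  qed
  obtain B where B: "finite B" "op_ker T' \<subseteq> cspan B" using IH by (auto simp: finite_dim_def)
  have decomp: "(x - (cinner (v N) x / cinner (v N) x0) *\<^sub>C x0, y - (cinner (v N) x / cinner (v N) x0) *\<^sub>C y0) \<in> T'"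
    if "(x, y) \<in> T" "(x0, y0) \<in> T" "cinner (v N) x0 \<noteq> 0" for x y x0 y0
    unfolding T'_def using L(4)[OF that(1) L(3)[OF that(2)]] that(3)
    by (simp add: cinner_diff_right cinner_scaleC_right)
  have "closed (Range T)"
  proof (cases "\<exists>x0 y0. (x0, y0) \<in> T \<and> cinner (v N) x0 \<noteq> 0")
    case True
    then obtain x0 y0 where xy0: "(x0, y0) \<in> T" "cinner (v N) x0 \<noteq> 0" by blast
    have "Range T = {z + c *\<^sub>C y0 | z c. z \<in> Range T'}"
    proof (intro equalityI subsetI)
      fix y assume "y \<in> Range T"
      then obtain x where "(x, y) \<in> T" by blast
      from decomp[OF this xy0]
      have "y = (y - (cinner (v N) x / cinner (v N) x0) *\<^sub>C y0) + (cinner (v N) x / cinner (v N) x0) *\<^sub>C y0"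
        "y - (cinner (v N) x / cinner (v N) x0) *\<^sub>C y0 \<in> Range T'" by auto
      thus "y \<in> {z + c *\<^sub>C y0 | z c. z \<in> Range T'}" by blast
    next
      fix w assume "w \<in> {z + c *\<^sub>C y0 | z c. z \<in> Range T'}"
      then obtain x z c where w: "w = z + c *\<^sub>C y0" and "(x, z) \<in> T'" by blast
      hence "(x, z) \<in> T" by (simp add: T'_def)
      from L(2)[OF this L(3)[OF xy0(1), of c]] show "w \<in> Range T" unfolding w by blast
    qed
    thus ?thesis using closed_add_line[OF csubspace_Range[OF L']] IH by simp
  next
    case False
    hence "T' = T" by (auto simp: T'_def)
    thus ?thesis using IH by simp
  qed
  moreover have "finite_dim (op_ker T)"
  \<comment> \<open>The witness is now sought inside the kernel itself: the vector used for the
    range may have a nonzero image.\<close>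
  proof (cases "\<exists>x0. (x0, 0) \<in> T \<and> cinner (v N) x0 \<noteq> 0")
    case True
    then obtain x0 where x0: "(x0, 0) \<in> T" "cinner (v N) x0 \<noteq> 0" by blast
    have "op_ker T \<subseteq> cspan (insert x0 B)"
    proof
      fix x assume "x \<in> op_ker T"
      hence "x - (cinner (v N) x / cinner (v N) x0) *\<^sub>C x0 \<in> op_ker T'"
        using decomp[OF _ x0, of x 0] by (simp add: op_ker_def)
      thus "x \<in> cspan (insert x0 B)" using B(2) unfolding cvec.span_insert by blast
    qed
    thus ?thesis using B(1) unfolding finite_dim_def by (intro exI[of _ "insert x0 B"]) auto
  next
    case False
    hence "op_ker T \<subseteq> op_ker T'" by (auto simp: T'_def op_ker_def)
    thus ?thesis using B unfolding finite_dim_def by blast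
  qed
  ultimately show ?case by blast
qed

section \<open>Absolutely continuous functions\<close>

lemma set_integrable_eq_restrict:
  fixes f :: "real \<Rightarrow> 'b::{banach, second_countable_topology}"
  shows "A \<in> sets lborel \<Longrightarrow> set_integrable lborel A f \<longleftrightarrow> integrable (restrict_space lborel A) f"
  using integrable_restrict_space[of A lborel f] by (simp add: set_integrable_def)

lemma set_integral_eq_restrict:
  fixes f :: "real \<Rightarrow> 'b::{banach, second_countable_topology}"
  shows "A \<in> sets lborel \<Longrightarrow> set_lebesgue_integral lborel A f = integral\<^sup>L (restrict_space lborel A) f"
  using integral_restrict_space[of A lborel f] by (simp add: set_lebesgue_integral_def)

lemma locally_integrableD: "locally_integrable h \<Longrightarrow> set_integrable lborel {a..b} h"
  by (simp add: locally_integrable_def)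

lemma locally_integrable_interval:
  assumes "locally_integrable h"
  shows "interval_lebesgue_integrable lborel (ereal a) (ereal b) h"
proof -
  have "set_integrable lborel (einterval (ereal c) (ereal d)) h" for c d
    by (rule set_integrable_subset[OF locally_integrableD[OF assms, of c d]]) (auto simp: einterval_iff)
  thus ?thesis by (simp add: interval_lebesgue_integrable_def)
qed

lemma has_ac_derivative_diff:
  assumes "has_ac_derivative g h" "a \<le> b"
  shows "g b - g a = (LBINT s:{a..b}. h s)"
proof -
  have "g b = g a + (LBINT s=ereal a..ereal b. h s)" using assms(1) by (simp add: has_ac_derivative_def)
  thus ?thesis by (simp add: interval_integral_Icc[OF assms(2)])
qed

lemma has_ac_derivativeI:
  assumes h: "locally_integrable h" and g: "\<And>a b. a \<le> b \<Longrightarrow> g b - g a = (LBINT s:{a..b}. h s)"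
  shows "has_ac_derivative g h"
  unfolding has_ac_derivative_def
proof (intro conjI h allI)
  fix t0 t
  show "g t = g t0 + (LBINT s=ereal t0..ereal t. h s)"
  proof (cases "t0 \<le> t")
    case True
    thus ?thesis using g[OF True] by (simp add: interval_integral_Icc algebra_simps)
  next
    case False
    hence "g t0 - g t = (LBINT s=ereal t..ereal t0. h s)"
      using g[of t t0] by (simp add: interval_integral_Icc)
    thus ?thesis by (subst interval_integral_endpoints_reverse) (simp add: algebra_simps)
  qed
qed

lemma has_ac_derivative_primitive:
  assumes h: "locally_integrable h"
  shows "has_ac_derivative (\<lambda>t. c + (LBINT s=ereal t1..ereal t. h s)) h"
  unfolding has_ac_derivative_def
proof (intro conjI h allI)
  fix t0 t
  have "(LBINT s=ereal t1..ereal t0. h s) + (LBINT s=ereal t0..ereal t. h s) = (LBINT s=ereal t1..ereal t. h s)"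
    by (rule interval_integral_sum)
       (use locally_integrable_interval[OF h] in \<open>simp flip: ereal_min ereal_max\<close>)
  thus "c + (LBINT s=ereal t1..ereal t. h s) = c + (LBINT s=ereal t1..ereal t0. h s) + (LBINT s=ereal t0..ereal t. h s)"
    by (simp add: add.assoc)
qed

lemma has_ac_derivative_locally_integrable: "has_ac_derivative g h \<Longrightarrow> locally_integrable h"
  by (simp add: has_ac_derivative_def)

lemma locally_integrable_norm: "locally_integrable h \<Longrightarrow> locally_integrable (\<lambda>t. norm (h t))"
  by (simp add: locally_integrable_def set_integrable_norm)

lemma locally_integrable_add:
  "locally_integrable h \<Longrightarrow> locally_integrable k \<Longrightarrow> locally_integrable (\<lambda>t. h t + k t)"
  by (simp add: locally_integrable_def set_integral_add)

lemma integrable_locally_integrable: "integrable lborel h \<Longrightarrow> locally_integrable h"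
  unfolding locally_integrable_def set_integrable_def by (auto intro: integrable_mult_indicator)

text \<open>Dominated convergence for moving domains. All later uses concern intervals that grow,
  shrink to a point or escape to infinity, where membership of each point is eventually
  constant.\<close>

lemma tendsto_set_integral_sets:
  fixes f :: "real \<Rightarrow> 'b::{banach, second_countable_topology}"
  assumes f: "integrable lborel f" and A: "\<And>n::nat. A n \<in> sets lborel" "S \<in> sets lborel"
    and ev: "\<And>x. \<forall>\<^sub>F n in sequentially. x \<in> A n \<longleftrightarrow> x \<in> S"
  shows "(\<lambda>n. LBINT x:A n. f x) \<longlonglongrightarrow> (LBINT x:S. f x)"
  unfolding set_lebesgue_integral_def
proof (rule integral_dominated_convergence[where w = "\<lambda>x. norm (f x)"])
  have [measurable]: "f \<in> borel_measurable lborel" using f by simp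
  note A[measurable]
  show "(\<lambda>x. indicator S x *\<^sub>R f x) \<in> borel_measurable lborel" by measurable
  show "(\<lambda>x. indicator (A n) x *\<^sub>R f x) \<in> borel_measurable lborel" for n by measurable
  show "integrable lborel (\<lambda>x. norm (f x))" using f by simp
  show "AE x in lborel. (\<lambda>n. indicator (A n) x *\<^sub>R f x) \<longlonglongrightarrow> indicator S x *\<^sub>R f x"
  proof (rule AE_I2)
    fix x
    have "\<forall>\<^sub>F n in sequentially. indicator (A n) x *\<^sub>R f x = indicator S x *\<^sub>R f x"
      using ev[of x] by eventually_elim (simp add: indicator_def)
    thus "(\<lambda>n. indicator (A n) x *\<^sub>R f x) \<longlonglongrightarrow> indicator S x *\<^sub>R f x"
      by (rule tendsto_eventually)
  qed
  show "AE x in lborel. norm (indicator (A n) x *\<^sub>R f x) \<le> norm (f x)" for n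
    by (rule AE_I2) (simp add: indicator_def)
qed

text \<open>The last assumption keeps \<open>r\<close> in all the intervals, so the indicators
  converge at \<open>r\<close> too; the limit set is the null set containing only
  \<open>r\<close>.\<close>

lemma set_integral_small_intervals:
  fixes h :: "real \<Rightarrow> real"
  assumes h: "locally_integrable h" and s: "\<And>n. s n \<le> t n" "s \<longlonglongrightarrow> r" "t \<longlonglongrightarrow> r"
    "\<And>n. s n = r \<or> t n = r"
  shows "(\<lambda>n. LBINT x:{s n..t n}. h x) \<longlonglongrightarrow> 0"
proof -
  obtain K where K: "\<And>n. \<bar>s n\<bar> \<le> K" "\<And>n. \<bar>t n\<bar> \<le> K"
  proof -
    have "bounded (range s)" "bounded (range t)" using s by (auto intro: convergent_imp_bounded)
    then obtain a b where "\<And>n. \<bar>s n\<bar> \<le> a" "\<And>n. \<bar>t n\<bar> \<le> b" unfolding bounded_iff by auto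
    thus ?thesis by (intro that[of "max a b"]) (auto simp: le_max_iff_disj)
  qed
  let ?f = "\<lambda>x. indicator {-K..K} x *\<^sub>R h x"
  have f: "integrable lborel ?f" using locally_integrableD[OF h] by (simp add: set_integrable_def)
  have "(\<lambda>n. LBINT x:{s n..t n}. ?f x) \<longlonglongrightarrow> (LBINT x:{r}. ?f x)"
  proof (rule tendsto_set_integral_sets[OF f])
    fix x
    show "\<forall>\<^sub>F n in sequentially. x \<in> {s n..t n} \<longleftrightarrow> x \<in> {r}"
    proof (cases x r rule: linorder_cases)
      case less
      hence "\<forall>\<^sub>F n in sequentially. s n > x" using s by (intro order_tendstoD) auto
      thus ?thesis using less by (auto elim: eventually_mono)
    next
      case greater
      hence "\<forall>\<^sub>F n in sequentially. t n < x" using s by (intro order_tendstoD) auto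
      thus ?thesis using greater by (auto elim: eventually_mono)
    next
      case equal
      have "x \<in> {s n..t n}" for n using s(1)[of n] s(4)[of n] equal by auto
      thus ?thesis using equal by simp
    qed
  qed auto
  moreover have "(LBINT x:{r}. ?f x) = 0" 
    unfolding set_lebesgue_integral_def
    by (rule integral_eq_zero_AE) (use AE_lborel_singleton[of r] in \<open>auto simp: indicator_def\<close>)
  moreover have "(LBINT x:{s n..t n}. ?f x) = (LBINT x:{s n..t n}. h x)" for n
    unfolding set_lebesgue_integral_def using K[of n]
    by (intro Bochner_Integration.integral_cong) (auto simp: indicator_def)
  ultimately show ?thesis by simp
qed

lemma set_integral_Icc_split:
  assumes h: "locally_integrable h" "a \<le> b" "b \<le> c"
  shows "(LBINT x:{a..c}. h x) = (LBINT x:{a..b}. h x) + (LBINT x:{b..c}. h x)"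
  using has_ac_derivative_diff[OF has_ac_derivative_primitive[OF h(1), of 0 0], of a c]
    has_ac_derivative_diff[OF has_ac_derivative_primitive[OF h(1), of 0 0], of a b]
    has_ac_derivative_diff[OF has_ac_derivative_primitive[OF h(1), of 0 0], of b c] h(2,3)
  by (simp add: algebra_simps)

lemma norm_has_ac_derivative_diff_le:
  assumes "has_ac_derivative g h" "a \<le> b"
  shows "norm (g b - g a) \<le> (LBINT s:{a..b}. norm (h s))"
  unfolding has_ac_derivative_diff[OF assms]
  by (rule set_integral_norm_bound[OF locally_integrableD[OF has_ac_derivative_locally_integrable[OF assms(1)]]])

lemma has_ac_derivative_continuous:
  fixes g :: "real \<Rightarrow> 'b::{banach, second_countable_topology}"
  assumes g: "has_ac_derivative g h"
  shows "continuous_on UNIV g"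
  unfolding continuous_on_eq_continuous_at[OF open_UNIV]
proof
  fix r :: real
  show "isCont g r"
    unfolding continuous_at_sequentially o_def
  proof (intro allI impI)
    fix t :: "nat \<Rightarrow> real" assume t: "t \<longlonglongrightarrow> r"
    have "(\<lambda>n. LBINT x:{min r (t n)..max r (t n)}. norm (h x)) \<longlonglongrightarrow> 0"
    proof (rule set_integral_small_intervals)
      show "locally_integrable (\<lambda>x. norm (h x))"
        by (intro locally_integrable_norm has_ac_derivative_locally_integrable[OF g])
      have "(\<lambda>n. min r (t n)) \<longlonglongrightarrow> min r r" by (intro tendsto_intros t)
      thus "(\<lambda>n. min r (t n)) \<longlonglongrightarrow> r" by simp
      have "(\<lambda>n. max r (t n)) \<longlonglongrightarrow> max r r" by (intro tendsto_intros t)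
      thus "(\<lambda>n. max r (t n)) \<longlonglongrightarrow> r" by simp
    qed (auto simp: min_def max_def)
    hence lim: "(\<lambda>n. LBINT x:{min r (t n)..max r (t n)}. norm (h x)) \<longlonglongrightarrow> 0" .
    have "norm (g (t n) - g r) \<le> (LBINT x:{min r (t n)..max r (t n)}. norm (h x))" for n
      using norm_has_ac_derivative_diff_le[OF g, of r "t n"] norm_has_ac_derivative_diff_le[OF g, of "t n" r]
      by (cases "r \<le> t n") (auto simp: min_def max_def norm_minus_commute)
    hence "(\<lambda>n. g (t n) - g r) \<longlonglongrightarrow> 0"
      by (intro Lim_null_comparison[OF _ lim] always_eventually allI)
    thus "(\<lambda>n. g (t n)) \<longlonglongrightarrow> g r" by (rule LIM_zero_cancel)
  qed
qed

text \<open>Over a fine partition the squared increments of a continuous monotone control sum to an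
  arbitrarily small number. This is how the product rule is obtained without almost everywhere
  differentiation.\<close>

lemma constant_if_quadratic_increments:
  fixes G :: "real \<Rightarrow> 'b::real_normed_vector" and M :: "real \<Rightarrow> real"
  assumes M: "continuous_on UNIV M" "mono M" and G: "\<And>s t. s \<le> t \<Longrightarrow> norm (G t - G s) \<le> (M t - M s)\<^sup>2"
    and ab: "a \<le> b"
  shows "G b = G a"
proof -
  have "norm (G b - G a) \<le> 0 + \<epsilon>" if e: "\<epsilon> > 0" for \<epsilon>
  proof -
    \<comment> \<open>If every increment of \<open>M\<close> is at most \<eta>, the squares sum to
      at most \<eta> (M b - M a) <= \<epsilon>. The added 1 covers M b = M a.\<close>
    define \<eta> where "\<eta> = \<epsilon> / (M b - M a + 1)"
    have Mab: "M b - M a \<ge> 0" using M(2) ab by (simp add: mono_def)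
    have eta: "\<eta> > 0" using e Mab by (simp add: \<eta>_def)
    have "uniformly_continuous_on {a..b} M"
      using M(1) by (intro compact_uniformly_continuous) (auto intro: continuous_on_subset)
    then obtain d where d: "d > 0" "\<And>x y. x \<in> {a..b} \<Longrightarrow> y \<in> {a..b} \<Longrightarrow> dist y x < d \<Longrightarrow> dist (M y) (M x) < \<eta>"
      using eta unfolding uniformly_continuous_on_def by metis
    obtain n :: nat where n: "(b - a) / d < n" using reals_Archimedean2 by blast
    hence n0: "n > 0" using ab d(1) by (intro gr0I) (auto simp: divide_less_0_iff)
    define p where "p i = a + (b - a) * (i / n)" for i :: nat
    have pmono: "p i \<le> p (Suc i)" for i
      using ab by (simp add: p_def divide_right_mono mult_left_mono)
    have pab: "p i \<in> {a..b}" if "i \<le> n" for i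
    proof -
      have "0 \<le> (b - a) * (i / n)" "(b - a) * (i / n) \<le> (b - a) * 1"
        using ab that n0 by (auto intro!: mult_left_mono simp: divide_le_eq)
      thus ?thesis by (simp add: p_def)
    qed
    have step: "norm (G (p (Suc i)) - G (p i)) \<le> \<eta> * (M (p (Suc i)) - M (p i))" if "i < n" for i
    proof -
      have "p (Suc i) - p i = (b - a) / n" by (simp add: p_def field_simps add_divide_distrib)
      also have "\<dots> < d" using n n0 d(1) by (simp add: field_simps)
      finally have "dist (p (Suc i)) (p i) < d" using pmono[of i] by (simp add: dist_real_def)
      hence "M (p (Suc i)) - M (p i) \<le> \<eta>"
        using d(2)[of "p i" "p (Suc i)"] pab[of i] pab[of "Suc i"] that by (simp add: dist_real_def)
      moreover have "0 \<le> M (p (Suc i)) - M (p i)" using M(2) pmono[of i] by (simp add: mono_def)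
      ultimately have "(M (p (Suc i)) - M (p i))\<^sup>2 \<le> \<eta> * (M (p (Suc i)) - M (p i))"
        unfolding power2_eq_square by (intro mult_right_mono) auto
      thus ?thesis using G[OF pmono[of i]] by linarith
    qed
    have "G (p n) - G (p 0) = (\<Sum>i<n. G (p (Suc i)) - G (p i))" by (rule sum_lessThan_telescope[symmetric])
    hence "norm (G (p n) - G (p 0)) \<le> (\<Sum>i<n. norm (G (p (Suc i)) - G (p i)))"
      by (simp add: norm_sum)
    also have "\<dots> \<le> (\<Sum>i<n. \<eta> * (M (p (Suc i)) - M (p i)))" by (intro sum_mono step) simp
    also have "\<dots> = \<eta> * (M (p n) - M (p 0))"
      unfolding sum_distrib_left[symmetric] by (subst sum_lessThan_telescope) simp
    finally have "norm (G (p n) - G (p 0)) \<le> \<eta> * (M (p n) - M (p 0))" .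
    moreover have "p n = b" "p 0 = a" using n0 by (simp_all add: p_def)
    moreover have "\<eta> * (M b - M a) \<le> \<epsilon>" using Mab e by (simp add: \<eta>_def field_simps)
    ultimately show ?thesis by simp
  qed
  hence "norm (G b - G a) \<le> 0" by (rule field_le_epsilon)
  thus ?thesis by simp
qed

lemma locally_integrable_bounded_mult:
  fixes f :: "real \<Rightarrow> 'b::{banach, second_countable_topology}" and k :: "real \<Rightarrow> real"
  assumes k: "locally_integrable k" and f: "\<And>a b. set_borel_measurable lborel {a..b} f"
    and bd: "\<And>a b. \<exists>C. \<forall>t\<in>{a..b}. norm (f t) \<le> C * k t"
  shows "locally_integrable f"
  unfolding locally_integrable_def
proof (intro allI)
  fix a b :: real
  obtain C where C: "\<And>t. t \<in> {a..b} \<Longrightarrow> norm (f t) \<le> C * k t" using bd by blast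
  show "set_integrable lborel {a..b} f"
  proof (rule set_integrable_bound)
    show "set_integrable lborel {a..b} (\<lambda>t. C * k t)"
      using locally_integrableD[OF k] by (simp add: set_integrable_mult_right)
    show "set_borel_measurable lborel {a..b} f" by (rule f)
    show "AE x in lborel. x \<in> {a..b} \<longrightarrow> norm (f x) \<le> norm (C * k x)"
      using C by (intro AE_I2) (metis abs_ge_self order.trans real_norm_def)
  qed
qed

lemma continuous_bounded_interval:
  fixes u :: "real \<Rightarrow> 'b::real_normed_vector"
  assumes "continuous_on UNIV u"
  shows "\<exists>C\<ge>0. \<forall>t\<in>{a..b}. norm (u t) \<le> C"
proof -
  have "compact (u ` {a..b})"
    by (intro compact_continuous_image continuous_on_subset[OF assms]) auto
  hence "bounded (u ` {a..b})" by (rule compact_imp_bounded)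
  then obtain C where "\<forall>t\<in>{a..b}. norm (u t) \<le> C" by (auto simp: bounded_iff)
  thus ?thesis by (intro exI[of _ "max C 0"]) (auto simp: le_max_iff_disj)
qed

section \<open>The product rule for absolutely continuous functions\<close>

lemma locally_integrable_inner_continuous:
  fixes u v :: "real \<Rightarrow> 'h::{chilbert_space, second_countable_topology}"
  assumes u: "locally_integrable u" and v: "continuous_on UNIV v"
  shows "locally_integrable (\<lambda>t. inner (u t) (v t))"
proof (rule locally_integrable_bounded_mult[OF locally_integrable_norm[OF u]])
  fix a b
  have [measurable]: "v \<in> borel_measurable borel" by (rule borel_measurable_continuous_onI[OF v])
  have [measurable]: "(\<lambda>x. indicator {a..b} x *\<^sub>R u x) \<in> borel_measurable lborel"
    using locally_integrableD[OF u, of a b] by (simp add: set_integrable_def)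
  have "(\<lambda>x. inner (indicator {a..b} x *\<^sub>R u x) (v x)) \<in> borel_measurable lborel" by measurable
  thus "set_borel_measurable lborel {a..b} (\<lambda>t. inner (u t) (v t))"
    by (simp add: set_borel_measurable_def)
  obtain C where C: "\<And>t. t \<in> {a..b} \<Longrightarrow> norm (v t) \<le> C" using continuous_bounded_interval[OF v] by blast
  have "norm (inner (u t) (v t)) \<le> C * norm (u t)" if "t \<in> {a..b}" for t
  proof -
    have "norm (inner (u t) (v t)) \<le> norm (u t) * norm (v t)"
      using Cauchy_Schwarz_ineq2 by simp
    also have "\<dots> \<le> norm (u t) * C" by (intro mult_left_mono C that) simp
    finally show ?thesis by (simp add: mult.commute)
  qed
  thus "\<exists>C. \<forall>t\<in>{a..b}. norm (inner (u t) (v t)) \<le> C * norm (u t)" by blast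
qed

text \<open>Let G be the product minus the primitive of the expected derivative. Its increments are
  at most the squared increments of the primitive \<open>M\<close> of norm(u') + norm(v'), so G is
  constant.\<close>

lemma has_ac_derivative_inner:
  fixes u v :: "real \<Rightarrow> 'h::{chilbert_space, second_countable_topology}"
  assumes u: "has_ac_derivative u u'" and v: "has_ac_derivative v v'"
  shows "has_ac_derivative (\<lambda>t. inner (u t) (v t)) (\<lambda>t. inner (u' t) (v t) + inner (u t) (v' t))"
proof -
  note lu = has_ac_derivative_locally_integrable[OF u] and lv = has_ac_derivative_locally_integrable[OF v]
  note cu = has_ac_derivative_continuous[OF u] and cv = has_ac_derivative_continuous[OF v]
  have l1: "locally_integrable (\<lambda>t. inner (u' t) (v t))" by (rule locally_integrable_inner_continuous[OF lu cv])
  have l2: "locally_integrable (\<lambda>t. inner (u t) (v' t))"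
    using locally_integrable_inner_continuous[OF lv cu] by (simp add: inner_commute)
  define k where "k t = norm (u' t) + norm (v' t)" for t
  have lk: "locally_integrable k"
    unfolding k_def by (intro locally_integrable_add locally_integrable_norm lu lv)
  define M where "M = (\<lambda>t. LBINT s=ereal 0..ereal t. k s)"
  have acM: "has_ac_derivative M k"
    using has_ac_derivative_primitive[OF lk, of 0 0] by (simp add: M_def)
  have Mdiff: "M t - M s = (LBINT r:{s..t}. k r)" if "s \<le> t" for s t
    by (rule has_ac_derivative_diff[OF acM that])
  have monoM: "mono M"
  proof (rule monoI)
    fix s t :: real assume "s \<le> t"
    have "0 \<le> (LBINT r:{s..t}. k r)"
      unfolding set_lebesgue_integral_def by (intro integral_nonneg_AE AE_I2) (simp add: k_def)
    thus "M s \<le> M t" using Mdiff[OF \<open>s \<le> t\<close>] by simp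
  qed
  let ?q = "\<lambda>t. inner (u' t) (v t) + inner (u t) (v' t)"
  have lq: "locally_integrable ?q" by (rule locally_integrable_add[OF l1 l2])
  define P where "P = (\<lambda>t. LBINT s=ereal 0..ereal t. ?q s)"
  have acP: "has_ac_derivative P ?q"
    using has_ac_derivative_primitive[OF lq, of 0 0] by (simp add: P_def)
  define G where "G t = inner (u t) (v t) - P t" for t
  have incr: "norm (G t - G s) \<le> (M t - M s)\<^sup>2" if st: "s \<le> t" for s t
  proof -
    let ?R = "restrict_space lborel {s..t}"
    have iu: "integrable ?R u'" and iv: "integrable ?R v'" and i1: "integrable ?R (\<lambda>r. inner (u' r) (v r))"
      and i2: "integrable ?R (\<lambda>r. inner (u r) (v' r))" and ik: "integrable ?R k"
      using locally_integrableD[OF lu] locally_integrableD[OF lv] locally_integrableD[OF l1]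
        locally_integrableD[OF l2] locally_integrableD[OF lk]
      by (simp_all add: set_integrable_eq_restrict)
    have eu: "u t - u s = integral\<^sup>L ?R u'" and ev: "v t - v s = integral\<^sup>L ?R v'"
      and eP: "P t - P s = integral\<^sup>L ?R ?q" and eM: "M t - M s = integral\<^sup>L ?R k"
      using has_ac_derivative_diff[OF u st] has_ac_derivative_diff[OF v st]
        has_ac_derivative_diff[OF acP st] Mdiff[OF st] by (simp_all add: set_integral_eq_restrict)
    \<comment> \<open>One factor is frozen at the right endpoint and the other at the left one.
      Comparing with the true integrand leaves u' and v' multiplied by increments of v and u, each
      at most \<open>M t - M s\<close>.\<close>
    have "inner (u t) (v t) - inner (u s) (v s) = inner (u t - u s) (v t) + inner (u s) (v t - v s)"
      by (simp add: inner_diff_left inner_diff_right)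
    also have "\<dots> = (\<integral>r. inner (u' r) (v t) + inner (u s) (v' r) \<partial>?R)"
      unfolding eu ev using iu iv by simp
    finally have "G t - G s = (\<integral>r. inner (u' r) (v t) + inner (u s) (v' r) \<partial>?R) - integral\<^sup>L ?R ?q"
      using eP by (simp add: G_def)
    also have "\<dots> = (\<integral>r. (inner (u' r) (v t) + inner (u s) (v' r)) - ?q r \<partial>?R)"
      by (rule Bochner_Integration.integral_diff[symmetric])
         (intro Bochner_Integration.integrable_add integrable_inner_left integrable_inner_right iu iv i1 i2)+
    also have "\<dots> = (\<integral>r. inner (u' r) (v t - v r) + inner (u s - u r) (v' r) \<partial>?R)"
      by (rule Bochner_Integration.integral_cong) (simp_all add: inner_diff_left inner_diff_right)
    finally have "norm (G t - G s) \<le> (\<integral>r. norm (inner (u' r) (v t - v r) + inner (u s - u r) (v' r)) \<partial>?R)"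
      by simp
    also have "\<dots> \<le> (\<integral>r. (M t - M s) * k r \<partial>?R)"
    proof (rule integral_mono)
      show "integrable ?R (\<lambda>r. (M t - M s) * k r)" using ik by simp
      have "integrable ?R (\<lambda>r. (inner (u' r) (v t) + inner (u s) (v' r)) - ?q r)"
        by (intro Bochner_Integration.integrable_diff Bochner_Integration.integrable_add
            integrable_inner_left integrable_inner_right iu iv i1 i2)
      thus "integrable ?R (\<lambda>r. norm (inner (u' r) (v t - v r) + inner (u s - u r) (v' r)))"
        by (intro integrable_norm) (simp add: inner_diff_left inner_diff_right algebra_simps)
    next
      fix r assume "r \<in> space ?R"
      hence r: "s \<le> r" "r \<le> t" by (auto simp: space_restrict_space)
      have nv: "norm (v t - v r) \<le> M t - M s"
      proof -
        have "norm (v t - v r) \<le> (LBINT x:{r..t}. norm (v' x))"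
          by (rule norm_has_ac_derivative_diff_le[OF v r(2)])
        also have "\<dots> \<le> (LBINT x:{r..t}. k x)"
          by (rule set_integral_mono)
             (auto simp: k_def intro!: locally_integrableD locally_integrable_norm lv lk[unfolded k_def])
        also have "\<dots> = M t - M r" by (rule Mdiff[OF r(2), symmetric])
        finally show ?thesis using monoM r(1) by (meson diff_left_mono monoD order.trans)
      qed
      have nu: "norm (u s - u r) \<le> M t - M s"
      proof -
        have "norm (u r - u s) \<le> (LBINT x:{s..r}. norm (u' x))"
          by (rule norm_has_ac_derivative_diff_le[OF u r(1)])
        also have "\<dots> \<le> (LBINT x:{s..r}. k x)"
          by (rule set_integral_mono)
             (auto simp: k_def intro!: locally_integrableD locally_integrable_norm lu lk[unfolded k_def])
        also have "\<dots> = M r - M s" by (rule Mdiff[OF r(1), symmetric])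
        finally show ?thesis using monoM r(2)
          by (metis diff_right_mono monoD norm_minus_commute order.trans)
      qed
      have "norm (inner (u' r) (v t - v r) + inner (u s - u r) (v' r))
          \<le> norm (u' r) * norm (v t - v r) + norm (u s - u r) * norm (v' r)"
        using Cauchy_Schwarz_ineq2[of "u' r" "v t - v r"] Cauchy_Schwarz_ineq2[of "u s - u r" "v' r"]
        by (simp add: abs_le_iff)
      also have "\<dots> \<le> norm (u' r) * (M t - M s) + (M t - M s) * norm (v' r)"
        by (intro add_mono mult_left_mono mult_right_mono nv nu) auto
      also have "\<dots> = (M t - M s) * k r" by (simp add: k_def algebra_simps)
      finally show "norm (inner (u' r) (v t - v r) + inner (u s - u r) (v' r)) \<le> (M t - M s) * k r" .
    qed
    also have "\<dots> = (M t - M s) * (M t - M s)" using eM by simp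
    finally show ?thesis by (simp add: power2_eq_square)
  qed
  show ?thesis
  proof (rule has_ac_derivativeI[OF lq])
    fix a b :: real assume ab: "a \<le> b"
    have "G b = G a"
      by (rule constant_if_quadratic_increments[OF has_ac_derivative_continuous[OF acM] monoM incr ab])
    thus "inner (u b) (v b) - inner (u a) (v a) = (LBINT s:{a..b}. ?q s)"
      using has_ac_derivative_diff[OF acP ab] by (simp add: G_def algebra_simps)
  qed
qed

section \<open>The Sobolev space and the adjoint of the derivative\<close>

text \<open>The relation between functions behind \<open>ddt_op\<close>. Point values, such as the
  boundary value at 0, belong to the continuous representative and not to its class.\<close>

definition has_W12_derivative ::
    "(real \<Rightarrow> 'h::{chilbert_space, second_countable_topology}) \<Rightarrow> (real \<Rightarrow> 'h) \<Rightarrow> bool" where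
  "has_W12_derivative u u' \<longleftrightarrow> sq_integrable u \<and> sq_integrable u' \<and> has_ac_derivative u u'"

section \<open>Pointwise bounds and integration by parts for Sobolev functions\<close>

lemma ddt_op_iff: "(x, y) \<in> ddt_op \<longleftrightarrow> (\<exists>u u'. x = abs_l2 u \<and> y = abs_l2 u' \<and> has_W12_derivative u u')"
  by (auto simp: ddt_op_def has_W12_derivative_def)

lemma locally_integrable_const: "locally_integrable (\<lambda>_. c :: real)"
proof -
  have "integrable lborel (\<lambda>x. indicator {a..b} x * c)" for a b :: real
    by (intro integrable_mult_left integrable_real_indicator) (auto simp: emeasure_lborel_Icc_eq)
  thus ?thesis by (simp add: locally_integrable_def set_integrable_def)
qed

lemma set_integral_const_Icc: "a \<le> b \<Longrightarrow> (LBINT s:{a..b}. c) = (b - a) * (c :: real)"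
  by (simp add: set_lebesgue_integral_def)

lemma sq_integrable_locally_integrable:
  assumes "sq_integrable f"
  shows "locally_integrable f"
proof (rule locally_integrable_bounded_mult)
  note locally_integrable_const[of 1]
  moreover have "locally_integrable (\<lambda>t. (norm (f t))\<^sup>2)"
    using assms by (intro integrable_locally_integrable) (simp add: sq_integrable_def)
  ultimately show "locally_integrable (\<lambda>t. 1 + (norm (f t))\<^sup>2)" by (rule locally_integrable_add)
  have [measurable]: "f \<in> borel_measurable lborel" using assms by (simp add: sq_integrable_def)
  show "set_borel_measurable lborel {a..b} f" for a b
    unfolding set_borel_measurable_def by measurable
  have "norm (f t) \<le> 1 * (1 + (norm (f t))\<^sup>2)" for t
  proof -
    have "0 \<le> (norm (f t) - 1)\<^sup>2" by simp
    moreover have "0 \<le> (norm (f t))\<^sup>2" by simp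
    ultimately have "2 * norm (f t) \<le> (norm (f t))\<^sup>2 + 1" by (simp add: power2_diff)
    moreover have "norm (f t) \<le> 2 * norm (f t)" by simp
    ultimately have "norm (f t) \<le> (norm (f t))\<^sup>2 + 1" by (rule order.trans[rotated])
    thus ?thesis by simp
  qed
  thus "\<exists>C. \<forall>t\<in>{a..b}. norm (f t) \<le> C * (1 + (norm (f t))\<^sup>2)" for a b by blast
qed

lemma sq_integrable_norm_sq: "sq_integrable f \<Longrightarrow> integrable lborel (\<lambda>t. (norm (f t))\<^sup>2)"
  by (simp add: sq_integrable_def)

lemma abs_inner_le: "\<bar>inner x y\<bar> \<le> ((norm x)\<^sup>2 + (norm y)\<^sup>2) / 2"
proof -
  have "\<bar>inner x y\<bar> \<le> norm x * norm y" by (rule Cauchy_Schwarz_ineq2)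
  also have "\<dots> \<le> ((norm x)\<^sup>2 + (norm y)\<^sup>2) / 2"
    using sum_squares_bound[of "norm x" "norm y"] by simp
  finally show ?thesis .
qed

text \<open>A local Sobolev inequality: norm(u)^2 changes on the unit interval by at most the
  integral of norm(u)^2 + norm(u')^2. Keeping the right-hand side local gives both the uniform bound
  and the decay at infinity.\<close>

lemma has_W12_derivative_decay:
  assumes u: "has_W12_derivative u u'"
  shows "(norm (u t))\<^sup>2 \<le> (LBINT r:{t..t+1}. 2 * (norm (u r))\<^sup>2 + (norm (u' r))\<^sup>2)"
proof -
  define Q where "Q = (\<lambda>t. inner (u t) (u t))"
  define q where "q = (\<lambda>t. inner (u' t) (u t) + inner (u t) (u' t))"
  have ac: "has_ac_derivative Q q"
    unfolding Q_def q_def by (intro has_ac_derivative_inner) (use u in \<open>simp_all add: has_W12_derivative_def\<close>)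
  have lq: "locally_integrable q" by (rule has_ac_derivative_locally_integrable[OF ac])
  define p where "p r = (norm (u r))\<^sup>2 + (norm (u' r))\<^sup>2" for r
  have ip: "integrable lborel p" and iQ: "integrable lborel Q"
    unfolding p_def Q_def power2_norm_eq_inner[symmetric]
    using u by (auto simp: has_W12_derivative_def sq_integrable_norm_sq)
  note lp = integrable_locally_integrable[OF ip] and lQ = integrable_locally_integrable[OF iQ]
  have qp: "norm (q r) \<le> p r" for r
    using abs_inner_le[of "u' r" "u r"] unfolding q_def p_def real_norm_def
    by (simp add: inner_commute[of "u r" "u' r"])
  define c where "c = (LBINT r:{t..t+1}. p r)"
  have Qle: "Q t \<le> Q s + c" if s: "s \<in> {t..t+1}" for s
  proof -
    have "norm (Q s - Q t) \<le> (LBINT r:{t..s}. norm (q r))"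
      by (rule norm_has_ac_derivative_diff_le[OF ac]) (use s in simp)
    also have "\<dots> \<le> (LBINT r:{t..s}. p r)"
      by (rule set_integral_mono; (intro locally_integrableD locally_integrable_norm lp lq)?) (rule qp)
    also have "\<dots> \<le> (LBINT r:{t..t+1}. p r)"
    proof -
      have "0 \<le> (LBINT r:{s..t+1}. p r)"
        unfolding set_lebesgue_integral_def by (intro integral_nonneg_AE AE_I2) (simp add: p_def)
      thus ?thesis using set_integral_Icc_split[OF lp, of t s "t+1"] s by simp
    qed
    finally show ?thesis by (simp add: c_def)
  qed
  \<comment> \<open>Averaging the comparison of \<open>Q t\<close> with \<open>Q s\<close> over an
    interval of length 1 replaces the unknown value \<open>Q s\<close> by its integral.\<close>
  have "Q t = (LBINT s:{t..t+1}. Q t)" by (simp add: set_integral_const_Icc)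
  also have "\<dots> \<le> (LBINT s:{t..t+1}. Q s + c)"
    by (rule set_integral_mono; (intro locally_integrableD locally_integrable_add locally_integrable_const lQ)?)
       (rule Qle)
  also have "\<dots> = (LBINT s:{t..t+1}. Q s) + (LBINT s:{t..t+1}. c)"
    by (rule set_integral_add(2)) (intro locally_integrableD locally_integrable_const lQ)+
  also have "\<dots> = (LBINT s:{t..t+1}. Q s) + c" by (simp add: set_integral_const_Icc)
  also have "\<dots> = (LBINT s:{t..t+1}. Q s + p s)"
    unfolding c_def by (rule set_integral_add(2)[symmetric]) (intro locally_integrableD lQ lp)+
  finally show ?thesis by (simp add: Q_def p_def power2_norm_eq_inner algebra_simps)
qed

lemma has_W12_derivative_sq_le:
  assumes u: "has_W12_derivative u u'"
  shows "(norm (u t))\<^sup>2 \<le> 2 * (\<integral>r. (norm (u r))\<^sup>2 \<partial>lborel) + (\<integral>r. (norm (u' r))\<^sup>2 \<partial>lborel)"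
proof -
  have i: "integrable lborel (\<lambda>r. (norm (u r))\<^sup>2)" "integrable lborel (\<lambda>r. (norm (u' r))\<^sup>2)"
    using u by (auto simp: has_W12_derivative_def sq_integrable_norm_sq)
  have i': "integrable lborel (\<lambda>r. 2 * (norm (u r))\<^sup>2 + (norm (u' r))\<^sup>2)" using i by simp
  have "(LBINT r:{t..t+1}. 2 * (norm (u r))\<^sup>2 + (norm (u' r))\<^sup>2)
      \<le> (\<integral>r. 2 * (norm (u r))\<^sup>2 + (norm (u' r))\<^sup>2 \<partial>lborel)"
    unfolding set_lebesgue_integral_def
    by (intro integral_mono i' integrable_mult_indicator) (auto simp: indicator_def)
  also have "\<dots> = 2 * (\<integral>r. (norm (u r))\<^sup>2 \<partial>lborel) + (\<integral>r. (norm (u' r))\<^sup>2 \<partial>lborel)" using i by simp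
  finally show ?thesis using has_W12_derivative_decay[OF u, of t] by linarith
qed

lemma has_W12_derivative_tendsto:
  assumes u: "has_W12_derivative u u'" and t: "filterlim (\<lambda>n::nat. \<bar>t n\<bar>) at_top sequentially"
  shows "(\<lambda>n. u (t n)) \<longlonglongrightarrow> 0"
proof -
  let ?w = "\<lambda>r. 2 * (norm (u r))\<^sup>2 + (norm (u' r))\<^sup>2"
  have "(\<lambda>n. LBINT r:{t n..t n+1}. ?w r) \<longlonglongrightarrow> (LBINT r:{}. ?w r)"
  proof (rule tendsto_set_integral_sets)
    show "integrable lborel ?w" using u by (auto simp: has_W12_derivative_def sq_integrable_norm_sq)
    fix x :: real
    have "\<forall>\<^sub>F n in sequentially. \<bar>t n\<bar> > \<bar>x\<bar> + 1" using t by (simp add: filterlim_at_top_dense)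
    thus "\<forall>\<^sub>F n in sequentially. x \<in> {t n..t n + 1} \<longleftrightarrow> x \<in> {}"
      by eventually_elim auto
  qed auto
  hence lim: "(\<lambda>n. LBINT r:{t n..t n+1}. ?w r) \<longlonglongrightarrow> 0" by (simp add: set_lebesgue_integral_def)
  have "(\<lambda>n. (norm (u (t n)))\<^sup>2) \<longlonglongrightarrow> 0"
    by (rule Lim_null_comparison[OF _ lim]) (use has_W12_derivative_decay[OF u] in simp)
  thus ?thesis by (simp add: power_tendsto_0_iff tendsto_norm_zero_iff)
qed

lemma has_W12_derivative_parts:
  fixes u v :: "real \<Rightarrow> 'h::{chilbert_space, second_countable_topology}"
  assumes u: "has_W12_derivative u u'" and v: "has_W12_derivative v v'"
  shows "(\<integral>t. inner (u' t) (v t) + inner (u t) (v' t) \<partial>lborel) = 0"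
    and "(LBINT t:{0..}. inner (u' t) (v t) + inner (u t) (v' t)) = - inner (u 0) (v 0)"
    and "(LBINT t:{..0}. inner (u' t) (v t) + inner (u t) (v' t)) = inner (u 0) (v 0)"
proof -
  let ?q = "\<lambda>t. inner (u' t) (v t) + inner (u t) (v' t)"
  have ac: "has_ac_derivative (\<lambda>t. inner (u t) (v t)) ?q"
    by (intro has_ac_derivative_inner) (use u v in \<open>simp_all add: has_W12_derivative_def\<close>)
  have iq: "integrable lborel ?q"
    using u v by (intro Bochner_Integration.integrable_add sq_integrable_inner) (auto simp: has_W12_derivative_def)
  have top: "filterlim (\<lambda>n. \<bar>real n\<bar>) at_top sequentially" "filterlim (\<lambda>n. \<bar>- real n\<bar>) at_top sequentially"
    by (simp_all add: filterlim_real_sequentially)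
  have "(\<lambda>n. inner (u (real n)) (v (real n))) \<longlonglongrightarrow> inner (0 :: 'h) 0"
    by (rule tendsto_inner[OF has_W12_derivative_tendsto[OF u top(1)] has_W12_derivative_tendsto[OF v top(1)]])
  moreover have "(\<lambda>n. inner (u (- real n)) (v (- real n))) \<longlonglongrightarrow> inner (0 :: 'h) 0"
    by (rule tendsto_inner[OF has_W12_derivative_tendsto[OF u top(2)] has_W12_derivative_tendsto[OF v top(2)]])
  ultimately have l: "(\<lambda>n. inner (u (real n)) (v (real n))) \<longlonglongrightarrow> 0"
    "(\<lambda>n. inner (u (- real n)) (v (- real n))) \<longlonglongrightarrow> 0" by simp_all
  have ev: "\<forall>\<^sub>F n in sequentially. real n > c" for c
    using filterlim_real_sequentially by (simp add: filterlim_at_top_dense)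
  have "(\<lambda>n. LBINT t:{- real n..real n}. ?q t) \<longlonglongrightarrow> (LBINT t:UNIV. ?q t)"
  proof (rule tendsto_set_integral_sets[OF iq])
    fix x show "\<forall>\<^sub>F n in sequentially. x \<in> {- real n..real n} \<longleftrightarrow> x \<in> UNIV"
      using ev[of "\<bar>x\<bar>"] by eventually_elim auto
  qed auto
  moreover have "(\<lambda>n. LBINT t:{- real n..real n}. ?q t) \<longlonglongrightarrow> 0 - 0"
    using tendsto_diff[OF l] has_ac_derivative_diff[OF ac, of "- real n" "real n" for n] by simp
  ultimately show "(\<integral>t. ?q t \<partial>lborel) = 0" using LIMSEQ_unique by (fastforce simp: set_lebesgue_integral_def)
  have "(\<lambda>n. LBINT t:{0..real n}. ?q t) \<longlonglongrightarrow> (LBINT t:{0..}. ?q t)"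
  proof (rule tendsto_set_integral_sets[OF iq])
    fix x show "\<forall>\<^sub>F n in sequentially. x \<in> {0..real n} \<longleftrightarrow> x \<in> {0..}"
      using ev[of "\<bar>x\<bar>"] by eventually_elim auto
  qed auto
  moreover have "(\<lambda>n. LBINT t:{0..real n}. ?q t) \<longlonglongrightarrow> 0 - inner (u 0) (v 0)"
    using tendsto_diff[OF l(1) tendsto_const[of "inner (u 0) (v 0)"]] has_ac_derivative_diff[OF ac, of 0 "real n" for n] by simp
  ultimately show "(LBINT t:{0..}. ?q t) = - inner (u 0) (v 0)" using LIMSEQ_unique by fastforce
  have "(\<lambda>n. LBINT t:{- real n..0}. ?q t) \<longlonglongrightarrow> (LBINT t:{..0}. ?q t)"
  proof (rule tendsto_set_integral_sets[OF iq])
    fix x show "\<forall>\<^sub>F n in sequentially. x \<in> {- real n..0} \<longleftrightarrow> x \<in> {..0}"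
      using ev[of "\<bar>x\<bar>"] by eventually_elim auto
  qed auto
  moreover have "(\<lambda>n. LBINT t:{- real n..0}. ?q t) \<longlonglongrightarrow> inner (u 0) (v 0) - 0"
    using tendsto_diff[OF tendsto_const[of "inner (u 0) (v 0)"] l(2)] has_ac_derivative_diff[OF ac, of "- real n" 0 for n] by simp
  ultimately show "(LBINT t:{..0}. ?q t) = inner (u 0) (v 0)" using LIMSEQ_unique by fastforce
qed

text \<open>Hoelder continuity of order 1/2, written with a free parameter: the integrand is bounded
  by \<eta> norm(u')^2 + 1/\<eta>, and the parameter is fixed only where the oscillation on short
  intervals is estimated.\<close>

lemma has_W12_derivative_diff_le:
  assumes u: "has_W12_derivative u u'" and st: "s \<le> t" and \<eta>: "\<eta> > 0"
  shows "norm (u t - u s) \<le> \<eta> * (\<integral>r. (norm (u' r))\<^sup>2 \<partial>lborel) + (t - s) / \<eta>"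
proof -
  have ac: "has_ac_derivative u u'" and i: "integrable lborel (\<lambda>r. (norm (u' r))\<^sup>2)"
    using u by (auto simp: has_W12_derivative_def sq_integrable_norm_sq)
  have li: "locally_integrable (\<lambda>r. \<eta> * (norm (u' r))\<^sup>2)" using i by (intro integrable_locally_integrable) simp
  have lc: "locally_integrable (\<lambda>r. 1 / \<eta>)" by (rule locally_integrable_const)
  have "norm (u t - u s) \<le> (LBINT r:{s..t}. norm (u' r))"
    by (rule norm_has_ac_derivative_diff_le[OF ac st])
  also have "\<dots> \<le> (LBINT r:{s..t}. \<eta> * (norm (u' r))\<^sup>2 + 1 / \<eta>)"
  proof (rule set_integral_mono)
    show "set_integrable lborel {s..t} (\<lambda>r. norm (u' r))"
      by (intro locally_integrableD locally_integrable_norm has_ac_derivative_locally_integrable[OF ac])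
    show "set_integrable lborel {s..t} (\<lambda>r. \<eta> * (norm (u' r))\<^sup>2 + 1 / \<eta>)"
      by (intro locally_integrableD locally_integrable_add li lc)
    fix r
    have "0 \<le> (\<eta> * norm (u' r) - 1)\<^sup>2 / \<eta>" using \<eta> by simp
    also have "\<dots> = \<eta> * (norm (u' r))\<^sup>2 + 1 / \<eta> - 2 * norm (u' r)"
      using \<eta> by (simp add: power2_eq_square field_simps)
    finally show "norm (u' r) \<le> \<eta> * (norm (u' r))\<^sup>2 + 1 / \<eta>"
      using norm_ge_zero[of "u' r"] by linarith
  qed
  also have "\<dots> = (LBINT r:{s..t}. \<eta> * (norm (u' r))\<^sup>2) + (LBINT r:{s..t}. 1 / \<eta>)"
    by (rule set_integral_add(2)) (intro locally_integrableD li lc)+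
  also have "(LBINT r:{s..t}. 1 / \<eta>) = (t - s) / \<eta>" using st by (simp only: set_integral_const_Icc) simp
  also have "(LBINT r:{s..t}. \<eta> * (norm (u' r))\<^sup>2) \<le> (\<integral>r. \<eta> * (norm (u' r))\<^sup>2 \<partial>lborel)"
    unfolding set_lebesgue_integral_def
    using i \<eta> by (intro integral_mono integrable_mult_indicator) (auto simp: indicator_def)
  finally show ?thesis by simp
qed

lemma has_ac_derivative_bounded_linear:
  fixes u :: "real \<Rightarrow> 'b::{banach, second_countable_topology}" and T :: "'b \<Rightarrow> 'c::{banach, second_countable_topology}"
  assumes T: "bounded_linear T" and u: "has_ac_derivative u u'"
  shows "has_ac_derivative (\<lambda>t. T (u t)) (\<lambda>t. T (u' t))"
proof (rule has_ac_derivativeI)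
  have i: "integrable (restrict_space lborel {a..b}) u'" for a b
    using locally_integrableD[OF has_ac_derivative_locally_integrable[OF u], of a b]
    by (simp add: set_integrable_eq_restrict)
  show "locally_integrable (\<lambda>t. T (u' t))"
    unfolding locally_integrable_def
    using integrable_bounded_linear[OF T i] by (simp add: set_integrable_eq_restrict)
  fix a b :: real assume "a \<le> b"
  have "T (u b) - T (u a) = T (u b - u a)" by (simp only: linear_diff[OF bounded_linear.linear[OF T]])
  also have "u b - u a = integral\<^sup>L (restrict_space lborel {a..b}) u'"
    using has_ac_derivative_diff[OF u \<open>a \<le> b\<close>] by (simp add: set_integral_eq_restrict)
  also have "T \<dots> = (LBINT s:{a..b}. T (u' s))"
    by (simp add: set_integral_eq_restrict integral_bounded_linear[OF T i])
  finally show "T (u b) - T (u a) = (LBINT s:{a..b}. T (u' s))" .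
qed

lemma sq_integrable_bounded_mult:
  fixes f g :: "real \<Rightarrow> 'h::{chilbert_space, second_countable_topology}"
  assumes f: "sq_integrable f" and g: "g \<in> borel_measurable lborel" and le: "\<And>t. norm (g t) \<le> K * norm (f t)"
  shows "sq_integrable g"
  unfolding sq_integrable_def
proof (intro conjI g, rule Bochner_Integration.integrable_bound)
  show "integrable lborel (\<lambda>t. K\<^sup>2 * (norm (f t))\<^sup>2)" using sq_integrable_norm_sq[OF f] by simp
  show "(\<lambda>t. (norm (g t))\<^sup>2) \<in> borel_measurable lborel" using g by measurable
  show "AE t in lborel. norm ((norm (g t))\<^sup>2) \<le> norm (K\<^sup>2 * (norm (f t))\<^sup>2)"
  proof (rule AE_I2)
    fix t
    have "(norm (g t))\<^sup>2 \<le> (K * norm (f t))\<^sup>2" by (intro power_mono le) simp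
    thus "norm ((norm (g t))\<^sup>2) \<le> norm (K\<^sup>2 * (norm (f t))\<^sup>2)" by (simp add: power_mult_distrib)
  qed
qed

lemma has_W12_derivative_blinfun:
  fixes u :: "real \<Rightarrow> 'h::{chilbert_space, second_countable_topology}" and S :: "'h \<Rightarrow>\<^sub>L 'h"
  assumes "has_W12_derivative u u'"
  shows "has_W12_derivative (\<lambda>t. S (u t)) (\<lambda>t. S (u' t))"
proof -
  have *: "sq_integrable (\<lambda>t. S (f t))" if f: "sq_integrable f" for f :: "real \<Rightarrow> 'h"
  proof (rule sq_integrable_bounded_mult[OF f])
    have "f \<in> borel_measurable lborel" using f by (simp add: sq_integrable_def)
    moreover have "(blinfun_apply S) \<in> borel_measurable borel"
      by (intro borel_measurable_continuous_onI linear_continuous_on blinfun.bounded_linear_right)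
    ultimately show "(\<lambda>t. S (f t)) \<in> borel_measurable lborel" by (rule measurable_compose)
    show "norm (S (f t)) \<le> norm S * norm (f t)" for t by (rule norm_blinfun)
  qed
  have "has_ac_derivative (\<lambda>t. S (u t)) (\<lambda>t. S (u' t))"
    by (rule has_ac_derivative_bounded_linear[OF blinfun.bounded_linear_right])
       (use assms in \<open>simp add: has_W12_derivative_def\<close>)
  thus ?thesis using assms * unfolding has_W12_derivative_def by simp
qed

section \<open>The derivative as a skew-adjoint operator\<close>

lemma l2rel_refl: "sq_integrable f \<Longrightarrow> l2rel f f"
  by (simp add: l2rel_def)

lemma abs_l2_eqI:
  assumes "sq_integrable f" "sq_integrable g" "AE t in lborel. f t = g t"
  shows "abs_l2 f = abs_l2 g"
  by (rule Quotient3_rel_abs[OF Quotient3_l2]) (simp add: l2rel_def assms)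

lemma inner_abs_l2:
  "sq_integrable f \<Longrightarrow> sq_integrable g \<Longrightarrow> inner (abs_l2 f) (abs_l2 g) = (\<integral>t. inner (f t) (g t) \<partial>lborel)"
  by (intro inner_l2.abs_eq l2rel_refl)

lemma plus_abs_l2:
  "sq_integrable f \<Longrightarrow> sq_integrable g \<Longrightarrow> abs_l2 f + abs_l2 g = abs_l2 (\<lambda>t. f t + g t)"
  by (intro plus_l2.abs_eq l2rel_refl)

lemma uminus_abs_l2: "sq_integrable f \<Longrightarrow> - abs_l2 f = abs_l2 (\<lambda>t. - f t)"
  by (intro uminus_l2.abs_eq l2rel_refl)

lemma scaleC_abs_l2: "sq_integrable f \<Longrightarrow> c *\<^sub>C abs_l2 f = abs_l2 (\<lambda>t. c *\<^sub>C f t)"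
  by (intro scaleC_l2.abs_eq l2rel_refl)

lemma sq_integrable_compact_support:
  fixes g :: "real \<Rightarrow> 'h::{chilbert_space, second_countable_topology}"
  assumes g: "g \<in> borel_measurable lborel" and le: "\<And>t. norm (g t) \<le> C * indicator {a..b} t"
  shows "sq_integrable g"
  unfolding sq_integrable_def
proof (intro conjI g, rule Bochner_Integration.integrable_bound)
  show "integrable lborel (\<lambda>t. indicator {a..b} t * C\<^sup>2 :: real)"
    by (intro integrable_mult_left integrable_real_indicator) (auto simp: emeasure_lborel_Icc_eq)
  show "(\<lambda>t. (norm (g t))\<^sup>2) \<in> borel_measurable lborel" using g by measurable
  show "AE t in lborel. norm ((norm (g t))\<^sup>2) \<le> norm (indicator {a..b} t * C\<^sup>2 :: real)"
  proof (rule AE_I2)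
    fix t
    have "(norm (g t))\<^sup>2 \<le> (C * indicator {a..b} t)\<^sup>2" by (intro power_mono le) simp
    thus "norm ((norm (g t))\<^sup>2) \<le> norm (indicator {a..b} t * C\<^sup>2 :: real)"
      by (cases "t \<in> {a..b}") (simp_all add: power_mult_distrib)
  qed
qed

lemma has_ac_derivative_add:
  assumes "has_ac_derivative u u'" "has_ac_derivative v v'"
  shows "has_ac_derivative (\<lambda>t. u t + v t) (\<lambda>t. u' t + v' t)"
proof (rule has_ac_derivativeI)
  note l = assms[THEN has_ac_derivative_locally_integrable]
  show "locally_integrable (\<lambda>t. u' t + v' t)" by (intro locally_integrable_add l)
  fix a b :: real assume ab: "a \<le> b"
  show "u b + v b - (u a + v a) = (LBINT s:{a..b}. u' s + v' s)"
    using assms[THEN has_ac_derivative_diff, OF ab] set_integral_add(2)[OF l[THEN locally_integrableD], of a b]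
    by (simp add: algebra_simps)
qed

lemma has_W12_derivative_add:
  "has_W12_derivative u u' \<Longrightarrow> has_W12_derivative v v' \<Longrightarrow>
   has_W12_derivative (\<lambda>t. u t + v t) (\<lambda>t. u' t + v' t)"
  by (simp add: has_W12_derivative_def sq_integrable_add has_ac_derivative_add)

lemma has_W12_derivative_scaleC:
  "has_W12_derivative u u' \<Longrightarrow> has_W12_derivative (\<lambda>t. c *\<^sub>C u t) (\<lambda>t. c *\<^sub>C u' t)"
  by (simp add: has_W12_derivative_def sq_integrable_scaleC
      has_ac_derivative_bounded_linear[OF bounded_linear_scaleC])

lemma sq_integrable_W12: "has_W12_derivative u u' \<Longrightarrow> sq_integrable u" "has_W12_derivative u u' \<Longrightarrow> sq_integrable u'"
  by (simp_all add: has_W12_derivative_def)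

lemma complex_linear_relation_ddt:
  "complex_linear_relation (ddt_op :: ('a::{chilbert_space, second_countable_topology} l2 \<times> 'a l2) set)"
  unfolding complex_linear_relation_def
proof (intro conjI allI impI)
  have z: "abs_l2 (\<lambda>_. 0 :: 'a) = 0" by (simp add: zero_l2.abs_eq)
  have "locally_integrable (\<lambda>_. 0 :: 'a)"
    by (rule sq_integrable_locally_integrable) simp
  hence "has_ac_derivative (\<lambda>_. 0 :: 'a) (\<lambda>_. 0)"
    by (intro has_ac_derivativeI) (simp_all add: set_lebesgue_integral_def)
  hence "has_W12_derivative (\<lambda>_. 0 :: 'a) (\<lambda>_. 0)"
    by (simp add: has_W12_derivative_def)
  thus "(0 :: 'a l2, 0) \<in> ddt_op" 
    unfolding ddt_op_iff by (intro exI[of _ "\<lambda>_. 0"]) (simp add: z)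
next
  fix x y x' y' :: "'a l2" assume "(x, y) \<in> ddt_op" "(x', y') \<in> ddt_op"
  then obtain u u' v v' where *: "x = abs_l2 u" "y = abs_l2 u'" "has_W12_derivative u u'"
     "x' = abs_l2 v" "y' = abs_l2 v'" "has_W12_derivative v v'" unfolding ddt_op_iff by blast
  note s = sq_integrable_W12[OF *(3)] sq_integrable_W12[OF *(6)]
  have "x + x' = abs_l2 (\<lambda>t. u t + v t)" "y + y' = abs_l2 (\<lambda>t. u' t + v' t)"
    unfolding * by (simp_all add: plus_abs_l2 s)
  thus "(x + x', y + y') \<in> ddt_op" unfolding ddt_op_iff using has_W12_derivative_add[OF *(3,6)] by blast
next
  fix c and x y :: "'a l2" assume "(x, y) \<in> ddt_op"
  then obtain u u' where *: "x = abs_l2 u" "y = abs_l2 u'" "has_W12_derivative u u'"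
    unfolding ddt_op_iff by blast
  have "c *\<^sub>C x = abs_l2 (\<lambda>t. c *\<^sub>C u t)" "c *\<^sub>C y = abs_l2 (\<lambda>t. c *\<^sub>C u' t)"
    unfolding * by (simp_all add: scaleC_abs_l2 sq_integrable_W12[OF *(3)])
  thus "(c *\<^sub>C x, c *\<^sub>C y) \<in> ddt_op"
    unfolding ddt_op_iff using has_W12_derivative_scaleC[OF *(3)] by blast
qed

lemma ddt_skew:
  assumes "(x, x') \<in> ddt_op" "(y, y') \<in> ddt_op"
  shows "inner y x' = - inner y' x"
proof -
  obtain u u' v v' where *: "x = abs_l2 u" "x' = abs_l2 u'" "has_W12_derivative u u'"
     "y = abs_l2 v" "y' = abs_l2 v'" "has_W12_derivative v v'" using assms unfolding ddt_op_iff by blast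
  note s = sq_integrable_W12[OF *(3)] sq_integrable_W12[OF *(6)]
  have "inner y' x + inner y x' = (\<integral>t. inner (v' t) (u t) + inner (v t) (u' t) \<partial>lborel)"
    unfolding * by (simp add: inner_abs_l2 sq_integrable_inner s)
  thus ?thesis using has_W12_derivative_parts(1)[OF *(6,3)] by simp
qed

text \<open>The endpoints are exempt because the truncated test derivative may jump there.\<close>

lemma set_integral_endpoints_0:
  fixes \<psi> :: "real \<Rightarrow> 'b::{banach, second_countable_topology}"
  assumes "\<And>t. t \<in> {a..b} \<Longrightarrow> t \<noteq> a \<Longrightarrow> t \<noteq> b \<Longrightarrow> \<psi> t = 0"
  shows "(LBINT s:{a..b}. \<psi> s) = 0"
  unfolding set_lebesgue_integral_def
proof (rule integral_eq_zero_AE)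
  show "AE s in lborel. indicator {a..b} s *\<^sub>R \<psi> s = 0"
    using AE_lborel_singleton[of a] AE_lborel_singleton[of b]
    by eventually_elim (use assms in \<open>auto simp: indicator_def\<close>)
qed

text \<open>The argument of du Bois-Reymond: with a primitive \<open>Y\<close> of \<open>-h\<close>, the function \<open>f - Y\<close> is
  orthogonal to all derivatives of compactly supported test functions, in particular to its own
  truncated deviation from its mean.\<close>

lemma ae_constant_on_interval:
  fixes f h :: "real \<Rightarrow> 'h::{chilbert_space, second_countable_topology}"
  assumes f: "sq_integrable f" and h: "sq_integrable h" and N: "N > 0"
    and Y: "has_ac_derivative Y (\<lambda>t. - h t)"
    and weak: "\<And>\<phi> \<psi>. has_W12_derivative \<phi> \<psi> \<Longrightarrow>
      (\<integral>t. inner (f t) (\<psi> t) \<partial>lborel) = (\<integral>t. inner (h t) (\<phi> t) \<partial>lborel)"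
  shows "\<exists>m. AE t in lborel. t \<in> {-N..N} \<longrightarrow> f t - Y t = m"
proof -
  have cY: "continuous_on UNIV Y" by (rule has_ac_derivative_continuous[OF Y])
  hence [measurable]: "Y \<in> borel_measurable borel" by (rule borel_measurable_continuous_onI)
  have [measurable]: "f \<in> borel_measurable lborel" using f by (simp add: sq_integrable_def)
  \<comment> \<open>Subtracting the mean makes the integral of \<psi> vanish, so that its primitive
    \<phi> is 0 on both sides of the interval and is an admissible test function.\<close>
  define m where "m = (1 / (2 * N)) *\<^sub>R (LBINT s:{-N..N}. f s - Y s)"
  define \<psi> where "\<psi> = (\<lambda>t. indicator {-N..N} t *\<^sub>R (f t - Y t - m))"
  have \<psi>_out: "\<psi> t = 0" if "t \<notin> {-N..N}" for t using that by (simp add: \<psi>_def)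
  obtain C where C: "\<And>t. t \<in> {-N..N} \<Longrightarrow> norm (Y t + m) \<le> C"
  proof -
    have "continuous_on UNIV (\<lambda>t. Y t + m)" by (intro continuous_intros cY)
    from continuous_bounded_interval[OF this, of "-N" N] that show thesis by blast
  qed
  have "sq_integrable (\<lambda>t. indicator {-N..N} t *\<^sub>R f t)"
  proof (rule sq_integrable_bounded_mult[OF f])
    show "(\<lambda>t. indicator {-N..N} t *\<^sub>R f t) \<in> borel_measurable lborel" by measurable
    show "norm (indicator {-N..N} t *\<^sub>R f t) \<le> 1 * norm (f t)" for t by (simp add: indicator_def)
  qed
  moreover have "sq_integrable (\<lambda>t. indicator {-N..N} t *\<^sub>R (Y t + m))"
  proof (rule sq_integrable_compact_support)
    show "(\<lambda>t. indicator {-N..N} t *\<^sub>R (Y t + m)) \<in> borel_measurable lborel" by measurable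
    show "norm (indicator {-N..N} t *\<^sub>R (Y t + m)) \<le> C * indicator {-N..N} t" for t
      using C by (simp add: indicator_def)
  qed
  ultimately have "sq_integrable (\<lambda>t. indicator {-N..N} t *\<^sub>R f t - indicator {-N..N} t *\<^sub>R (Y t + m))"
    by (rule sq_integrable_diff)
  moreover have "(\<lambda>t. indicator {-N..N} t *\<^sub>R f t - indicator {-N..N} t *\<^sub>R (Y t + m)) = \<psi>"
    by (simp add: \<psi>_def scaleR_diff_right scaleR_add_right fun_eq_iff)
  ultimately have \<psi>: "sq_integrable \<psi>" by simp
  note l\<psi> = sq_integrable_locally_integrable[OF \<psi>]
  have l\<zeta>: "locally_integrable (\<lambda>t. f t - Y t)"
  proof -
    have "set_integrable lborel {a..b} Y" for a b
      by (rule borel_integrable_atLeastAtMost') (rule continuous_on_subset[OF cY], simp)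
    thus ?thesis using locally_integrableD[OF sq_integrable_locally_integrable[OF f]]
      unfolding locally_integrable_def by (intro allI set_integral_diff)
  qed
  define \<phi> where "\<phi> = (\<lambda>t. 0 + (LBINT s=ereal (-N)..ereal t. \<psi> s))"
  have ac\<phi>: "has_ac_derivative \<phi> \<psi>" unfolding \<phi>_def by (rule has_ac_derivative_primitive[OF l\<psi>])
  have \<phi>N: "\<phi> (-N) = 0" by (simp add: \<phi>_def)
  have int\<psi>: "(LBINT s:{-N..N}. \<psi> s) = 0"
  proof -
    have "(LBINT s:{-N..N}. \<psi> s) = (LBINT s:{-N..N}. (f s - Y s) - m)"
      unfolding set_lebesgue_integral_def \<psi>_def
      by (intro Bochner_Integration.integral_cong) (auto simp: indicator_def)
    also have "\<dots> = (LBINT s:{-N..N}. f s - Y s) - (LBINT s:{-N..N}. m)"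
      by (rule set_integral_diff(2)[OF locally_integrableD[OF l\<zeta>] borel_integrable_atLeastAtMost'[OF continuous_on_const]])
    also have "(LBINT s:{-N..N}. m) = (2 * N) *\<^sub>R m" using N by (simp add: set_lebesgue_integral_def)
    also have "\<dots> = (LBINT s:{-N..N}. f s - Y s)" using N by (simp add: m_def)
    finally show ?thesis by simp
  qed
  have \<phi>_out: "\<phi> t = 0" if t: "t \<notin> {-N..N}" for t
  proof (cases "t < - N")
    case True
    have "\<phi> (-N) - \<phi> t = (LBINT s:{t..-N}. \<psi> s)" by (rule has_ac_derivative_diff[OF ac\<phi>]) (use True in simp)
    also have "\<dots> = 0" by (rule set_integral_endpoints_0) (auto intro!: \<psi>_out)
    finally show ?thesis by (simp add: \<phi>N)
  next
    case False
    hence "N < t" using t by auto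
    have "\<phi> N - \<phi> (-N) = 0" using has_ac_derivative_diff[OF ac\<phi>, of "-N" N] N int\<psi> by simp
    moreover have "\<phi> t - \<phi> N = (LBINT s:{N..t}. \<psi> s)" by (rule has_ac_derivative_diff[OF ac\<phi>]) (use \<open>N < t\<close> in simp)
    moreover have "(LBINT s:{N..t}. \<psi> s) = 0" by (rule set_integral_endpoints_0) (auto intro!: \<psi>_out)
    ultimately show ?thesis by (simp add: \<phi>N)
  qed
  have c\<phi>: "continuous_on UNIV \<phi>" by (rule has_ac_derivative_continuous[OF ac\<phi>])
  obtain C' where C': "\<And>t. t \<in> {-N..N} \<Longrightarrow> norm (\<phi> t) \<le> C'"
    using continuous_bounded_interval[OF c\<phi>, of "-N" N] by blast
  have \<phi>: "sq_integrable \<phi>"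
  proof (rule sq_integrable_compact_support)
    show "\<phi> \<in> borel_measurable lborel" using borel_measurable_continuous_onI[OF c\<phi>] by simp
    show "norm (\<phi> t) \<le> C' * indicator {-N..N} t" for t
      using C'[of t] \<phi>_out[of t] by (cases "t \<in> {-N..N}") auto
  qed
  have W: "has_W12_derivative \<phi> \<psi>" using \<phi> \<psi> ac\<phi> by (simp add: has_W12_derivative_def)
  have i1: "integrable lborel (\<lambda>t. inner (f t) (\<psi> t))" by (rule sq_integrable_inner[OF f \<psi>])
  have i2: "integrable lborel (\<lambda>t. inner (h t) (\<phi> t))" by (rule sq_integrable_inner[OF h \<phi>])
  have e1: "(\<integral>t. inner (f t) (\<psi> t) - inner (h t) (\<phi> t) \<partial>lborel) = 0"
    using weak[OF W] i1 i2 by simp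
  have acp: "has_ac_derivative (\<lambda>t. inner (Y t) (\<phi> t)) (\<lambda>t. inner (- h t) (\<phi> t) + inner (Y t) (\<psi> t))"
    by (rule has_ac_derivative_inner[OF Y ac\<phi>])
  have \<phi>N': "\<phi> N = 0" using has_ac_derivative_diff[OF ac\<phi>, of "-N" N] N int\<psi> \<phi>N by simp
  have "(LBINT t:{-N..N}. inner (- h t) (\<phi> t) + inner (Y t) (\<psi> t)) = 0"
    using has_ac_derivative_diff[OF acp, of "-N" N] N \<phi>N \<phi>N' by simp
  moreover have ind: "indicator {-N..N} t *\<^sub>R (inner (- h t) (\<phi> t) + inner (Y t) (\<psi> t))
      = inner (Y t) (\<psi> t) - inner (h t) (\<phi> t)" for t
    using \<phi>_out[of t] \<psi>_out[of t] by (cases "t \<in> {-N..N}") auto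
  ultimately have e2: "(\<integral>t. inner (Y t) (\<psi> t) - inner (h t) (\<phi> t) \<partial>lborel) = 0"
    by (simp only: set_lebesgue_integral_def)
  have i3: "integrable lborel (\<lambda>t. inner (Y t) (\<psi> t) - inner (h t) (\<phi> t))"
    using locally_integrableD[OF has_ac_derivative_locally_integrable[OF acp], of "-N" N]
    unfolding set_integrable_def ind .
  have "integrable lborel \<psi>"
  proof -
    have "indicator {-N..N} t *\<^sub>R \<psi> t = \<psi> t" for t using \<psi>_out[of t] by (cases "t \<in> {-N..N}") auto
    thus ?thesis using locally_integrableD[OF l\<psi>, of "-N" N] by (simp add: set_integrable_def)
  qed
  moreover have "integral\<^sup>L lborel \<psi> = 0"
  proof -
    have "indicator {-N..N} t *\<^sub>R \<psi> t = \<psi> t" for t using \<psi>_out[of t] by (cases "t \<in> {-N..N}") auto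
    thus ?thesis using int\<psi> by (simp add: set_lebesgue_integral_def)
  qed
  ultimately have e3: "(\<integral>t. inner m (\<psi> t) \<partial>lborel) = 0" and i4: "integrable lborel (\<lambda>t. inner m (\<psi> t))" by simp_all
  \<comment> \<open>The products of \<open>h\<close> and \<phi> are inserted and cancel. The first
    bracket then integrates to 0 by the weak equation, the second by the product rule for
    \<open>Y\<close> and \<phi>, and the last term because \<psi> has integral 0.\<close>
  have sq: "(norm (\<psi> t))\<^sup>2 = (inner (f t) (\<psi> t) - inner (h t) (\<phi> t))
      - (inner (Y t) (\<psi> t) - inner (h t) (\<phi> t)) - inner m (\<psi> t)" for t
    using \<psi>_out[of t] by (cases "t \<in> {-N..N}")
      (auto simp: \<psi>_def power2_norm_eq_inner inner_diff_left inner_diff_right algebra_simps)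
  have "(\<integral>t. (norm (\<psi> t))\<^sup>2 \<partial>lborel) = 0"
    unfolding sq Bochner_Integration.integral_diff[OF Bochner_Integration.integrable_diff[OF
      Bochner_Integration.integrable_diff[OF i1 i2] i3] i4]
      Bochner_Integration.integral_diff[OF Bochner_Integration.integrable_diff[OF i1 i2] i3]
    by (simp only: e1 e2 e3 diff_self)
  hence "AE t in lborel. (norm (\<psi> t))\<^sup>2 = 0"
    using \<psi> by (subst (asm) integral_nonneg_eq_0_iff_AE) (auto simp: sq_integrable_def)
  hence "AE t in lborel. t \<in> {-N..N} \<longrightarrow> f t - Y t = m"
    by eventually_elim (auto simp: \<psi>_def)
  thus ?thesis by blast
qed

text \<open>The harder inclusion in the skew-adjointness of d/dt: an element of the adjoint domain
  agrees almost everywhere with a primitive of \<open>- z\<close>, which is the representative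
  required by \<open>ddt_op\<close>.\<close>

lemma ddt_if_weak_derivative:
  fixes y z :: "'h::{chilbert_space, second_countable_topology} l2"
  assumes w: "\<And>x x'. (x, x') \<in> ddt_op \<Longrightarrow> inner y x' = inner z x"
  shows "(y, - z) \<in> ddt_op"
proof -
  define f where "f = rep_l2 y"
  define h where "h = rep_l2 z"
  have f: "sq_integrable f" and h: "sq_integrable h" by (simp_all add: f_def h_def sq_integrable_rep_l2)
  have yf: "y = abs_l2 f" and zh: "z = abs_l2 h" by (simp_all add: f_def h_def)
  have mh: "sq_integrable (\<lambda>t. - h t)" by (rule sq_integrable_minus[OF h])
  define Y where "Y = (\<lambda>t. 0 + (LBINT s=ereal 0..ereal t. - h s))"
  have Y: "has_ac_derivative Y (\<lambda>t. - h t)"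
    unfolding Y_def by (rule has_ac_derivative_primitive[OF sq_integrable_locally_integrable[OF mh]])
  have weak: "(\<integral>t. inner (f t) (\<psi> t) \<partial>lborel) = (\<integral>t. inner (h t) (\<phi> t) \<partial>lborel)"
    if W: "has_W12_derivative \<phi> \<psi>" for \<phi> \<psi>
  proof -
    have "(abs_l2 \<phi>, abs_l2 \<psi>) \<in> ddt_op" using W unfolding ddt_op_iff by blast
    from w[OF this] show ?thesis
      unfolding yf zh by (simp add: inner_abs_l2 f h sq_integrable_W12[OF W])
  qed
  have "\<forall>N. \<exists>m. AE t in lborel. t \<in> {-real (Suc N)..real (Suc N)} \<longrightarrow> f t - Y t = m"
    by (intro allI ae_constant_on_interval[OF f h _ Y weak]) simp
  then obtain m where m: "\<And>N. AE t in lborel. t \<in> {-real (Suc N)..real (Suc N)} \<longrightarrow> f t - Y t = m N"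
    by metis
  \<comment> \<open>Each interval contains [-1, 1] thanks to the successor in its endpoints, so two
    different constants would make [-1, 1] a null set.\<close>
  have m0: "m N = m 0" for N
  proof (rule ccontr)
    assume ne: "m N \<noteq> m 0"
    have "AE t in lborel. t \<notin> {-1..1::real}"
      using m[of N] m[of 0] by eventually_elim (use ne in auto)
    hence "{-1..1::real} \<in> null_sets lborel" using AE_iff_null_sets[of "{-1..1::real}" lborel] by simp
    thus False by (simp add: null_sets_def)
  qed
  have "AE t in lborel. \<forall>N. t \<in> {-real (Suc N)..real (Suc N)} \<longrightarrow> f t - Y t = m 0"
    unfolding AE_all_countable
  proof
    fix N
    show "AE t in lborel. t \<in> {-real (Suc N)..real (Suc N)} \<longrightarrow> f t - Y t = m 0"
      using m[of N] unfolding m0[of N] .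
  qed
  hence ae: "AE t in lborel. f t = m 0 + Y t"
  proof eventually_elim
    case (elim t)
    obtain N :: nat where "\<bar>t\<bar> \<le> real N" using real_arch_simple by blast
    hence "t \<in> {-real (Suc N)..real (Suc N)}" by auto
    hence "f t - Y t = m 0" using elim by blast
    thus ?case by (simp add: algebra_simps)
  qed
  have ac: "has_ac_derivative (\<lambda>t. m 0 + Y t) (\<lambda>t. - h t)"
    by (rule has_ac_derivativeI) (use Y has_ac_derivative_diff[OF Y] in \<open>auto simp: has_ac_derivative_def\<close>)
  have ms: "(\<lambda>t. m 0 + Y t) \<in> borel_measurable lborel"
    using borel_measurable_continuous_onI[OF has_ac_derivative_continuous[OF ac]] by simp
  have sqY: "sq_integrable (\<lambda>t. m 0 + Y t)"
    unfolding sq_integrable_def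
  proof (intro conjI ms)
    have fm: "f \<in> borel_measurable lborel" using f by (simp add: sq_integrable_def)
    have "integrable lborel (\<lambda>t. (norm (f t))\<^sup>2) = integrable lborel (\<lambda>t. (norm (m 0 + Y t))\<^sup>2)"
    proof (rule integrable_cong_AE)
      show "(\<lambda>t. (norm (f t))\<^sup>2) \<in> borel_measurable lborel" using fm by measurable
      show "(\<lambda>t. (norm (m 0 + Y t))\<^sup>2) \<in> borel_measurable lborel" using ms by measurable
      show "AE t in lborel. (norm (f t))\<^sup>2 = (norm (m 0 + Y t))\<^sup>2" using ae by eventually_elim simp
    qed
    thus "integrable lborel (\<lambda>t. (norm (m 0 + Y t))\<^sup>2)" using sq_integrable_norm_sq[OF f] by simp
  qed
  have "y = abs_l2 (\<lambda>t. m 0 + Y t)" unfolding yf by (rule abs_l2_eqI[OF f sqY ae])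
  moreover have "- z = abs_l2 (\<lambda>t. - h t)" unfolding zh by (rule uminus_abs_l2[OF h])
  moreover have "has_W12_derivative (\<lambda>t. m 0 + Y t) (\<lambda>t. - h t)"
    using sqY mh ac by (simp add: has_W12_derivative_def)
  ultimately show ?thesis unfolding ddt_op_iff by blast
qed

text \<open>The skew relation against a fixed element of the graph survives limits, and by the weak
  characterization it forces membership.\<close>

lemma closed_ddt: "closed (ddt_op :: ('h::{chilbert_space, second_countable_topology} l2 \<times> 'h l2) set)"
  unfolding closed_sequential_limits
proof (intro allI impI, elim conjE)
  fix xy and l :: "'h l2 \<times> 'h l2" assume xy: "\<forall>n. xy n \<in> ddt_op" "xy \<longlonglongrightarrow> l"
  have "inner (fst l) v' = inner (- snd l) v" if v: "(v, v') \<in> ddt_op" for v v'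
  proof (rule LIMSEQ_unique)
    show "(\<lambda>n. inner (fst (xy n)) v') \<longlonglongrightarrow> inner (fst l) v'" by (intro tendsto_intros xy)
    have "inner (fst (xy n)) v' = inner (- snd (xy n)) v" for n
      using ddt_skew[OF v, of "fst (xy n)" "snd (xy n)"] xy(1) by simp
    thus "(\<lambda>n. inner (fst (xy n)) v') \<longlonglongrightarrow> inner (- snd l) v" by (simp only:) (intro tendsto_intros xy)
  qed
  from ddt_if_weak_derivative[OF this] show "l \<in> ddt_op" by simp
qed

text \<open>Norm continuity makes (t, x) -> A(t) x jointly continuous, so \<open>A t (f t)\<close>
  is measurable for measurable \<open>f\<close>; together with the uniform bound this makes
  \<open>mult_op\<close> independent of representatives.\<close>

locale bounded_operator_family =
  fixes A :: "real \<Rightarrow> 'h::{chilbert_space, second_countable_topology} \<Rightarrow>\<^sub>L 'h" and K :: real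
  assumes continuous: "continuous_on UNIV A"
    and bounded: "norm (A t) \<le> K"
    and selfadjoint: "selfadjoint_op (A t)"
begin

lemma norm_apply_le: "norm (A t x) \<le> K * norm x"
  using norm_blinfun[of "A t" x] mult_right_mono[OF bounded[of t] norm_ge_zero[of x]] by linarith

lemma measurable_apply:
  assumes "f \<in> borel_measurable M" "g \<in> borel_measurable M"
  shows "(\<lambda>x. A (f x) (g x)) \<in> borel_measurable M"
proof (rule borel_measurable_continuous_Pair[OF assms])
  have "continuous_on UNIV (\<lambda>x. A (fst x))"
    by (rule continuous_on_compose2[OF continuous continuous_on_fst[OF continuous_on_id]]) auto
  thus "continuous_on UNIV (\<lambda>x. A (fst x) (snd x))"
    by (rule blinfun.continuous_on[OF _ continuous_on_snd[OF continuous_on_id]])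
qed

lemma sq_integrable_apply: "sq_integrable f \<Longrightarrow> sq_integrable (\<lambda>t. A t (f t))"
  by (rule sq_integrable_bounded_mult[OF _ measurable_apply norm_apply_le]) (simp_all add: sq_integrable_def)

lemma mult_op_abs_l2:
  assumes f: "sq_integrable f"
  shows "mult_op A (abs_l2 f) = abs_l2 (\<lambda>t. A t (f t))"
  unfolding mult_op_def
proof (rule abs_l2_eqI)
  have "l2rel (rep_l2 (abs_l2 f)) f" 
    by (rule Quotient3_rep_abs[OF Quotient3_l2]) (rule l2rel_refl[OF f])
  hence "AE t in lborel. rep_l2 (abs_l2 f) t = f t" by (simp add: l2rel_def)
  thus "AE t in lborel. A t (rep_l2 (abs_l2 f) t) = A t (f t)" by eventually_elim simp
qed (intro sq_integrable_apply sq_integrable_rep_l2 f)+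

lemma ex_abs_l2: "\<exists>f. sq_integrable f \<and> x = abs_l2 f"
  by (metis abs_rep_l2 sq_integrable_rep_l2)

lemma mult_op_add: "mult_op A (x + y) = mult_op A x + mult_op A y"
proof -
  obtain f g where *: "sq_integrable f" "x = abs_l2 f" "sq_integrable g" "y = abs_l2 g" using ex_abs_l2 by metis
  show ?thesis unfolding *(2,4)
    by (simp add: plus_abs_l2 mult_op_abs_l2 sq_integrable_apply sq_integrable_add *(1,3) blinfun.add_right)
qed

lemma mult_op_scaleC: "mult_op A (c *\<^sub>C x) = c *\<^sub>C mult_op A x"
proof -
  obtain f where *: "sq_integrable f" "x = abs_l2 f" using ex_abs_l2 by metis
  have "A t (c *\<^sub>C v) = c *\<^sub>C A t v" for t v
    using selfadjoint[of t] by (auto simp: selfadjoint_op_def clinear_op_def)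
  thus ?thesis unfolding *(2)
    by (simp add: scaleC_abs_l2 mult_op_abs_l2 sq_integrable_apply sq_integrable_scaleC *(1))
qed

lemma inner_mult_op: "inner x (mult_op A y) = inner (mult_op A x) y"
proof -
  obtain f g where *: "sq_integrable f" "x = abs_l2 f" "sq_integrable g" "y = abs_l2 g" using ex_abs_l2 by metis
  show ?thesis unfolding *(2,4)
    by (simp add: inner_abs_l2 mult_op_abs_l2 sq_integrable_apply *(1,3) selfadjoint_op_inner[OF selfadjoint])
qed

text \<open>The bound is asked only along \<open>f\<close>. This serves for the global bound
  \<open>K\<close> as well as for a bump on whose values the operators are small.\<close>

lemma norm_mult_op_le:
  assumes f: "sq_integrable f" and c: "c \<ge> 0" and le: "\<And>t. norm (A t (f t)) \<le> c * norm (f t)"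
  shows "norm (mult_op A (abs_l2 f)) \<le> c * norm (abs_l2 f)"
proof (rule power2_le_imp_le)
  have "(norm (mult_op A (abs_l2 f)))\<^sup>2 = (\<integral>t. (norm (A t (f t)))\<^sup>2 \<partial>lborel)"
    by (simp add: mult_op_abs_l2 norm_abs_l2 sq_integrable_apply f)
  also have "\<dots> \<le> (\<integral>t. c\<^sup>2 * (norm (f t))\<^sup>2 \<partial>lborel)"
  proof (rule integral_mono)
    show "integrable lborel (\<lambda>t. (norm (A t (f t)))\<^sup>2)"
      by (intro sq_integrable_norm_sq sq_integrable_apply f)
    show "integrable lborel (\<lambda>t. c\<^sup>2 * (norm (f t))\<^sup>2)" using sq_integrable_norm_sq[OF f] by simp
    show "(norm (A t (f t)))\<^sup>2 \<le> c\<^sup>2 * (norm (f t))\<^sup>2" for t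
      unfolding power_mult_distrib[symmetric] by (intro power_mono le) simp
  qed
  also have "\<dots> = (c * norm (abs_l2 f))\<^sup>2" by (simp add: norm_abs_l2 f power_mult_distrib)
  finally show "(norm (mult_op A (abs_l2 f)))\<^sup>2 \<le> (c * norm (abs_l2 f))\<^sup>2" .
qed (use c in simp)

lemma bounded_linear_mult_op: "bounded_linear (mult_op A)"
proof (rule bounded_linear_intro)
  show "mult_op A (x + y) = mult_op A x + mult_op A y" for x y by (rule mult_op_add)
  show "mult_op A (r *\<^sub>R x) = r *\<^sub>R mult_op A x" for r x
    using mult_op_scaleC[of "of_real r" x] by (simp add: scaleC_of_real)
  show "norm (mult_op A x) \<le> norm x * K" for x
  proof -
    obtain f where *: "sq_integrable f" "x = abs_l2 f" using ex_abs_l2 by metis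
    show ?thesis
      using norm_mult_op_le[OF *(1) order.trans[OF norm_ge_zero bounded] norm_apply_le]
      by (simp add: *(2) mult.commute)
  qed
qed

lemma D_op_iff: "(x, y) \<in> D_op A \<longleftrightarrow> (x, y - mult_op A x) \<in> ddt_op"
proof
  assume "(x, y) \<in> D_op A"
  then obtain x' where "y = x' + mult_op A x" "(x, x') \<in> ddt_op" by (auto simp: D_op_def)
  thus "(x, y - mult_op A x) \<in> ddt_op" by simp
next
  assume "(x, y - mult_op A x) \<in> ddt_op"
  moreover have "y = (y - mult_op A x) + mult_op A x" by simp
  ultimately show "(x, y) \<in> D_op A" unfolding D_op_def by blast
qed

lemma complex_linear_relation_D_op: "complex_linear_relation (D_op A)"
proof -
  note L = complex_linear_relationD[OF complex_linear_relation_ddt]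
  have "mult_op A 0 = 0" using mult_op_scaleC[of 0 0] by simp
  thus ?thesis unfolding complex_linear_relation_def D_op_iff
  proof (intro conjI allI impI)
    show "(0, 0 - mult_op A 0) \<in> ddt_op" using L(1) \<open>mult_op A 0 = 0\<close> by simp
    show "(x + x', y + y' - mult_op A (x + x')) \<in> ddt_op"
      if "(x, y - mult_op A x) \<in> ddt_op" "(x', y' - mult_op A x') \<in> ddt_op" for x y x' y'
      using L(2)[OF that] by (simp add: mult_op_add algebra_simps)
    show "(c *\<^sub>C x, c *\<^sub>C y - mult_op A (c *\<^sub>C x)) \<in> ddt_op" if "(x, y - mult_op A x) \<in> ddt_op" for c x y
      using L(3)[OF that, of c] by (simp add: mult_op_scaleC cvec.scale_right_diff_distrib)
  qed
qed

lemma closed_D_op: "closed (D_op A)"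
  unfolding closed_sequential_limits
proof (intro allI impI, elim conjE)
  fix xy l assume xy: "\<forall>n. xy n \<in> D_op A" "xy \<longlonglongrightarrow> l"
  have "(fst (xy n), snd (xy n) - mult_op A (fst (xy n))) \<in> ddt_op" for n
    using xy(1) D_op_iff[of "fst (xy n)" "snd (xy n)"] by simp
  moreover have "(\<lambda>n. (fst (xy n), snd (xy n) - mult_op A (fst (xy n)))) \<longlonglongrightarrow> (fst l, snd l - mult_op A (fst l))"
    by (intro tendsto_intros xy bounded_linear.tendsto[OF bounded_linear_mult_op])
  ultimately have "(fst l, snd l - mult_op A (fst l)) \<in> ddt_op" by (rule closed_sequentially[OF closed_ddt])
  thus "l \<in> D_op A" using D_op_iff[of "fst l" "snd l"] by simp
qed

text \<open>The adjoint is -d/dt + A on the same domain: the bounded symmetric part moves to the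
  other side, and the rest is the skew-adjointness of d/dt.\<close>

lemma op_adjoint_D_op: "(y, z) \<in> op_adjoint (D_op A) \<longleftrightarrow> (y, mult_op A y - z) \<in> ddt_op"
proof
  assume yz: "(y, z) \<in> op_adjoint (D_op A)"
  have "inner y x' = inner (z - mult_op A y) x" if "(x, x') \<in> ddt_op" for x x'
  proof -
    have "(x, x' + mult_op A x) \<in> D_op A" using that by (simp add: D_op_iff)
    hence "cinner y (x' + mult_op A x) = cinner z x" using yz by (auto simp: op_adjoint_def)
    hence "inner y (x' + mult_op A x) = inner z x" by (simp flip: Re_cinner)
    thus ?thesis by (simp add: inner_add_right inner_mult_op inner_diff_left)
  qed
  from ddt_if_weak_derivative[OF this] show "(y, mult_op A y - z) \<in> ddt_op" by simp
next
  assume d: "(y, mult_op A y - z) \<in> ddt_op"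
  have *: "inner y w = inner z x" if "(x, w) \<in> D_op A" for x w
  proof -
    have "inner y (w - mult_op A x) = - inner (mult_op A y - z) x"
      by (rule ddt_skew[OF _ d]) (use that in \<open>simp add: D_op_iff\<close>)
    thus ?thesis by (simp add: inner_diff_right inner_diff_left inner_mult_op)
  qed
  \<comment> \<open>The identity for real parts applies to all complex multiples of the graph
    element, which gives the imaginary part.\<close>
  have "cinner y w = cinner z x" if xw: "(x, w) \<in> D_op A" for x w
    unfolding cinner_eq_inner
    using *[OF xw] *[OF complex_linear_relationD(3)[OF complex_linear_relation_D_op xw]] by simp
  thus "(y, z) \<in> op_adjoint (D_op A)" by (auto simp: op_adjoint_def)
qed

end

lemma selfadjoint_op_uminus: "selfadjoint_op T \<Longrightarrow> selfadjoint_op (- T)"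
  unfolding selfadjoint_op_def clinear_op_def
  by (auto simp: blinfun.minus_left cinner_diff_right[of _ 0, simplified] cinner_diff_left[of 0, simplified])

lemma bounded_operator_family_uminus:
  assumes "bounded_operator_family A K"
  shows "bounded_operator_family (\<lambda>t. - A t) K"
proof -
  interpret bounded_operator_family A K by fact
  have "selfadjoint_op (- A t)" for t by (rule selfadjoint_op_uminus[OF selfadjoint])
  thus ?thesis by unfold_locales (use continuous bounded in \<open>auto intro: continuous_intros\<close>)
qed

section \<open>The Fredholm estimate\<close>

lemma completely_continuous_diff:
  "completely_continuous C \<Longrightarrow> completely_continuous D \<Longrightarrow> completely_continuous (C - D)"
  unfolding completely_continuous_def blinfun.diff_left
  using tendsto_diff[where a = 0 and b = 0] by fastforce

lemma completely_continuous_uminus: "completely_continuous C \<Longrightarrow> completely_continuous (- C)"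
  unfolding completely_continuous_def blinfun.minus_left
  using tendsto_minus[where a = 0] by fastforce

lemma completely_continuous_limit:
  fixes C :: "'b \<Rightarrow> 'a::real_inner \<Rightarrow>\<^sub>L 'a"
  assumes C: "\<And>i. completely_continuous (C i)" and lim: "(C \<longlongrightarrow> D) F" "F \<noteq> bot"
  shows "completely_continuous D"
  unfolding completely_continuous_def
proof (intro allI impI)
  fix u :: "nat \<Rightarrow> 'a" assume u: "weakly_null u"
  then obtain M where M: "\<And>n. norm (u n) \<le> M" by (auto simp: weakly_null_def)
  have M0: "M \<ge> 0" using order.trans[OF norm_ge_zero M[of 0]] .
  show "(\<lambda>n. D (u n)) \<longlonglongrightarrow> 0"
  proof (rule LIMSEQ_I)
    fix e :: real assume e: "e > 0"
    have "e / (2 * (M + 1)) > 0" using e M0 by simp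
    with lim have "\<exists>i. dist (C i) D < e / (2 * (M + 1))"
      by (metis eventually_happens' tendstoD)
    then obtain i where i: "norm (D - C i) < e / (2 * (M + 1))" by (auto simp: dist_norm norm_minus_commute)
    have "(\<lambda>n. C i (u n)) \<longlonglongrightarrow> 0" using C u by (simp add: completely_continuous_def)
    then obtain N where N: "\<And>n. n \<ge> N \<Longrightarrow> norm (C i (u n)) < e / 2"
      using LIMSEQ_D[of _ 0 "e/2"] e by fastforce
    have "norm (D (u n) - 0) < e" if "n \<ge> N" for n
    proof -
      have "norm ((D - C i) (u n)) \<le> norm (D - C i) * norm (u n)" by (rule norm_blinfun)
      also have "\<dots> \<le> (e / (2 * (M + 1))) * (M + 1)"
        using i M[of n] M0 e by (intro mult_mono) auto
      also have "\<dots> = e / 2" using M0 by (simp add: field_simps)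
      finally have "norm (D (u n) - C i (u n)) \<le> e / 2" by (simp add: blinfun.diff_left)
      moreover have "norm (D (u n)) \<le> norm (D (u n) - C i (u n)) + norm (C i (u n))"
        using norm_triangle_ineq[of "D (u n) - C i (u n)" "C i (u n)"] by simp
      ultimately show ?thesis using N[OF that] by simp
    qed
    thus "\<exists>N. \<forall>n\<ge>N. norm (D (u n) - 0) < e" by blast
  qed
qed

section \<open>Energy estimates on the half-lines\<close>

lemma set_integrable_of_integrable:
  "integrable lborel f \<Longrightarrow> S \<in> sets lborel \<Longrightarrow> set_integrable lborel S (f :: real \<Rightarrow> real)"
  unfolding set_integrable_def by (rule integrable_mult_indicator)

lemma set_integral_le_integral:
  fixes f :: "real \<Rightarrow> real"
  assumes "integrable lborel f" "S \<in> sets lborel" "\<And>t. f t \<ge> 0"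
  shows "(LBINT t:S. f t) \<le> integral\<^sup>L lborel f"
  unfolding set_lebesgue_integral_def
  using assms by (intro integral_mono integrable_mult_indicator) (auto simp: indicator_def)

text \<open>In norm(u' + S u)^2 the cross term is the derivative of (u, S u) by self-adjointness,
  and norm(u')^2 is dropped. Decay at infinity leaves the value at 0, with opposite signs on the two
  half-lines.\<close>

lemma energy_half_line:
  fixes u :: "real \<Rightarrow> 'h::{chilbert_space, second_countable_topology}"
  assumes u: "has_W12_derivative u u'" and S: "selfadjoint_op S"
  shows "(LBINT t:{..0}. (norm (S (u t)))\<^sup>2) \<le> (LBINT t:{..0}. (norm (u' t + S (u t)))\<^sup>2) - inner (u 0) (S (u 0))"
    and "(LBINT t:{0..}. (norm (S (u t)))\<^sup>2) \<le> (LBINT t:{0..}. (norm (u' t + S (u t)))\<^sup>2) + inner (u 0) (S (u 0))"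
proof -
  have v: "has_W12_derivative (\<lambda>t. S (u t)) (\<lambda>t. S (u' t))" by (rule has_W12_derivative_blinfun[OF u])
  note sq = sq_integrable_W12[OF u] sq_integrable_W12[OF v]
  let ?q = "\<lambda>t. inner (u' t) (S (u t)) + inner (u t) (S (u' t))"
  have le: "(norm (S (u t)))\<^sup>2 \<le> (norm (u' t + S (u t)))\<^sup>2 - ?q t" for t
  proof -
    have "inner (u t) (S (u' t)) = inner (u' t) (S (u t))"
      using selfadjoint_op_inner[OF S] by (metis inner_commute)
    thus ?thesis
      by (simp add: power2_norm_eq_inner inner_add_left inner_add_right inner_commute)
  qed
  have i1: "integrable lborel (\<lambda>t. (norm (S (u t)))\<^sup>2)" by (intro sq_integrable_norm_sq sq)
  have i2: "integrable lborel (\<lambda>t. (norm (u' t + S (u t)))\<^sup>2)" by (intro sq_integrable_norm_sq sq_integrable_add sq)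
  have i3: "integrable lborel ?q" by (intro Bochner_Integration.integrable_add sq_integrable_inner sq)
  have main: "(LBINT t:X. (norm (S (u t)))\<^sup>2) \<le> (LBINT t:X. (norm (u' t + S (u t)))\<^sup>2) - (LBINT t:X. ?q t)"
    if X: "X \<in> sets lborel" for X
  proof -
    note i = i1[THEN set_integrable_of_integrable, OF X] i2[THEN set_integrable_of_integrable, OF X]
      i3[THEN set_integrable_of_integrable, OF X]
    have "(LBINT t:X. (norm (S (u t)))\<^sup>2) \<le> (LBINT t:X. (norm (u' t + S (u t)))\<^sup>2 - ?q t)"
      by (rule set_integral_mono[OF i(1) set_integral_diff(1)[OF i(2,3)]]) (rule le)
    also have "\<dots> = (LBINT t:X. (norm (u' t + S (u t)))\<^sup>2) - (LBINT t:X. ?q t)"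
      by (rule set_integral_diff(2)[OF i(2,3)])
    finally show ?thesis .
  qed
  show "(LBINT t:{..0}. (norm (S (u t)))\<^sup>2) \<le> (LBINT t:{..0}. (norm (u' t + S (u t)))\<^sup>2) - inner (u 0) (S (u 0))"
    using main[of "{..0}"] has_W12_derivative_parts(3)[OF u v] by simp
  show "(LBINT t:{0..}. (norm (S (u t)))\<^sup>2) \<le> (LBINT t:{0..}. (norm (u' t + S (u t)))\<^sup>2) + inner (u 0) (S (u 0))"
    using main[of "{0..}"] has_W12_derivative_parts(2)[OF u v] by simp
qed

text \<open>What the Fredholm argument retains of the trace class hypotheses: norm limits at both
  ends and compact differences. The conditions are stable under a change of sign of the family,
  which is what the adjoint requires.\<close>

locale asymptotic_family = bounded_operator_family A K
  for A :: "real \<Rightarrow> 'h::{chilbert_space, second_countable_topology} \<Rightarrow>\<^sub>L 'h" and K +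
  fixes L\<^sub>m L\<^sub>p :: "'h \<Rightarrow>\<^sub>L 'h"
  assumes lim_bot: "(A \<longlongrightarrow> L\<^sub>m) at_bot" and lim_top: "(A \<longlongrightarrow> L\<^sub>p) at_top"
    and sa_m: "selfadjoint_op L\<^sub>m" and sa_p: "selfadjoint_op L\<^sub>p"
    and cc: "completely_continuous (A t - L\<^sub>m)"
begin

lemma cc_diff: "completely_continuous (L\<^sub>p - L\<^sub>m)"
  by (rule completely_continuous_limit[OF cc tendsto_diff[OF lim_top tendsto_const]]) simp

lemma cc_top: "completely_continuous (A t - L\<^sub>p)"
  using completely_continuous_diff[OF cc[of t] cc_diff] by simp

lemma sq_integrable_apply_diff:
  assumes f: "sq_integrable f"
  shows "sq_integrable (\<lambda>t. (A t - L) (f t))"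
proof -
  interpret L: bounded_operator_family "\<lambda>_. 0 :: 'h \<Rightarrow>\<^sub>L 'h" 0
    by unfold_locales (auto simp: selfadjoint_op_def clinear_op_def)
  have fm: "f \<in> borel_measurable lborel" using f by (simp add: sq_integrable_def)
  have Lm: "(blinfun_apply L) \<in> borel_measurable borel"
    by (intro borel_measurable_continuous_onI linear_continuous_on blinfun.bounded_linear_right)
  have "sq_integrable (\<lambda>t. L (f t))"
    by (rule sq_integrable_bounded_mult[OF f measurable_compose[OF fm Lm] norm_blinfun])
  thus ?thesis unfolding blinfun.diff_left by (intro sq_integrable_diff sq_integrable_apply f)
qed

text \<open>Outside [-T, T] the difference is small in operator norm. Inside, complete continuity
  gives convergence to 0 at every t, and the uniform bound on \<open>u\<close> makes the integrands
  dominated by a constant.\<close>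

lemma tendsto_perturbation:
  assumes u: "\<And>n. has_W12_derivative (u n) (u' n)" and u1: "\<And>n. (\<integral>t. (norm (u n t))\<^sup>2 \<partial>lborel) \<le> 1"
    and ub: "\<And>n t. (norm (u n t))\<^sup>2 \<le> C"
    and weak: "\<And>t. weakly_null (\<lambda>n. u n t)"
    and S: "S \<in> sets lborel" and ccL: "\<And>t. completely_continuous (A t - L)"
    and tail: "\<And>\<epsilon>. \<epsilon> > 0 \<Longrightarrow> \<exists>T. \<forall>t\<in>S. \<bar>t\<bar> > T \<longrightarrow> norm (A t - L) \<le> \<epsilon>"
  shows "(\<lambda>n. LBINT t:S. (norm ((A t - L) (u n t)))\<^sup>2) \<longlonglongrightarrow> 0"
proof (rule LIMSEQ_I)
  fix e :: real assume e: "e > 0"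
  \<comment> \<open>The tail contributes at most \<epsilon>^2 times an integral that is at most 1,
    that is e/2.\<close>
  define \<epsilon> where "\<epsilon> = sqrt (e / 2)"
  have eps: "\<epsilon> > 0" "\<epsilon>\<^sup>2 = e / 2" using e by (simp_all add: \<epsilon>_def)
  obtain T where T: "\<And>t. t \<in> S \<Longrightarrow> \<bar>t\<bar> > T \<Longrightarrow> norm (A t - L) \<le> \<epsilon>" using tail[OF eps(1)] by blast
  define k where "k n t = (norm ((A t - L) (u n t)))\<^sup>2" for n t
  have sqk: "sq_integrable (\<lambda>t. (A t - L) (u n t))" for n
    by (rule sq_integrable_apply_diff[OF sq_integrable_W12(1)[OF u]])
  have ik: "integrable lborel (k n)" for n
    unfolding k_def by (rule sq_integrable_norm_sq[OF sqk])
  define M where "M = (K + norm L)\<^sup>2 * C"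
  have kM: "k n t \<le> M" for n t
  proof -
    have "norm (A t - L) \<le> K + norm L" using norm_triangle_ineq4[of "A t" L] bounded[of t] by linarith
    hence "norm ((A t - L) (u n t)) \<le> (K + norm L) * norm (u n t)"
      using norm_blinfun[of "A t - L" "u n t"] by (meson mult_right_mono norm_ge_zero order.trans)
    hence "k n t \<le> ((K + norm L) * norm (u n t))\<^sup>2" unfolding k_def by (intro power_mono) auto
    also have "\<dots> \<le> M" unfolding M_def power_mult_distrib by (intro mult_left_mono ub) simp
    finally show ?thesis .
  qed
  have "(\<lambda>n. \<integral>t. indicator {-T..T} t * k n t \<partial>lborel) \<longlonglongrightarrow> (\<integral>t. 0 \<partial>(lborel :: real measure))"
  proof (rule integral_dominated_convergence[where w = "\<lambda>t. indicator {-T..T} t * M"])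
    show "integrable lborel (\<lambda>t. indicator {-T..T} t * M)"
      by (intro integrable_mult_left integrable_real_indicator) (auto simp: emeasure_lborel_Icc_eq)
    have [measurable]: "k n \<in> borel_measurable lborel" for n using ik by simp
    show "(\<lambda>t. indicator {-T..T} t * k n t) \<in> borel_measurable lborel" for n by measurable
    show "AE t in lborel. (\<lambda>n. indicator {-T..T} t * k n t) \<longlonglongrightarrow> 0"
    proof (rule AE_I2)
      fix t
      have "(\<lambda>n. (A t - L) (u n t)) \<longlonglongrightarrow> 0" using ccL weak by (simp add: completely_continuous_def)
      hence "(\<lambda>n. indicator {-T..T} t * (norm ((A t - L) (u n t)))\<^sup>2) \<longlonglongrightarrow> indicator {-T..T} t * (norm (0::'h))\<^sup>2"
        by (intro tendsto_intros)
      thus "(\<lambda>n. indicator {-T..T} t * k n t) \<longlonglongrightarrow> 0" by (simp add: k_def)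
    qed
    show "AE t in lborel. norm (indicator {-T..T} t * k n t) \<le> indicator {-T..T} t * M" for n
      using kM by (intro AE_I2) (auto simp: indicator_def k_def)
  qed simp
  hence "(\<lambda>n. \<integral>t. indicator {-T..T} t * k n t \<partial>lborel) \<longlonglongrightarrow> 0" by simp
  from LIMSEQ_D[OF this, of "e/2"] e obtain N where
    N: "\<And>n. n \<ge> N \<Longrightarrow> norm ((\<integral>t. indicator {-T..T} t * k n t \<partial>lborel) - 0) < e / 2" by (metis half_gt_zero)
  have "norm ((LBINT t:S. k n t) - 0) < e" if n: "n \<ge> N" for n
  proof -
    have iu: "integrable lborel (\<lambda>t. (norm (u n t))\<^sup>2)" by (rule sq_integrable_norm_sq[OF sq_integrable_W12(1)[OF u]])
    have iI: "integrable lborel (\<lambda>t. indicator {-T..T} t * k n t)"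
      using integrable_mult_indicator[OF _ ik[of n], of "{-T..T}"] by simp
    have "(LBINT t:S. k n t) \<le> (\<integral>t. indicator {-T..T} t * k n t + \<epsilon>\<^sup>2 * (norm (u n t))\<^sup>2 \<partial>lborel)"
      unfolding set_lebesgue_integral_def
    proof (rule integral_mono)
      show "integrable lborel (\<lambda>t. indicator S t *\<^sub>R k n t)" using integrable_mult_indicator[OF S ik] .
      show "integrable lborel (\<lambda>t. indicator {-T..T} t * k n t + \<epsilon>\<^sup>2 * (norm (u n t))\<^sup>2)"
        using iu iI by simp
      fix t
      show "indicator S t *\<^sub>R k n t \<le> indicator {-T..T} t * k n t + \<epsilon>\<^sup>2 * (norm (u n t))\<^sup>2"
      proof (cases "t \<in> S \<and> t \<notin> {-T..T}")
        case True
        hence "norm (A t - L) \<le> \<epsilon>" by (intro T) auto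
        hence "norm ((A t - L) (u n t)) \<le> \<epsilon> * norm (u n t)"
          using norm_blinfun[of "A t - L" "u n t"] by (meson mult_right_mono norm_ge_zero order.trans)
        hence "k n t \<le> (\<epsilon> * norm (u n t))\<^sup>2" unfolding k_def by (intro power_mono) auto
        thus ?thesis using True by (simp add: power_mult_distrib)
      next
        case False
        thus ?thesis by (auto simp: indicator_def k_def)
      qed
    qed
    also have "\<dots> = (\<integral>t. indicator {-T..T} t * k n t \<partial>lborel) + \<epsilon>\<^sup>2 * (\<integral>t. (norm (u n t))\<^sup>2 \<partial>lborel)"
      using iu iI by simp
    also have "\<dots> < e / 2 + \<epsilon>\<^sup>2 * 1"
      using N[OF n] by (intro add_less_le_mono mult_left_mono u1) auto
    also have "\<dots> = e" by (simp add: eps)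
    finally have "(LBINT t:S. k n t) < e" .
    moreover have "0 \<le> (LBINT t:S. k n t)"
      unfolding set_lebesgue_integral_def by (intro integral_nonneg_AE AE_I2) (simp add: k_def)
    ultimately show ?thesis by simp
  qed
  thus "\<exists>N. \<forall>n\<ge>N. norm ((LBINT t:S. (norm ((A t - L) (u n t)))\<^sup>2) - 0) < e" by (auto simp: k_def)
qed

lemma strongly_null_if_weakly_null:
  assumes c: "c > 0" "\<And>x. norm (L\<^sub>m x) \<ge> c * norm x" "\<And>x. norm (L\<^sub>p x) \<ge> c * norm x"
    and u: "\<And>n. has_W12_derivative (u n) (u' n)" and u1: "\<And>n. (\<integral>t. (norm (u n t))\<^sup>2 \<partial>lborel) \<le> 1"
    and ub: "\<And>n t. (norm (u n t))\<^sup>2 \<le> C"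
    and weak: "\<And>t. weakly_null (\<lambda>n. u n t)"
    and g: "(\<lambda>n. \<integral>t. (norm (u' n t + A t (u n t)))\<^sup>2 \<partial>lborel) \<longlonglongrightarrow> 0"
  shows "(\<lambda>n. \<integral>t. (norm (u n t))\<^sup>2 \<partial>lborel) \<longlonglongrightarrow> 0"
proof -
  have k1: "(\<lambda>n. LBINT t:{..0}. (norm ((A t - L\<^sub>m) (u n t)))\<^sup>2) \<longlonglongrightarrow> 0"
  proof (rule tendsto_perturbation[OF u u1 ub weak _ cc])
    fix \<epsilon> :: real assume "\<epsilon> > 0"
    hence "\<forall>\<^sub>F t in at_bot. dist (A t) L\<^sub>m < \<epsilon>" by (rule tendstoD[OF lim_bot])
    then obtain T where "\<And>t. t \<le> T \<Longrightarrow> dist (A t) L\<^sub>m < \<epsilon>" by (auto simp: eventually_at_bot_linorder)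
    thus "\<exists>T. \<forall>t\<in>{..0}. \<bar>t\<bar> > T \<longrightarrow> norm (A t - L\<^sub>m) \<le> \<epsilon>"
      by (intro exI[of _ "-T"]) (auto simp: dist_norm intro!: less_imp_le)
  qed simp
  have k2: "(\<lambda>n. LBINT t:{0..}. (norm ((A t - L\<^sub>p) (u n t)))\<^sup>2) \<longlonglongrightarrow> 0"
  proof (rule tendsto_perturbation[OF u u1 ub weak _ cc_top])
    fix \<epsilon> :: real assume "\<epsilon> > 0"
    hence "\<forall>\<^sub>F t in at_top. dist (A t) L\<^sub>p < \<epsilon>" by (rule tendstoD[OF lim_top])
    then obtain T where "\<And>t. t \<ge> T \<Longrightarrow> dist (A t) L\<^sub>p < \<epsilon>" by (auto simp: eventually_at_top_linorder)
    thus "\<exists>T. \<forall>t\<in>{0..}. \<bar>t\<bar> > T \<longrightarrow> norm (A t - L\<^sub>p) \<le> \<epsilon>"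
      by (intro exI[of _ T]) (auto simp: dist_norm intro!: less_imp_le)
  qed simp
  define b where "b n = inner (u n 0) ((L\<^sub>p - L\<^sub>m) (u n 0))" for n
  have b0: "b \<longlonglongrightarrow> 0"
  proof -
    have "(\<lambda>n. norm ((L\<^sub>p - L\<^sub>m) (u n 0))) \<longlonglongrightarrow> 0"
      using cc_diff weak by (simp add: completely_continuous_def tendsto_norm_zero)
    hence "(\<lambda>n. sqrt C * norm ((L\<^sub>p - L\<^sub>m) (u n 0))) \<longlonglongrightarrow> sqrt C * 0" by (intro tendsto_intros)
    hence lim: "(\<lambda>n. sqrt C * norm ((L\<^sub>p - L\<^sub>m) (u n 0))) \<longlonglongrightarrow> 0" by simp
    have "norm (b n) \<le> sqrt C * norm ((L\<^sub>p - L\<^sub>m) (u n 0))" for n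
    proof -
      have "norm (b n) \<le> norm (u n 0) * norm ((L\<^sub>p - L\<^sub>m) (u n 0))"
        unfolding b_def using Cauchy_Schwarz_ineq2 by simp
      also have "norm (u n 0) \<le> sqrt C" using ub[of n 0] by (simp add: real_le_rsqrt)
      hence "norm (u n 0) * norm ((L\<^sub>p - L\<^sub>m) (u n 0)) \<le> sqrt C * norm ((L\<^sub>p - L\<^sub>m) (u n 0))"
        by (intro mult_right_mono) auto
      finally show ?thesis .
    qed
    thus ?thesis by (intro Lim_null_comparison[OF _ lim] always_eventually allI)
  qed
  define G where "G n = (\<integral>t. (norm (u' n t + A t (u n t)))\<^sup>2 \<partial>lborel)" for n
  \<comment> \<open>The shared estimate for both half-lines. The lower bound of \<open>L\<close>
    meets the energy inequality, and u' + L u is split as (u' + A u) - (A - L) u; the factors 2 come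
    from squaring this sum. The boundary term is \<open>s\<close>.\<close>
  have half: "c\<^sup>2 * (LBINT t:S. (norm (u n t))\<^sup>2) \<le> 2 * G n + 2 * (LBINT t:S. (norm ((A t - L) (u n t)))\<^sup>2) + s"
    if S: "S \<in> sets lborel" and L: "\<And>x. norm (L x) \<ge> c * norm x"
      and E: "(LBINT t:S. (norm (L (u n t)))\<^sup>2) \<le> (LBINT t:S. (norm (u' n t + L (u n t)))\<^sup>2) + s"
    for S s n and L :: "'h \<Rightarrow>\<^sub>L 'h"
  proof -
    note sq = sq_integrable_W12[OF u[of n]]
    have sqL: "sq_integrable (\<lambda>t. L (u n t))"
      using sq_integrable_diff[OF sq_integrable_apply[OF sq(1)] sq_integrable_apply_diff[OF sq(1), of L]]
      by (simp add: blinfun.diff_left)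
    have i0: "set_integrable lborel S (\<lambda>t. (norm (u n t))\<^sup>2)"
      and i1: "set_integrable lborel S (\<lambda>t. (norm (L (u n t)))\<^sup>2)"
      and i2: "set_integrable lborel S (\<lambda>t. (norm (u' n t + L (u n t)))\<^sup>2)"
      and i3: "set_integrable lborel S (\<lambda>t. (norm (u' n t + A t (u n t)))\<^sup>2)"
      and i4: "set_integrable lborel S (\<lambda>t. (norm ((A t - L) (u n t)))\<^sup>2)"
      by (intro set_integrable_of_integrable S sq_integrable_norm_sq sq_integrable_add sq sqL
          sq_integrable_apply sq_integrable_apply_diff)+
    have "c\<^sup>2 * (LBINT t:S. (norm (u n t))\<^sup>2) = (LBINT t:S. c\<^sup>2 * (norm (u n t))\<^sup>2)" by simp
    also have "\<dots> \<le> (LBINT t:S. (norm (L (u n t)))\<^sup>2)"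
    proof (rule set_integral_mono[OF _ i1])
      show "set_integrable lborel S (\<lambda>t. c\<^sup>2 * (norm (u n t))\<^sup>2)" using i0 by simp
      show "c\<^sup>2 * (norm (u n t))\<^sup>2 \<le> (norm (L (u n t)))\<^sup>2" for t
        unfolding power_mult_distrib[symmetric] using c(1) by (intro power_mono L) simp
    qed
    also have "\<dots> \<le> (LBINT t:S. (norm (u' n t + L (u n t)))\<^sup>2) + s" by (rule E)
    also have "(LBINT t:S. (norm (u' n t + L (u n t)))\<^sup>2)
        \<le> (LBINT t:S. 2 * (norm (u' n t + A t (u n t)))\<^sup>2 + 2 * (norm ((A t - L) (u n t)))\<^sup>2)"
    proof (rule set_integral_mono[OF i2])
      show "set_integrable lborel S (\<lambda>t. 2 * (norm (u' n t + A t (u n t)))\<^sup>2 + 2 * (norm ((A t - L) (u n t)))\<^sup>2)"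
        using i3 i4 by (intro set_integral_add(1)) simp_all
      fix t
      have eq: "u' n t + L (u n t) = (u' n t + A t (u n t)) + (- (A t - L) (u n t))"
        by (simp add: blinfun.diff_left)
      show "(norm (u' n t + L (u n t)))\<^sup>2 \<le> 2 * (norm (u' n t + A t (u n t)))\<^sup>2 + 2 * (norm ((A t - L) (u n t)))\<^sup>2"
        using norm_add_sq_le[of "u' n t + A t (u n t)" "- (A t - L) (u n t)"]
        unfolding eq[symmetric] norm_minus_cancel .
    qed
    also have "\<dots> = 2 * (LBINT t:S. (norm (u' n t + A t (u n t)))\<^sup>2) + 2 * (LBINT t:S. (norm ((A t - L) (u n t)))\<^sup>2)"
      using i3 i4 by (subst set_integral_add(2)) simp_all
    also have "(LBINT t:S. (norm (u' n t + A t (u n t)))\<^sup>2) \<le> G n"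
      unfolding G_def by (intro set_integral_le_integral S sq_integrable_norm_sq sq_integrable_add sq sq_integrable_apply) simp
    finally show ?thesis by simp
  qed
  define P where "P n = (LBINT t:{..0}. (norm ((A t - L\<^sub>m) (u n t)))\<^sup>2)" for n
  define Q where "Q n = (LBINT t:{0..}. (norm ((A t - L\<^sub>p) (u n t)))\<^sup>2)" for n
  have est: "(\<integral>t. (norm (u n t))\<^sup>2 \<partial>lborel) \<le> (4 * G n + 2 * P n + 2 * Q n + b n) / c\<^sup>2" for n
  proof -
    have iu: "integrable lborel (\<lambda>t. (norm (u n t))\<^sup>2)" by (rule sq_integrable_norm_sq[OF sq_integrable_W12(1)[OF u]])
    \<comment> \<open>The half-lines share the point 0; since the integrands are nonnegative,
      counting it twice preserves the inequality.\<close>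
    have "(\<integral>t. (norm (u n t))\<^sup>2 \<partial>lborel)
        \<le> (\<integral>t. indicator {..0} t *\<^sub>R (norm (u n t))\<^sup>2 + indicator {0..} t *\<^sub>R (norm (u n t))\<^sup>2 \<partial>lborel)"
      by (intro integral_mono iu Bochner_Integration.integrable_add integrable_mult_indicator[OF _ iu])
         (auto simp: indicator_def)
    also have "\<dots> = (LBINT t:{..0}. (norm (u n t))\<^sup>2) + (LBINT t:{0..}. (norm (u n t))\<^sup>2)"
      unfolding set_lebesgue_integral_def
      by (intro Bochner_Integration.integral_add integrable_mult_indicator[OF _ iu]) simp_all
    finally have "c\<^sup>2 * (\<integral>t. (norm (u n t))\<^sup>2 \<partial>lborel)
        \<le> c\<^sup>2 * ((LBINT t:{..0}. (norm (u n t))\<^sup>2) + (LBINT t:{0..}. (norm (u n t))\<^sup>2))"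
      by (intro mult_left_mono) auto
    also have "\<dots> \<le> (2 * G n + 2 * P n + (- inner (u n 0) (L\<^sub>m (u n 0)))) + (2 * G n + 2 * Q n + inner (u n 0) (L\<^sub>p (u n 0)))"
      unfolding distrib_left P_def Q_def
      by (intro add_mono half c) (use energy_half_line[OF u sa_m] energy_half_line[OF u sa_p] in simp_all)
    also have "\<dots> = 4 * G n + 2 * P n + 2 * Q n + b n"
      by (simp add: b_def blinfun.diff_left inner_diff_right)
    finally show ?thesis using c(1) by (simp add: field_simps)
  qed
  have "(\<lambda>n. (4 * G n + 2 * P n + 2 * Q n + b n) / c\<^sup>2) \<longlonglongrightarrow> (4 * 0 + 2 * 0 + 2 * 0 + 0) / c\<^sup>2"
    using g k1 k2 c(1) by (intro tendsto_intros b0) (simp_all add: G_def P_def Q_def)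
  hence lim: "(\<lambda>n. (4 * G n + 2 * P n + 2 * Q n + b n) / c\<^sup>2) \<longlonglongrightarrow> 0" by simp
  show ?thesis
    by (rule Lim_null_comparison[OF _ lim]) (use est in simp)
qed
end

section \<open>Weak convergence at single points\<close>

lemma sq_integrable_indicator_const: "sq_integrable (\<lambda>t. indicator {a..b} t *\<^sub>R h)"
  by (rule sq_integrable_compact_support[where C = "norm h"]) (auto simp: indicator_def)

lemma inner_indicator_const:
  assumes u: "sq_integrable u"
  shows "inner (abs_l2 (\<lambda>t. indicator {a..b} t *\<^sub>R h)) (abs_l2 u) = (LBINT t:{a..b}. inner h (u t))"
  using inner_abs_l2[OF sq_integrable_indicator_const u] by (simp add: set_lebesgue_integral_def)

text \<open>On a short interval an element of \<open>W\<^sup>1\<^sup>,\<^sup>2\<close> is close to its mean, so that weak convergence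
  tested against step functions gives weak convergence at every point.\<close>

lemma inner_point_le_mean:
  fixes u :: "real \<Rightarrow> 'h::{chilbert_space, second_countable_topology}"
  assumes u: "has_W12_derivative u u'" and ab: "t \<le> a" "a < b" "b \<le> t + \<delta>" and \<eta>: "\<eta> > 0"
    and M: "(\<integral>r. (norm (u' r))\<^sup>2 \<partial>lborel) \<le> M"
  shows "\<bar>inner h (u t)\<bar> \<le> \<bar>LBINT s:{a..b}. inner h (u s)\<bar> / (b - a) + norm h * (\<eta> * M + \<delta> / \<eta>)"
proof -
  let ?R = "restrict_space lborel {a..b}"
  define r where "r = norm h * (\<eta> * M + \<delta> / \<eta>)"
  have lu: "locally_integrable u" by (rule sq_integrable_locally_integrable[OF sq_integrable_W12(1)[OF u]])
  have ih: "integrable ?R (\<lambda>s. inner h (u s))"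
    using locally_integrableD[OF lu, of a b] by (intro integrable_inner_right) (simp add: set_integrable_eq_restrict)
  have ic: "integrable ?R (\<lambda>s. c)" for c :: real
    using locally_integrableD[OF locally_integrable_const, of a b] by (simp only: set_integrable_eq_restrict sets_lborel atLeastAtMost_borel)
  have mc: "(\<integral>s. c \<partial>?R) = (b - a) * c" for c :: real
    using set_integral_const_Icc[of a b c] ab by (simp only: set_integral_eq_restrict sets_lborel atLeastAtMost_borel less_imp_le)
  have close: "\<bar>inner h (u t) - inner h (u s)\<bar> \<le> r" if s: "s \<in> {a..b}" for s
  proof -
    have "\<bar>inner h (u t) - inner h (u s)\<bar> \<le> norm h * norm (u s - u t)"
      using Cauchy_Schwarz_ineq2[of h "u t - u s"] by (simp add: inner_diff_right norm_minus_commute)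
    also have "norm (u s - u t) \<le> \<eta> * (\<integral>r. (norm (u' r))\<^sup>2 \<partial>lborel) + (s - t) / \<eta>"
      by (rule has_W12_derivative_diff_le[OF u _ \<eta>]) (use s ab in auto)
    also have "\<dots> \<le> \<eta> * M + \<delta> / \<eta>"
      by (intro add_mono mult_left_mono divide_right_mono M) (use \<eta> s ab in auto)
    finally show ?thesis by (simp add: r_def mult_left_mono)
  qed
  have "(b - a) * inner h (u t) = (\<integral>s. inner h (u t) - inner h (u s) \<partial>?R) + (\<integral>s. inner h (u s) \<partial>?R)"
    by (simp only: Bochner_Integration.integral_diff[OF ic ih] mc)
  also have "\<bar>\<dots>\<bar> \<le> \<bar>\<integral>s. inner h (u t) - inner h (u s) \<partial>?R\<bar> + \<bar>\<integral>s. inner h (u s) \<partial>?R\<bar>" by (rule abs_triangle_ineq)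
  also have "\<bar>\<integral>s. inner h (u t) - inner h (u s) \<partial>?R\<bar> \<le> (\<integral>s. \<bar>inner h (u t) - inner h (u s)\<bar> \<partial>?R)"
    by (rule integral_abs_bound)
  also have "\<dots> \<le> (\<integral>s. r \<partial>?R)"
    by (rule integral_mono[OF integrable_abs[OF Bochner_Integration.integrable_diff[OF ic ih]] ic])
       (use close in \<open>simp add: space_restrict_space\<close>)
  also have "\<dots> = (b - a) * r" by (rule mc)
  finally have "\<bar>(b - a) * inner h (u t)\<bar> \<le> (b - a) * r + \<bar>LBINT s:{a..b}. inner h (u s)\<bar>"
    by (simp add: set_integral_eq_restrict)
  hence "(b - a) * \<bar>inner h (u t)\<bar> \<le> (b - a) * r + \<bar>LBINT s:{a..b}. inner h (u s)\<bar>"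
    using ab by (simp add: abs_mult)
  thus ?thesis using ab unfolding r_def[symmetric] by (simp add: field_simps)
qed

context asymptotic_family
begin

lemma uminus: "asymptotic_family (\<lambda>t. - A t) K (- L\<^sub>m) (- L\<^sub>p)"
proof (intro asymptotic_family.intro bounded_operator_family_uminus asymptotic_family_axioms.intro)
  show "bounded_operator_family A K" by (rule bounded_operator_family_axioms)
  show "((\<lambda>t. - A t) \<longlongrightarrow> - L\<^sub>m) at_bot" by (rule tendsto_minus[OF lim_bot])
  show "((\<lambda>t. - A t) \<longlongrightarrow> - L\<^sub>p) at_top" by (rule tendsto_minus[OF lim_top])
  show "selfadjoint_op (- L\<^sub>m)" "selfadjoint_op (- L\<^sub>p)" by (intro selfadjoint_op_uminus sa_m sa_p)+
  show "completely_continuous (- A t - - L\<^sub>m)" for t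
    using completely_continuous_uminus[OF cc[of t]] by simp
qed

text \<open>If the estimate fails for every constant and every number of functionals from one fixed
  enumeration, normalized counterexamples form a sequence on which all these functionals tend to 0.
  The enumeration is chosen so that this already means weak convergence at every point.\<close>

lemma D_op_estimate:
  assumes c: "c > 0" "\<And>x. norm (L\<^sub>m x) \<ge> c * norm x" "\<And>x. norm (L\<^sub>p x) \<ge> c * norm x"
  shows "\<exists>C (N::nat) v. \<forall>(x, y)\<in>D_op A. norm x \<le> C * (norm y + (\<Sum>k<N. cmod (cinner (v k) x)))"
proof (rule ccontr)
  assume neg: "\<not> ?thesis"
  obtain D :: "'h set" where D: "countable D" "\<And>X. open X \<Longrightarrow> X \<noteq> {} \<Longrightarrow> \<exists>d\<in>D. d \<in> X"
    using countable_dense_exists by blast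
  \<comment> \<open>Pairing with such a step function gives the integral of (h, u) over an interval;
    a dense set of \<open>h\<close> and arbitrarily short rational intervals near each point are
    enough, and the set is countable.\<close>
  define V where "V = (\<lambda>(a, b, h). abs_l2 (\<lambda>t. indicator {a..b} t *\<^sub>R h)) ` (\<rat> \<times> \<rat> \<times> D)"
  have cV: "countable V" unfolding V_def by (intro countable_image countable_SIGMA countable_rat D)
  define v where "v = from_nat_into V"
  have "\<exists>x y. (x, y) \<in> D_op A \<and> norm x = 1 \<and> norm y < 1 / real (Suc n) \<and>
      (\<forall>k<Suc n. cmod (cinner (v k) x) < 1 / real (Suc n))" for n
  proof -
    obtain x y where xy: "(x, y) \<in> D_op A"
        "\<not> norm x \<le> real (Suc n) * (norm y + (\<Sum>k<Suc n. cmod (cinner (v k) x)))"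
      \<comment> \<open>Constant and number of functionals grow together, so each functional is
        tested from some index on, with a bound that tends to 0.\<close>
      using neg[unfolded not_ex, THEN spec, of "real (Suc n)", THEN spec, of "Suc n", THEN spec, of v]
      by (auto simp del: sum.lessThan_Suc of_nat_Suc)
    have sum0: "0 \<le> (\<Sum>k<Suc n. cmod (cinner (v k) x))" by (intro sum_nonneg) simp
    have xpos: "norm x > 0"
      using xy(2) sum0 by (smt (verit) mult_nonneg_nonneg norm_ge_zero of_nat_0_le_iff)
    define r where "r = complex_of_real (1 / norm x)"
    have r: "cmod r = 1 / norm x" using xpos by (simp add: r_def norm_divide)
    have lt: "norm y + (\<Sum>k<Suc n. cmod (cinner (v k) x)) < norm x / real (Suc n)"
      using xy(2) by (simp add: field_simps del: sum.lessThan_Suc of_nat_Suc)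
    have "cmod (cinner (v k) (r *\<^sub>C x)) < 1 / real (Suc n)" if "k < Suc n" for k
    proof -
      have "cmod (cinner (v k) x) \<le> (\<Sum>k<Suc n. cmod (cinner (v k) x))"
        by (rule member_le_sum) (use that in auto)
      hence "cmod (cinner (v k) x) < norm x / real (Suc n)" using lt norm_ge_zero[of y] by linarith
      thus ?thesis using xpos by (simp add: cinner_scaleC_right norm_mult r field_simps del: of_nat_Suc)
    qed
    moreover have "norm (r *\<^sub>C y) < 1 / real (Suc n)"
    proof -
      have "norm y < norm x / real (Suc n)" using lt sum0 by linarith
      thus ?thesis using xpos by (simp add: norm_scaleC r field_simps del: of_nat_Suc)
    qed
    moreover have "norm (r *\<^sub>C x) = 1" using xpos by (simp add: norm_scaleC r)
    moreover have "(r *\<^sub>C x, r *\<^sub>C y) \<in> D_op A"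
      by (rule complex_linear_relationD(3)[OF complex_linear_relation_D_op xy(1)])
    ultimately show ?thesis by blast
  qed
  then obtain x y where xy: "\<And>n. (x n, y n) \<in> D_op A" "\<And>n. norm (x n) = 1"
      "\<And>n. norm (y n) < 1 / real (Suc n)"
      "\<And>n k. k < Suc n \<Longrightarrow> cmod (cinner (v k) (x n)) < 1 / real (Suc n)" by metis
  have "\<exists>u u'. x n = abs_l2 u \<and> y n - mult_op A (x n) = abs_l2 u' \<and> has_W12_derivative u u'" for n
    using xy(1)[of n] unfolding D_op_iff ddt_op_iff .
  then obtain u u' where u: "\<And>n. x n = abs_l2 (u n)" "\<And>n. y n - mult_op A (x n) = abs_l2 (u' n)"
      "\<And>n. has_W12_derivative (u n) (u' n)" by metis
  note sq = sq_integrable_W12[OF u(3)]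
  have nu: "(\<integral>t. (norm (u n t))\<^sup>2 \<partial>lborel) = 1" for n
    using norm_abs_l2[OF sq(1)[of n]] xy(2)[of n] by (simp add: u(1))
  have inv: "1 / real (Suc n) \<le> 1" for n by simp
  have inv0: "(\<lambda>n. 1 / real (Suc n)) \<longlonglongrightarrow> 0" by (rule LIMSEQ_Suc[OF lim_1_over_n])
  have K0: "K \<ge> 0" using order.trans[OF norm_ge_zero bounded] .
  define M where "M = (1 + K)\<^sup>2"
  \<comment> \<open>The derivative is y - A x, with norm(y) < 1 and norm(A x) <= K; this bound makes
    the oscillation estimate uniform in the sequence.\<close>
  have nu': "(\<integral>t. (norm (u' n t))\<^sup>2 \<partial>lborel) \<le> M" for n
  proof -
    have "norm (mult_op A (x n)) \<le> K"
      using norm_mult_op_le[OF sq(1)[of n] K0 norm_apply_le] xy(2)[of n] by (simp add: u(1))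
    hence "norm (abs_l2 (u' n)) \<le> 1 + K"
      using norm_triangle_ineq4[of "y n" "mult_op A (x n)"] xy(3)[of n] inv[of n] unfolding u(2) by linarith
    hence "(norm (abs_l2 (u' n)))\<^sup>2 \<le> M" unfolding M_def by (intro power_mono) auto
    thus ?thesis by (simp add: norm_abs_l2 sq)
  qed
  have ub: "(norm (u n t))\<^sup>2 \<le> 2 + M" for n t
    using has_W12_derivative_sq_le[OF u(3), of n t] nu[of n] nu'[of n] by linarith
  have M0: "M \<ge> 0" by (simp add: M_def)
  define S where "S = sqrt (2 + M)"
  have us: "norm (u n t) \<le> S" for n t using ub[of n t] by (simp add: S_def real_le_rsqrt)
  have S0: "S \<ge> 0" using M0 by (simp add: S_def)
  have step: "(\<lambda>n. LBINT t:{a..b}. inner d (u n t)) \<longlonglongrightarrow> 0" if abd: "a \<in> \<rat>" "b \<in> \<rat>" "d \<in> D" for a b d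
  proof -
    have "abs_l2 (\<lambda>t. indicator {a..b} t *\<^sub>R d) \<in> V" using abd unfolding V_def by force
    then obtain k where k: "v k = abs_l2 (\<lambda>t. indicator {a..b} t *\<^sub>R d)"
      unfolding v_def using from_nat_into_surj[OF cV] by blast
    have ev: "\<forall>\<^sub>F n in sequentially. norm (LBINT t:{a..b}. inner d (u n t)) \<le> 1 / real (Suc n)"
      using eventually_ge_at_top[of k]
    proof eventually_elim
      case (elim n)
      have "norm (LBINT t:{a..b}. inner d (u n t)) = \<bar>Re (cinner (v k) (x n))\<bar>"
        unfolding Re_cinner k u(1) by (simp add: inner_indicator_const[OF sq(1)])
      also have "\<dots> \<le> cmod (cinner (v k) (x n))" by (rule abs_Re_le_cmod)
      also have "\<dots> \<le> 1 / real (Suc n)" by (rule less_imp_le[OF xy(4)]) (use elim in simp)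
      finally show ?case .
    qed
    show ?thesis by (rule Lim_null_comparison[OF ev inv0])
  qed
  have weak: "weakly_null (\<lambda>n. u n t)" for t
    unfolding weakly_null_def
  proof (intro conjI allI)
    show "\<exists>M. \<forall>n. norm (u n t) \<le> M" using us by blast
    fix h
    show "(\<lambda>n. inner h (u n t)) \<longlonglongrightarrow> 0"
    proof (rule LIMSEQ_I)
      fix e :: real assume e: "e > 0"
      \<comment> \<open>Error budget: replacing \<open>h\<close> by the dense \<open>d\<close> costs
        e/4, the two parts of the oscillation cost e/8 each, and the mean is eventually below e/4.
        Here \<eta> is fixed before \<delta>, which must be small relative to it.\<close>
      define \<rho> where "\<rho> = e / (4 * (S + 1))"
      have \<rho>: "\<rho> > 0" using e S0 by (simp add: \<rho>_def)
      obtain d where d: "d \<in> D" "d \<in> ball h \<rho>" using D(2)[of "ball h \<rho>"] \<rho> by auto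
      define \<eta> where "\<eta> = e / (8 * (norm d + 1) * (M + 1))"
      have \<eta>: "\<eta> > 0" using e M0 by (simp add: \<eta>_def add_nonneg_pos)
      define \<delta> where "\<delta> = \<eta> * e / (8 * (norm d + 1))"
      have \<delta>: "\<delta> > 0" using e \<eta> by (simp add: \<delta>_def add_nonneg_pos)
      obtain a where a: "a \<in> \<rat>" "t < a" "a < t + \<delta>" using Rats_dense_in_real[of t "t + \<delta>"] \<delta> by auto
      obtain b where b: "b \<in> \<rat>" "a < b" "b < t + \<delta>" using Rats_dense_in_real[of a "t + \<delta>"] a by auto
      have small: "norm d * (\<eta> * M + \<delta> / \<eta>) \<le> e / 4"
      proof -
        have nd: "norm d + 1 > 0" using norm_ge_zero[of d] by linarith
        have "norm d * (\<eta> * M) \<le> (norm d + 1) * (\<eta> * (M + 1))"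
          using \<eta> M0 by (intro mult_mono) auto
        also have "\<dots> = e / 8"
        proof -
          have "p * (e / (8 * p * q) * q) = e / 8" if "p > 0" "q > 0" for p q :: real
            using that by (simp add: field_simps)
          from this[OF nd, of "M + 1"] M0 show ?thesis by (simp add: \<eta>_def)
        qed
        finally have 1: "norm d * (\<eta> * M) \<le> e / 8" .
        have "norm d * (\<delta> / \<eta>) \<le> (norm d + 1) * (\<delta> / \<eta>)" using \<eta> \<delta> by (intro mult_right_mono) auto
        also have "\<dots> = e / 8"
        proof -
          have "p * (q * e / (8 * p) / q) = e / 8" if "p > 0" "q > 0" for p q :: real
            using that by (simp add: field_simps)
          from this[OF nd \<eta>] show ?thesis by (simp add: \<delta>_def)
        qed
        finally show ?thesis using 1 unfolding distrib_left by linarith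
      qed
      have "(\<lambda>n. \<bar>LBINT s:{a..b}. inner d (u n s)\<bar> / (b - a)) \<longlonglongrightarrow> \<bar>0\<bar> / (b - a)"
        by (intro tendsto_intros step a b d) (use b in simp)
      hence "\<forall>\<^sub>F n in sequentially. \<bar>LBINT s:{a..b}. inner d (u n s)\<bar> / (b - a) < e / 4"
        by (rule order_tendstoD(2)) (use e in simp)
      hence "\<forall>\<^sub>F n in sequentially. norm (inner h (u n t) - 0) < e"
      proof eventually_elim
        case (elim n)
        have "\<bar>inner d (u n t)\<bar> \<le> \<bar>LBINT s:{a..b}. inner d (u n s)\<bar> / (b - a) + norm d * (\<eta> * M + \<delta> / \<eta>)"
          by (rule inner_point_le_mean[OF u(3) _ _ _ \<eta> nu']) (use a b in simp_all)
        hence 1: "\<bar>inner d (u n t)\<bar> < e / 2" using elim small by linarith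
        have "\<bar>inner (h - d) (u n t)\<bar> \<le> norm (h - d) * norm (u n t)" by (rule Cauchy_Schwarz_ineq2)
        also have "\<dots> \<le> \<rho> * (S + 1)"
          using d us[of n t] \<rho> by (intro mult_mono) (auto simp: dist_norm)
        also have "\<dots> = e / 4" using S0 by (simp add: \<rho>_def field_simps)
        finally have 2: "\<bar>inner (h - d) (u n t)\<bar> \<le> e / 4" .
        have "inner h (u n t) = inner d (u n t) + inner (h - d) (u n t)" by (simp add: inner_diff_left)
        with 1 2 e show ?case unfolding real_norm_def by linarith
      qed
      thus "\<exists>N. \<forall>n\<ge>N. norm (inner h (u n t) - 0) < e" by (simp only: eventually_sequentially)
    qed
  qed
  have g: "(\<lambda>n. \<integral>t. (norm (u' n t + A t (u n t)))\<^sup>2 \<partial>lborel) \<longlonglongrightarrow> 0"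
  proof -
    have eq: "(\<integral>t. (norm (u' n t + A t (u n t)))\<^sup>2 \<partial>lborel) = (norm (y n))\<^sup>2" for n
    proof -
      have "y n = abs_l2 (u' n) + mult_op A (abs_l2 (u n))" using u(1,2)[of n] by (simp add: algebra_simps)
      also have "\<dots> = abs_l2 (\<lambda>t. u' n t + A t (u n t))"
        by (simp add: mult_op_abs_l2 plus_abs_l2 sq_integrable_apply sq)
      finally show ?thesis by (simp add: norm_abs_l2 sq_integrable_add sq_integrable_apply sq)
    qed
    have "y \<longlonglongrightarrow> 0" by (rule Lim_null_comparison[OF _ inv0]) (use xy(3) less_imp_le in \<open>blast intro: always_eventually\<close>)
    hence "(\<lambda>n. (norm (y n))\<^sup>2) \<longlonglongrightarrow> (norm (0 :: 'h l2))\<^sup>2" by (intro tendsto_intros)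
    thus ?thesis by (simp add: eq)
  qed
  have "(\<lambda>n. \<integral>t. (norm (u n t))\<^sup>2 \<partial>lborel) \<longlonglongrightarrow> 0"
    by (rule strongly_null_if_weakly_null[OF c u(3) _ ub weak g]) (simp_all add: nu)
  thus False by (simp add: nu LIMSEQ_const_iff)
qed

lemma mult_op_uminus: "mult_op (\<lambda>t. - A t) x = - mult_op A x"
  unfolding mult_op_def blinfun.minus_left
  by (rule uminus_abs_l2[symmetric]) (intro sq_integrable_apply sq_integrable_rep_l2)

lemma closed_Range_D_op:
  assumes c: "c > 0" "\<And>x. norm (L\<^sub>m x) \<ge> c * norm x" "\<And>x. norm (L\<^sub>p x) \<ge> c * norm x"
  shows "closed (Range (D_op A)) \<and> finite_dim (op_ker (D_op A))"
proof -
  obtain C v and N :: nat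
    where *: "\<And>x y. (x, y) \<in> D_op A \<Longrightarrow> norm x \<le> C * (norm y + (\<Sum>k<N. cmod (cinner (v k) x)))"
    using D_op_estimate[OF c] by blast
  show ?thesis by (rule closed_Range_if_estimate[OF complex_linear_relation_D_op closed_D_op *])
qed

text \<open>An element of the adjoint kernel solves y' = A y, which is the kernel equation for the
  family \<open>- A\<close>; the lower bounds at both ends do not see the sign.\<close>

lemma Fredholm_if_bounded_below:
  assumes c: "c > 0" "\<And>x. norm (L\<^sub>m x) \<ge> c * norm x" "\<And>x. norm (L\<^sub>p x) \<ge> c * norm x"
  shows "Fredholm (D_op A)"
proof -
  interpret neg: asymptotic_family "\<lambda>t. - A t" K "- L\<^sub>m" "- L\<^sub>p" by (rule uminus)
  have "op_ker (op_adjoint (D_op A)) = op_ker (D_op (\<lambda>t. - A t))"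
    unfolding op_ker_def op_adjoint_D_op neg.D_op_iff by (simp add: mult_op_uminus)
  moreover have "finite_dim (op_ker (D_op (\<lambda>t. - A t)))"
    using neg.closed_Range_D_op[OF c(1)] c(2,3) by (simp add: blinfun.minus_left)
  ultimately show ?thesis using closed_Range_D_op[OF c] by (simp add: Fredholm_def)
qed

end

section \<open>Singular sequences\<close>

text \<open>Squaring smooths the corner: at 0 the difference quotient is bounded by the modulus of
  h. The bump below is therefore continuously differentiable.\<close>

lemma DERIV_max_0_square: "((\<lambda>z::real. (max 0 z)\<^sup>2) has_real_derivative 2 * max 0 z) (at z)"
proof (cases z "0::real" rule: linorder_cases)
  case less
  have "((\<lambda>_::real. 0::real) has_real_derivative 0) (at z)" by simp
  hence "((\<lambda>z::real. (max 0 z)\<^sup>2) has_real_derivative 0) (at z)"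
    by (rule has_field_derivative_transform_within_open[where S = "{..<0}"]) (use less in auto)
  thus ?thesis using less by simp
next
  case greater
  have "((\<lambda>z::real. z\<^sup>2) has_real_derivative 2 * z) (at z)" by (auto intro!: derivative_eq_intros)
  hence "((\<lambda>z::real. (max 0 z)\<^sup>2) has_real_derivative 2 * z) (at z)"
    by (rule has_field_derivative_transform_within_open[where S = "{0<..}"]) (use greater in auto)
  thus ?thesis using greater by simp
next
  case equal
  have lim: "((\<lambda>h::real. \<bar>h\<bar>) \<longlongrightarrow> 0) (at 0)" by (rule tendsto_rabs_zero) (rule tendsto_ident_at)
  have "norm (((max 0 h)\<^sup>2 - 0) / h) \<le> \<bar>h\<bar>" for h :: real
    by (cases "h > 0") (auto simp: power2_eq_square)
  hence "\<forall>\<^sub>F h in at 0. norm (((max 0 h)\<^sup>2 - 0) / h) \<le> \<bar>h\<bar>" by (intro always_eventually allI)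
  hence "((\<lambda>h::real. ((max 0 h)\<^sup>2 - 0) / h) \<longlongrightarrow> 0) (at 0)"
    by (rule Lim_null_comparison[OF _ lim])
  thus ?thesis unfolding equal has_field_derivative_iff by simp
qed

lemma has_ac_derivative_continuous_derivative:
  fixes F :: "real \<Rightarrow> real"
  assumes F: "\<And>t. (F has_real_derivative f t) (at t)" and f: "continuous_on UNIV f"
  shows "has_ac_derivative F f"
  unfolding has_ac_derivative_def locally_integrable_def
proof (intro conjI allI)
  show "set_integrable lborel {a..b} f" for a b
    by (rule borel_integrable_atLeastAtMost') (rule continuous_on_subset[OF f], simp)
  fix t0 t
  have "(LBINT s=ereal t0..ereal t. f s) = F t - F t0"
  proof (rule interval_integral_FTC_finite)
    show "continuous_on {min t0 t..max t0 t} f" by (rule continuous_on_subset[OF f]) simp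
    show "(F has_vector_derivative f x) (at x within {min t0 t..max t0 t})" for x
      by (rule has_vector_derivative_at_within) (use F[of x] in \<open>simp add: has_real_derivative_iff_has_vector_derivative\<close>)
  qed
  thus "F t = F t0 + (LBINT s=ereal t0..ereal t. f s)" by simp
qed

text \<open>The squared positive part of the parabola with zeros at a and a + 2R and maximum 1. The
  parabola has slope at most 2/R there, which gives 4/R; on the middle half it is at least 3/4, and
  (3/4)^2 >= 1/2.\<close>

lemma ex_bump:
  assumes R: "R > 0"
  shows "\<exists>\<phi> \<phi>' :: real \<Rightarrow> real. has_ac_derivative \<phi> \<phi>' \<and> continuous_on UNIV \<phi> \<and> continuous_on UNIV \<phi>' \<and>
    (\<forall>t. t \<notin> {a<..<a+2*R} \<longrightarrow> \<phi> t = 0) \<and> (\<forall>t. \<bar>\<phi> t\<bar> \<le> indicator {a..a+2*R} t) \<and>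
    (\<forall>t. \<bar>\<phi>' t\<bar> \<le> (4 / R) * indicator {a..a+2*R} t) \<and> (\<forall>t\<in>{a+R/2..a+3*R/2}. \<phi> t \<ge> 1/2)"
proof -
  define w where "w t = 1 - ((t - a - R) / R)\<^sup>2" for t
  define \<phi> where "\<phi> t = (max 0 (w t))\<^sup>2" for t
  define \<phi>' where "\<phi>' t = 2 * max 0 (w t) * (- 2 * ((t - a - R) / R) / R)" for t
  have w: "(w has_real_derivative - 2 * ((t - a - R) / R) / R) (at t)" for t
    unfolding w_def using R by (auto intro!: derivative_eq_intros simp: field_simps power2_eq_square)
  have d: "(\<phi> has_real_derivative \<phi>' t) (at t)" for t
    unfolding \<phi>_def \<phi>'_def using DERIV_chain2[OF DERIV_max_0_square w] .
  have cw: "continuous_on UNIV w" unfolding w_def using R by (intro continuous_intros) simp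
  have c\<phi>': "continuous_on UNIV \<phi>'" unfolding \<phi>'_def by (intro continuous_intros cw) (use R in simp_all)
  have c\<phi>: "continuous_on UNIV \<phi>" unfolding \<phi>_def by (intro continuous_intros cw)
  have wout: "w t \<le> 0" if "t \<notin> {a<..<a+2*R}" for t
  proof -
    have "\<bar>(t - a - R) / R\<bar> \<ge> 1" using that R by (auto simp: abs_if field_simps)
    hence "1\<^sup>2 \<le> ((t - a - R) / R)\<^sup>2" by (metis abs_le_square_iff abs_one)
    thus ?thesis by (simp add: w_def)
  qed
  have wle: "w t \<le> 1" for t by (simp add: w_def)
  have out: "\<phi> t = 0" "\<phi>' t = 0" if "t \<notin> {a<..<a+2*R}" for t
    using wout[OF that] by (simp_all add: \<phi>_def \<phi>'_def max_def)
  have b1: "\<bar>\<phi> t\<bar> \<le> indicator {a..a+2*R} t" for t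
  proof (cases "t \<in> {a<..<a+2*R}")
    case True
    have "(max 0 (w t))\<^sup>2 \<le> 1\<^sup>2" using wle[of t] by (intro power_mono) auto
    thus ?thesis using True by (simp add: \<phi>_def)
  qed (simp add: out)
  have b2: "\<bar>\<phi>' t\<bar> \<le> (4 / R) * indicator {a..a+2*R} t" for t
  proof (cases "t \<in> {a<..<a+2*R}")
    case True
    have "\<bar>2 * max 0 c * (- 2 * \<tau> / R)\<bar> = 2 * max 0 c * (2 * \<bar>\<tau>\<bar> / R)" for c \<tau> :: real
      using R by (simp add: abs_mult)
    hence "\<bar>\<phi>' t\<bar> = 2 * max 0 (w t) * (2 * \<bar>(t - a - R) / R\<bar> / R)"
      unfolding \<phi>'_def .
    also have "\<dots> \<le> 2 * 1 * (2 * 1 / R)"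
    proof (intro mult_mono divide_right_mono)
      show "\<bar>(t - a - R) / R\<bar> \<le> 1" using True R by (auto simp: abs_if field_simps)
    qed (use wle[of t] R in auto)
    finally show ?thesis using True by simp
  qed (use R in \<open>simp add: out\<close>)
  have low: "\<phi> t \<ge> 1/2" if "t \<in> {a+R/2..a+3*R/2}" for t
  proof -
    have "\<bar>(t - a - R) / R\<bar> \<le> 1/2" using that R by (auto simp: abs_if field_simps)
    hence "((t - a - R) / R)\<^sup>2 \<le> (1/2)\<^sup>2" by (subst abs_le_square_iff[symmetric]) simp
    hence "w t \<ge> 3/4" by (simp add: w_def power2_eq_square)
    hence "(3/4)\<^sup>2 \<le> (max 0 (w t))\<^sup>2" by (intro power_mono) auto
    thus ?thesis by (simp add: \<phi>_def power2_eq_square)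
  qed
  show ?thesis
    using has_ac_derivative_continuous_derivative[OF d c\<phi>'] c\<phi> c\<phi>' out(1) b1 b2 low by blast
qed

lemma integral_le_indicator:
  fixes f :: "real \<Rightarrow> real"
  assumes "integrable lborel f" "\<And>t. f t \<le> c * indicator {a..b} t" "a \<le> b"
  shows "integral\<^sup>L lborel f \<le> c * (b - a)"
proof -
  have i: "integrable lborel (\<lambda>t. c * indicator {a..b} t :: real)"
    by (intro integrable_mult_right integrable_real_indicator) (auto simp: emeasure_lborel_Icc_eq)
  have "integral\<^sup>L lborel f \<le> (\<integral>t. c * indicator {a..b} t \<partial>lborel)" by (rule integral_mono[OF assms(1) i assms(2)])
  also have "\<dots> = c * (b - a)" using assms(3) by simp
  finally show ?thesis .
qed

text \<open>Before normalization the squared norm of the bump is at least R/4, from the middle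
  interval of length R, and that of its derivative at most (16/R^2) 2R = 32/R; the quotient is
  128/R^2.\<close>

lemma ex_W12_bump:
  fixes x :: "'h::{chilbert_space, second_countable_topology}"
  assumes R: "R > 0" and x: "norm x = 1"
  shows "\<exists>u u'. has_W12_derivative u u' \<and> (\<integral>t. (norm (u t))\<^sup>2 \<partial>lborel) = 1 \<and>
    (\<integral>t. (norm (u' t))\<^sup>2 \<partial>lborel) \<le> 128 / R\<^sup>2 \<and> (\<forall>t. \<exists>r. u t = r *\<^sub>R x) \<and>
    (\<forall>t. t \<notin> {a<..<a+2*R} \<longrightarrow> u t = 0)"
proof -
  obtain \<phi> \<phi>' :: "real \<Rightarrow> real" where ac: "has_ac_derivative \<phi> \<phi>'"
    and c: "continuous_on UNIV \<phi>" "continuous_on UNIV \<phi>'"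
    and out: "\<And>t. t \<notin> {a<..<a+2*R} \<Longrightarrow> \<phi> t = 0"
    and b: "\<And>t. \<bar>\<phi> t\<bar> \<le> indicator {a..a+2*R} t" "\<And>t. \<bar>\<phi>' t\<bar> \<le> (4 / R) * indicator {a..a+2*R} t"
    and low: "\<And>t. t \<in> {a+R/2..a+3*R/2} \<Longrightarrow> \<phi> t \<ge> 1/2"
    using ex_bump[OF R, of a] by blast
  have blx: "bounded_linear (\<lambda>r. r *\<^sub>R x)" by (rule bounded_linear_scaleR_left)
  have sq: "sq_integrable (\<lambda>t. \<phi> t *\<^sub>R x)"
  proof (rule sq_integrable_compact_support)
    show "(\<lambda>t. \<phi> t *\<^sub>R x) \<in> borel_measurable lborel"
      using borel_measurable_continuous_onI[OF c(1)] by simp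
    show "norm (\<phi> t *\<^sub>R x) \<le> 1 * indicator {a..a+2*R} t" for t using b(1)[of t] by (simp add: x)
  qed
  have sq': "sq_integrable (\<lambda>t. \<phi>' t *\<^sub>R x)"
  proof (rule sq_integrable_compact_support)
    show "(\<lambda>t. \<phi>' t *\<^sub>R x) \<in> borel_measurable lborel"
      using borel_measurable_continuous_onI[OF c(2)] by simp
    show "norm (\<phi>' t *\<^sub>R x) \<le> (4 / R) * indicator {a..a+2*R} t" for t using b(2)[of t] by (simp add: x)
  qed
  have W: "has_W12_derivative (\<lambda>t. \<phi> t *\<^sub>R x) (\<lambda>t. \<phi>' t *\<^sub>R x)"
    using sq sq' has_ac_derivative_bounded_linear[OF blx ac] by (simp add: has_W12_derivative_def)
  define \<nu> where "\<nu> = (\<integral>t. (norm (\<phi> t *\<^sub>R x))\<^sup>2 \<partial>lborel)"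
  have i: "integrable lborel (\<lambda>t. (norm (\<phi> t *\<^sub>R x))\<^sup>2)" "integrable lborel (\<lambda>t. (norm (\<phi>' t *\<^sub>R x))\<^sup>2)"
    by (intro sq_integrable_norm_sq sq sq')+
  have "R / 4 \<le> \<nu>"
  proof -
    have "- \<nu> \<le> (- (1/4)) * ((a+3*R/2) - (a+R/2))"
      unfolding \<nu>_def integral_minus[symmetric]
    proof (rule integral_le_indicator)
      fix t
      show "- (norm (\<phi> t *\<^sub>R x))\<^sup>2 \<le> - (1/4) * indicator {a+R/2..a+3*R/2} t"
      proof (cases "t \<in> {a+R/2..a+3*R/2}")
        case True
        hence "(1/2)\<^sup>2 \<le> (\<phi> t)\<^sup>2" by (intro power_mono low) auto
        thus ?thesis using True by (simp add: x power2_eq_square)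
      qed simp
    qed (use i R in simp_all)
    thus ?thesis using R by (simp add: field_simps)
  qed
  hence \<nu>: "\<nu> > 0" "R / 4 \<le> \<nu>" using R by auto
  have \<nu>': "(\<integral>t. (norm (\<phi>' t *\<^sub>R x))\<^sup>2 \<partial>lborel) \<le> (16 / R\<^sup>2) * ((a + 2 * R) - a)"
  proof (rule integral_le_indicator)
    fix t
    have "\<bar>\<phi>' t\<bar>\<^sup>2 \<le> ((4 / R) * indicator {a..a+2*R} t)\<^sup>2" by (intro power_mono b) simp
    thus "(norm (\<phi>' t *\<^sub>R x))\<^sup>2 \<le> 16 / R\<^sup>2 * indicator {a..a+2*R} t"
      by (cases "t \<in> {a..a+2*R}") (simp_all add: x power_divide)
  qed (use i R in simp_all)
  define s where "s = 1 / sqrt \<nu>"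
  have s2: "s\<^sup>2 = 1 / \<nu>" using \<nu> by (simp add: s_def power_divide)
  define u where "u t = (s * \<phi> t) *\<^sub>R x" for t
  define u' where "u' t = (s * \<phi>' t) *\<^sub>R x" for t
  have "has_W12_derivative u u'"
    using has_W12_derivative_scaleC[OF W, of "of_real s"] by (simp add: u_def[abs_def] u'_def[abs_def] scaleC_of_real)
  moreover have "(\<integral>t. (norm (u t))\<^sup>2 \<partial>lborel) = 1"
  proof -
    have "(\<integral>t. (norm (u t))\<^sup>2 \<partial>lborel) = (\<integral>t. s\<^sup>2 * (norm (\<phi> t *\<^sub>R x))\<^sup>2 \<partial>lborel)"
      by (simp add: u_def power_mult_distrib x)
    also have "\<dots> = s\<^sup>2 * \<nu>" unfolding \<nu>_def by simp
    finally show ?thesis using \<nu> by (simp add: s2)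
  qed
  moreover have "(\<integral>t. (norm (u' t))\<^sup>2 \<partial>lborel) \<le> 128 / R\<^sup>2"
  proof -
    have "(\<integral>t. (norm (u' t))\<^sup>2 \<partial>lborel) = (\<integral>t. s\<^sup>2 * (norm (\<phi>' t *\<^sub>R x))\<^sup>2 \<partial>lborel)"
      by (simp add: u'_def power_mult_distrib x)
    also have "\<dots> = s\<^sup>2 * (\<integral>t. (norm (\<phi>' t *\<^sub>R x))\<^sup>2 \<partial>lborel)" by simp
    also have "\<dots> \<le> (1 / (R / 4)) * (16 / R\<^sup>2 * ((a + 2 * R) - a))"
      unfolding s2 using \<nu> R by (intro mult_mono \<nu>' divide_left_mono) (auto intro!: integral_nonneg_AE)
    also have "\<dots> = 128 / R\<^sup>2" using R by (simp add: field_simps)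
    finally show ?thesis .
  qed
  moreover have "\<forall>t. \<exists>r. u t = r *\<^sub>R x" by (auto simp: u_def)
  moreover have "\<forall>t. t \<notin> {a<..<a+2*R} \<longrightarrow> u t = 0" using out by (simp add: u_def)
  ultimately show ?thesis by blast
qed

lemma cinner_self: "cinner x x = complex_of_real ((norm (x::'a::complex_inner))\<^sup>2)"
proof (rule complex_eqI)
  show "Re (cinner x x) = Re (complex_of_real ((norm x)\<^sup>2))"
    by (simp add: Re_cinner power2_norm_eq_inner)
  have "Im (cinner x x) = - Im (cinner x x)" by (metis cinner_commute cnj.sel(2))
  thus "Im (cinner x x) = Im (complex_of_real ((norm x)\<^sup>2))" by simp
qed

section \<open>Approximate kernel vectors and failure of the semi-Fredholm properties\<close>

context bounded_operator_family
begin

text \<open>Covers both ends of the line at once. One vector serves a whole interval of prescribed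
  length, so scalar bumps times that vector are approximate kernel vectors.\<close>

definition small_on_long_intervals :: bool where
  "small_on_long_intervals \<longleftrightarrow>
     (\<forall>\<epsilon>>0. \<forall>l. \<exists>a x. norm x = 1 \<and> (\<forall>t\<in>{a..a+l}. norm (A t x) \<le> \<epsilon>))"

lemma singular_sequence:
  assumes small: small_on_long_intervals and e: "\<epsilon> > 0"
  shows "\<exists>x x' :: nat \<Rightarrow> 'h l2. (\<forall>i<N. \<forall>j<N. cinner (x i) (x j) = (if i = j then 1 else 0)) \<and>
    (\<forall>i<N. (x i, x' i) \<in> ddt_op \<and> norm (x' i) \<le> \<epsilon> \<and> norm (mult_op A (x i)) \<le> \<epsilon>)"
proof -
  \<comment> \<open>With this width 128/R^2 = (128/144) \<epsilon>^2, which is below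
    \<epsilon>^2.\<close>
  define R where "R = 12 / \<epsilon>"
  have R: "R > 0" using e by (simp add: R_def)
  obtain a z where z: "norm z = 1" "\<And>t. t \<in> {a..a+2*R*N} \<Longrightarrow> norm (A t z) \<le> \<epsilon>"
    using small e unfolding small_on_long_intervals_def by metis
  \<comment> \<open>Left ends of \<open>N\<close> adjacent windows of length 2R. The bumps vanish
    outside the open windows, which are disjoint, and all windows lie in the interval chosen for
    \<open>z\<close>.\<close>
  define p where "p i = a + 2 * R * real i" for i
  have "\<forall>i. \<exists>u u'. has_W12_derivative u u' \<and> (\<integral>t. (norm (u t))\<^sup>2 \<partial>lborel) = 1 \<and>
    (\<integral>t. (norm (u' t))\<^sup>2 \<partial>lborel) \<le> 128 / R\<^sup>2 \<and> (\<forall>t. \<exists>r. u t = r *\<^sub>R z) \<and>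
    (\<forall>t. t \<notin> {p i<..<p i+2*R} \<longrightarrow> u t = 0)"
    using ex_W12_bump[OF R z(1)] by blast
  then obtain u u' where u: "\<And>i. has_W12_derivative (u i) (u' i)" "\<And>i. (\<integral>t. (norm (u i t))\<^sup>2 \<partial>lborel) = 1"
    "\<And>i. (\<integral>t. (norm (u' i t))\<^sup>2 \<partial>lborel) \<le> 128 / R\<^sup>2" "\<And>i t. \<exists>r. u i t = r *\<^sub>R z"
    "\<And>i t. t \<notin> {p i<..<p i+2*R} \<Longrightarrow> u i t = 0" by metis
  note sq = sq_integrable_W12[OF u(1)]
  have orth: "cinner (abs_l2 (u i)) (abs_l2 (u j)) = (if i = j then 1 else 0)" for i j
  proof (cases "i = j")
    case True
    thus ?thesis using norm_abs_l2[OF sq(1)[of j]] by (simp add: cinner_self u(2))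
  next
    case False
    have "u i t = 0 \<or> u j t = 0" for t
    proof (rule ccontr)
      assume "\<not> ?thesis"
      hence t: "p i < t" "t < p i + 2 * R" "p j < t" "t < p j + 2 * R" using u(5)[of t i] u(5)[of t j] by auto
      have "real i < real j + 1"
      proof -
        have "2 * R * real i < 2 * R * (real j + 1)" using t by (simp add: p_def algebra_simps)
        thus ?thesis using R by simp
      qed
      moreover have "real j < real i + 1"
      proof -
        have "2 * R * real j < 2 * R * (real i + 1)" using t by (simp add: p_def algebra_simps)
        thus ?thesis using R by simp
      qed
      ultimately show False using False by linarith
    qed
    hence "cinner (u i t) (u j t) = 0" for t by (metis cinner_0_left cinner_0_right)
    moreover have "cinner (abs_l2 (u i)) (abs_l2 (u j)) = (\<integral>t. cinner (u i t) (u j t) \<partial>lborel)"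
      by (intro cinner_l2.abs_eq l2rel_refl sq)
    ultimately show ?thesis using False by simp
  qed
  have n1: "norm (abs_l2 (u' i)) \<le> \<epsilon>" for i
  proof (rule power2_le_imp_le)
    have "128 / R\<^sup>2 \<le> \<epsilon>\<^sup>2" using e by (simp add: R_def power_divide)
    thus "(norm (abs_l2 (u' i)))\<^sup>2 \<le> \<epsilon>\<^sup>2" using u(3)[of i] by (simp add: norm_abs_l2 sq)
  qed (use e in simp)
  have n2: "norm (mult_op A (abs_l2 (u i))) \<le> \<epsilon>" if i: "i < N" for i
  proof -
    have "norm (A t (u i t)) \<le> \<epsilon> * norm (u i t)" for t
    proof (cases "t \<in> {p i<..<p i+2*R}")
      case True
      obtain r where r: "u i t = r *\<^sub>R z" using u(4) by blast
      have "2 * R * (real i + 1) \<le> 2 * R * real N" using R i by (intro mult_left_mono) auto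
      hence "p i + 2 * R \<le> a + 2 * R * N" by (simp add: p_def algebra_simps)
      moreover have "a \<le> p i" using R by (simp add: p_def)
      ultimately have "t \<in> {a..a+2*R*N}" using True by auto
      hence "\<bar>r\<bar> * norm (A t z) \<le> \<bar>r\<bar> * \<epsilon>" by (intro mult_left_mono z(2)) auto
      thus ?thesis by (simp add: r blinfun.scaleR_right z(1) mult.commute)
    qed (simp add: u(5) blinfun.zero_right)
    hence "norm (mult_op A (abs_l2 (u i))) \<le> \<epsilon> * norm (abs_l2 (u i))"
      using e by (intro norm_mult_op_le sq) auto
    moreover have "norm (abs_l2 (u i)) = 1"
      by (rule power2_eq_imp_eq) (simp_all add: norm_abs_l2 sq u(2))
    ultimately show ?thesis by simp
  qed
  have "(abs_l2 (u i), abs_l2 (u' i)) \<in> ddt_op" for i unfolding ddt_op_iff using u(1) by blast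
  thus ?thesis using orth n1 n2
    by (intro exI[of _ "\<lambda>i. abs_l2 (u i)"] exI[of _ "\<lambda>i. abs_l2 (u' i)"]) simp
qed

lemma not_semi_Fredholm:
  assumes small: small_on_long_intervals
  shows "\<not> upper_semi_Fredholm (D_op A)" "\<not> lower_semi_Fredholm (D_op A)"
proof -
  note lin = complex_linear_relation_D_op
  \<comment> \<open>Treats the operator and its adjoint together: they act as x' + A x and A x - x',
    both bounded in norm by norm(x') + norm(A x).\<close>
  have far: False
    if c: "c > 0" and V: "finite_dim V"
      and near: "\<And>x x'. (x, x') \<in> ddt_op \<Longrightarrow> \<exists>k\<in>V. norm (x - k) \<le> c * (norm x' + norm (mult_op A x))"
    for c and V :: "'h l2 set"
  proof -
    obtain N :: nat where N: "N > 0" "\<And>f :: nat \<Rightarrow> 'h l2. (\<forall>i<N. \<forall>j<N. cinner (f i) (f j) = (if i = j then 1 else 0)) \<Longrightarrow>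
           (\<exists>i<N. \<forall>k\<in>V. norm (f i - k) \<ge> 1 / N)"
      using finite_dim_orthonormal_far[OF V] by blast
    \<comment> \<open>This makes c (\<epsilon> + \<epsilon>) = 1/(2N), below the distance 1/N that
      some orthonormal vector must keep from \<open>V\<close>.\<close>
    define \<epsilon> where "\<epsilon> = 1 / (4 * c * real N)"
    have e: "\<epsilon> > 0" using c N(1) by (simp add: \<epsilon>_def)
    obtain x x' where x: "\<forall>i<N. \<forall>j<N. cinner (x i) (x j) = (if i = j then 1 else 0)"
      "\<And>i. i < N \<Longrightarrow> (x i, x' i) \<in> ddt_op \<and> norm (x' i) \<le> \<epsilon> \<and> norm (mult_op A (x i)) \<le> \<epsilon>"
      using singular_sequence[OF small e, of N] by blast
    obtain i where i: "i < N" "\<And>k. k \<in> V \<Longrightarrow> norm (x i - k) \<ge> 1 / N" using N(2)[OF x(1)] by blast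
    obtain k where k: "k \<in> V" "norm (x i - k) \<le> c * (norm (x' i) + norm (mult_op A (x i)))"
      using near x(2)[OF i(1)] by blast
    have "1 / real N \<le> c * (norm (x' i) + norm (mult_op A (x i)))" using i(2)[OF k(1)] k(2) by linarith
    also have "\<dots> \<le> c * (\<epsilon> + \<epsilon>)" using x(2)[OF i(1)] c by (intro mult_left_mono add_mono) auto
    also have "\<dots> = (1 / real N) / 2" using c N(1) by (simp add: \<epsilon>_def field_simps)
    finally have le: "1 / real N \<le> (1 / real N) / 2" .
    have "r / 2 < r" if "r > 0" for r :: real using that by simp
    from this[of "1 / real N"] have "(1 / real N) / 2 < 1 / real N" using N(1) by simp
    with leD[OF le] show False by blast
  qed
  show "\<not> upper_semi_Fredholm (D_op A)"
  proof
    assume U: "upper_semi_Fredholm (D_op A)"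
    obtain c where c: "c > 0" "\<And>x y. (x, y) \<in> D_op A \<Longrightarrow> \<exists>k\<in>op_ker (D_op A). norm (x - k) \<le> c * norm y"
      using closed_range_ker_dist(1)[OF lin closed_D_op] U unfolding upper_semi_Fredholm_def by blast
    show False
    proof (rule far[OF c(1)])
      show "finite_dim (op_ker (D_op A))" using U by (simp add: upper_semi_Fredholm_def)
      fix x x' :: "'h l2" assume "(x, x') \<in> ddt_op"
      hence "(x, x' + mult_op A x) \<in> D_op A" by (simp add: D_op_iff)
      from c(2)[OF this] obtain k where k: "k \<in> op_ker (D_op A)" "norm (x - k) \<le> c * norm (x' + mult_op A x)" by blast
      note k(2)
      also have "c * norm (x' + mult_op A x) \<le> c * (norm x' + norm (mult_op A x))"
        using c(1) by (intro mult_left_mono norm_triangle_ineq) simp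
      finally show "\<exists>k\<in>op_ker (D_op A). norm (x - k) \<le> c * (norm x' + norm (mult_op A x))" using k(1) by blast
    qed
  qed
  show "\<not> lower_semi_Fredholm (D_op A)"
  proof
    assume U: "lower_semi_Fredholm (D_op A)"
    obtain c where c: "c > 0" "\<And>y z. (y, z) \<in> op_adjoint (D_op A) \<Longrightarrow> \<exists>k\<in>op_ker (op_adjoint (D_op A)). norm (y - k) \<le> c * norm z"
      using closed_range_ker_dist(2)[OF lin closed_D_op] U unfolding lower_semi_Fredholm_def by blast
    show False
    proof (rule far[OF c(1)])
      show "finite_dim (op_ker (op_adjoint (D_op A)))" using U by (simp add: lower_semi_Fredholm_def)
      fix x x' :: "'h l2" assume "(x, x') \<in> ddt_op"
      hence "(x, mult_op A x - x') \<in> op_adjoint (D_op A)" by (simp add: op_adjoint_D_op)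
      from c(2)[OF this] obtain k where k: "k \<in> op_ker (op_adjoint (D_op A))" "norm (x - k) \<le> c * norm (mult_op A x - x')" by blast
      note k(2)
      also have "c * norm (mult_op A x - x') \<le> c * (norm x' + norm (mult_op A x))"
        using c(1) norm_triangle_ineq4[of "mult_op A x" x'] by (intro mult_left_mono) auto
      finally show "\<exists>k\<in>op_ker (op_adjoint (D_op A)). norm (x - k) \<le> c * (norm x' + norm (mult_op A x))" using k(1) by blast
    qed
  qed
qed

lemma small_on_long_intervals_top:
  assumes lim: "(A \<longlongrightarrow> L) at_top" and L: "selfadjoint_op L" "0 \<in> spectrum L"
  shows small_on_long_intervals
  unfolding small_on_long_intervals_def
proof (intro allI impI)
  fix \<epsilon> l :: real assume e: "\<epsilon> > 0"
  obtain x where x: "norm x = 1" "norm (L x) < \<epsilon> / 2" using approx_kernel_if_spectrum[OF L, of "\<epsilon>/2"] e by auto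
  have "\<forall>\<^sub>F t in at_top. dist (A t) L < \<epsilon> / 2" by (rule tendstoD[OF lim]) (use e in simp)
  then obtain T where T: "\<And>t. t \<ge> T \<Longrightarrow> dist (A t) L < \<epsilon> / 2" by (auto simp: eventually_at_top_linorder)
  have "norm (A t x) \<le> \<epsilon>" if "t \<ge> T" for t
    using norm_blinfun[of "A t - L" x] norm_triangle_ineq[of "(A t - L) x" "L x"] x T[OF that]
    by (simp add: blinfun.diff_left dist_norm)
  thus "\<exists>a x. norm x = 1 \<and> (\<forall>t\<in>{a..a+l}. norm (A t x) \<le> \<epsilon>)"
    using x(1) by (intro exI[of _ T] exI[of _ x]) simp
qed

lemma small_on_long_intervals_bot:
  assumes lim: "(A \<longlongrightarrow> L) at_bot" and L: "selfadjoint_op L" "0 \<in> spectrum L"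
  shows small_on_long_intervals
  unfolding small_on_long_intervals_def
proof (intro allI impI)
  fix \<epsilon> l :: real assume e: "\<epsilon> > 0"
  obtain x where x: "norm x = 1" "norm (L x) < \<epsilon> / 2" using approx_kernel_if_spectrum[OF L, of "\<epsilon>/2"] e by auto
  have "\<forall>\<^sub>F t in at_bot. dist (A t) L < \<epsilon> / 2" by (rule tendstoD[OF lim]) (use e in simp)
  then obtain T where T: "\<And>t. t \<le> T \<Longrightarrow> dist (A t) L < \<epsilon> / 2" by (auto simp: eventually_at_bot_linorder)
  have "norm (A t x) \<le> \<epsilon>" if "t \<le> T" for t
    using norm_blinfun[of "A t - L" x] norm_triangle_ineq[of "(A t - L) x" "L x"] x T[OF that]
    by (simp add: blinfun.diff_left dist_norm)
  thus "\<exists>a x. norm x = 1 \<and> (\<forall>t\<in>{a..a+l}. norm (A t x) \<le> \<epsilon>)"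
    using x(1) by (intro exI[of _ "T - l"] exI[of _ x]) simp
qed

end

section \<open>Trace class perturbations\<close>

text \<open>In the gauge integral, tags in the exceptional set \<open>N\<close> are controlled by Henstock's lemma for
  the derivative \<open>k\<close> from the definition of absolute continuity, set to zero on \<open>N\<close>.\<close>

lemma has_integral_ac_derivative:
  fixes F :: "real \<Rightarrow> real"
  assumes ac: "has_ac_derivative F k" and N: "negligible N"
    and d: "\<And>t. t \<notin> N \<Longrightarrow> (F has_real_derivative f t) (at t)" and f0: "\<And>t. t \<in> N \<Longrightarrow> f t = 0"
    and ab: "a \<le> b"
  shows "(f has_integral (F b - F a)) {a..b}"
  unfolding has_integral_real
proof (intro allI impI)
  fix e :: real assume e: "e > 0"
  define k1 where "k1 t = (if t \<in> N then 0 else k t)" for t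
  have k1: "k1 integrable_on {u..v} \<and> integral {u..v} k1 = F v - F u" if "u \<le> v" for u v
  proof -
    have si: "set_integrable lborel {u..v} k"
      by (rule locally_integrableD[OF has_ac_derivative_locally_integrable[OF ac]])
    have "(k has_integral (F v - F u)) {u..v}"
      using set_borel_integral_eq_integral[OF si] has_ac_derivative_diff[OF ac that]
      by (metis integrable_integral)
    hence "(k1 has_integral (F v - F u)) {u..v}"
      by (rule has_integral_spike[OF N, rotated]) (simp add: k1_def)
    thus ?thesis by (auto simp: has_integral_iff)
  qed
  obtain \<gamma>1 where \<gamma>1: "gauge \<gamma>1" "\<And>p. p tagged_partial_division_of {a..b} \<Longrightarrow> \<gamma>1 fine p \<Longrightarrow>
      sum (\<lambda>(x,K). norm (measure lborel K *\<^sub>R k1 x - integral K k1)) p < e / 2"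
    using Henstock_lemma[of k1 a b "e/2"] k1[OF ab] e by auto
  define \<epsilon> where "\<epsilon> = e / (2 * (b - a + 1))"
  have eps: "\<epsilon> > 0" using e ab by (simp add: \<epsilon>_def)
  have "\<exists>r>0. \<forall>y. \<bar>y - t\<bar> < r \<longrightarrow> \<bar>F y - F t - f t * (y - t)\<bar> \<le> \<epsilon> * \<bar>y - t\<bar>" if "t \<notin> N" for t
  proof -
    have "(F has_derivative (\<lambda>h. f t * h)) (at t)"
      using d[OF that] by (simp add: has_field_derivative_def)
    then obtain r where "r > 0" "\<And>y. norm (y - t) < r \<Longrightarrow> norm (F y - F t - f t * (y - t)) \<le> \<epsilon> * norm (y - t)"
      using eps unfolding has_derivative_at_alt by meson
    thus ?thesis by auto
  qed
  then obtain r where r: "\<And>t. t \<notin> N \<Longrightarrow> r t > 0"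
    "\<And>t y. t \<notin> N \<Longrightarrow> \<bar>y - t\<bar> < r t \<Longrightarrow> \<bar>F y - F t - f t * (y - t)\<bar> \<le> \<epsilon> * \<bar>y - t\<bar>" by metis
  define \<gamma> where "\<gamma> t = \<gamma>1 t \<inter> ball t (if t \<in> N then 1 else r t)" for t
  have \<gamma>: "gauge \<gamma>"
    unfolding \<gamma>_def by (intro gauge_Int \<gamma>1(1) gauge_ball_dependent) (use r(1) in auto)
  have "norm (sum (\<lambda>(x,K). measure lborel K *\<^sub>R f x) p - (F b - F a)) < e"
    if p: "p tagged_division_of {a..b}" "\<gamma> fine p" for p
  proof -
    have fine1: "\<gamma>1 fine p" using p(2) unfolding fine_def \<gamma>_def by blast
    have part: "p tagged_partial_division_of {a..b}" using p(1) by (simp add: tagged_division_of_def)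
    \<comment> \<open>For a tag outside \<open>N\<close> this is the straddle estimate: the tag lies
      in the interval, so the errors at its two ends add up to \<epsilon> times its length. For a
      tag in \<open>N\<close> both \<open>f\<close> and \<open>k1\<close> vanish there, and the
      error is exactly the Henstock term.\<close>
    have tag: "norm (measure lborel K *\<^sub>R f x - (F (Sup K) - F (Inf K)))
        \<le> \<epsilon> * measure lborel K + norm (measure lborel K *\<^sub>R k1 x - integral K k1)" if xK: "(x, K) \<in> p" for x K
    proof -
      obtain u v where K: "K = {u..v}" "x \<in> K"
        using tagged_division_ofD(2,4)[OF p(1) xK] by auto
      hence uv: "u \<le> x" "x \<le> v" by auto
      have sub: "K \<subseteq> \<gamma> x" using p(2) xK unfolding fine_def by blast
      show ?thesis
      proof (cases "x \<in> N")
        case True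
        have "integral K k1 = F v - F u" using k1[of u v] uv K(1) by simp
        thus ?thesis using True uv eps by (simp add: f0 k1_def K(1))
      next
        case False
        have "{u..v} \<subseteq> ball x (r x)" using sub K False by (simp add: \<gamma>_def)
        from subsetD[OF this, of u] subsetD[OF this, of v]
        have "u \<in> ball x (r x)" "v \<in> ball x (r x)" using uv by simp_all
        hence "\<bar>u - x\<bar> < r x" "\<bar>v - x\<bar> < r x" by (auto simp: dist_real_def abs_minus_commute)
        from r(2)[OF False this(1)] r(2)[OF False this(2)]
        have "\<bar>F u - F x - f x * (u - x)\<bar> \<le> \<epsilon> * (x - u)" "\<bar>F v - F x - f x * (v - x)\<bar> \<le> \<epsilon> * (v - x)"
          using uv by simp_all
        moreover have "measure lborel K *\<^sub>R f x - (F (Sup K) - F (Inf K))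
            = (F u - F x - f x * (u - x)) - (F v - F x - f x * (v - x))"
          using uv by (simp add: K(1) algebra_simps)
        moreover have "\<epsilon> * measure lborel K = \<epsilon> * (x - u) + \<epsilon> * (v - x)" using uv by (simp add: K(1) algebra_simps)
        moreover have "0 \<le> norm (measure lborel K *\<^sub>R k1 x - integral K k1)" by simp
        ultimately show ?thesis unfolding real_norm_def by linarith
      qed
    qed
    have "sum (\<lambda>(x,K). measure lborel K *\<^sub>R f x) p - (F b - F a)
        = sum (\<lambda>(x,K). measure lborel K *\<^sub>R f x - (F (Sup K) - F (Inf K))) p"
      unfolding additive_tagged_division_1[OF ab p(1), of F, symmetric]
      by (simp add: sum_subtractf[symmetric] split_beta)
    also have "norm \<dots> \<le> sum (\<lambda>(x,K). \<epsilon> * measure lborel K + norm (measure lborel K *\<^sub>R k1 x - integral K k1)) p"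
      by (rule sum_norm_le) (use tag in auto)
    also have "\<dots> = \<epsilon> * sum (\<lambda>(x,K). measure lborel K) p + sum (\<lambda>(x,K). norm (measure lborel K *\<^sub>R k1 x - integral K k1)) p"
      by (simp add: sum.distrib sum_distrib_left split_beta)
    also have "sum (\<lambda>(x,K). measure lborel K) p = b - a"
      using additive_content_tagged_division[of p a b] p(1) ab by simp
    also have "\<epsilon> * (b - a) \<le> e / 2"
    proof -
      have "(b - a) / (b - a + 1) \<le> 1" using ab by simp
      hence "e / 2 * ((b - a) / (b - a + 1)) \<le> e / 2 * 1" using e by (intro mult_left_mono) auto
      thus ?thesis using ab by (simp add: \<epsilon>_def)
    qed
    finally show ?thesis using \<gamma>1(2)[OF part fine1] by simp
  qed
  thus "\<exists>\<gamma>. gauge \<gamma> \<and> (\<forall>p. p tagged_division_of {a..b} \<and> \<gamma> fine p \<longrightarrow>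
      norm (sum (\<lambda>(x,K). measure lborel K *\<^sub>R f x) p - (F b - F a)) < e)" using \<gamma> by blast
qed

section \<open>Limits of operators and increments of the perturbation\<close>

lemma selfadjoint_op_limit:
  assumes lim: "(T \<longlongrightarrow> L) F" "F \<noteq> bot" and sa: "\<And>i. selfadjoint_op (T i)"
  shows "selfadjoint_op (L :: 'a::complex_inner \<Rightarrow>\<^sub>L 'a)"
  unfolding selfadjoint_op_def clinear_op_def
proof (intro conjI allI)
  have pt: "((\<lambda>i. T i x) \<longlongrightarrow> L x) F" for x by (intro tendsto_intros lim(1))
  show "L (c *\<^sub>C x) = c *\<^sub>C L x" for c x
  proof (rule tendsto_unique[OF lim(2) pt])
    have "T i (c *\<^sub>C x) = c *\<^sub>C T i x" for i using sa[of i] by (simp add: selfadjoint_op_def clinear_op_def)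
    thus "((\<lambda>i. T i (c *\<^sub>C x)) \<longlongrightarrow> c *\<^sub>C L x) F"
      using bounded_linear.tendsto[OF bounded_linear_scaleC pt] by simp
  qed
  show "cinner x (L y) = cinner (L x) y" for x y
  proof (rule tendsto_unique[OF lim(2)])
    show "((\<lambda>i. cinner x (T i y)) \<longlongrightarrow> cinner x (L y)) F" by (intro tendsto_cinner tendsto_const pt)
    have "cinner x (T i y) = cinner (T i x) y" for i using sa[of i] by (simp add: selfadjoint_op_def)
    thus "((\<lambda>i. cinner x (T i y)) \<longlongrightarrow> cinner (L x) y) F" by (simp add: tendsto_cinner[OF pt tendsto_const])
  qed
qed

lemma selfadjoint_op_add: "selfadjoint_op S \<Longrightarrow> selfadjoint_op T \<Longrightarrow> selfadjoint_op (S + T)"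
  by (simp add: selfadjoint_op_def clinear_op_def blinfun.add_left cinner_add_left cinner_add_right scaleC_add_right)

lemma norm_blinfun_le_if_inner:
  fixes T :: "'a::real_inner \<Rightarrow>\<^sub>L 'a"
  assumes c: "c \<ge> 0" and T: "\<And>g h. \<bar>inner g (T h)\<bar> \<le> norm g * norm h * c"
  shows "norm T \<le> c"
proof (rule norm_blinfun_bound[OF c])
  fix h
  show "norm (T h) \<le> c * norm h"
  proof (cases "T h = 0")
    case False
    have "norm (T h) * norm (T h) \<le> norm (T h) * (norm h * c)"
      using T[of "T h" h] by (simp add: power2_norm_eq_inner[symmetric] power2_eq_square mult.assoc)
    thus ?thesis using False by (simp add: mult.commute)
  qed (use c in simp)
qed

lemma convergent_at_top_if_tails:
  fixes A :: "real \<Rightarrow> 'b::banach"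
  assumes tail: "\<And>e. e > 0 \<Longrightarrow> \<exists>T. \<forall>s t. T \<le> s \<longrightarrow> s \<le> t \<longrightarrow> norm (A t - A s) \<le> e"
  shows "\<exists>L. (A \<longlongrightarrow> L) at_top"
proof -
  have "Cauchy (\<lambda>n. A (real n))"
  proof (rule metric_CauchyI)
    fix e :: real assume "e > 0"
    then obtain T where T: "\<And>s t. T \<le> s \<Longrightarrow> s \<le> t \<Longrightarrow> norm (A t - A s) \<le> e / 2" using tail[of "e/2"] by auto
    obtain M :: nat where M: "T \<le> real M" using real_arch_simple by blast
    have "dist (A (real m)) (A (real n)) < e" if "m \<ge> M" "n \<ge> M" for m n
    proof (cases "m \<le> n")
      case True
      have "T \<le> real m" using M that(1) by linarith
      thus ?thesis using T[of "real m" "real n"] True \<open>e > 0\<close> by (simp add: dist_norm norm_minus_commute)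
    next
      case False
      have "T \<le> real n" using M that(2) by linarith
      thus ?thesis using T[of "real n" "real m"] False \<open>e > 0\<close> by (simp add: dist_norm)
    qed
    thus "\<exists>M. \<forall>m\<ge>M. \<forall>n\<ge>M. dist (A (real m)) (A (real n)) < e" by blast
  qed
  then obtain L where L: "(\<lambda>n. A (real n)) \<longlonglongrightarrow> L" using Cauchy_convergent_iff convergent_def by blast
  have "(A \<longlongrightarrow> L) at_top"
  proof (rule tendstoI)
    fix e :: real assume "e > 0"
    then obtain T where T: "\<And>s t. T \<le> s \<Longrightarrow> s \<le> t \<Longrightarrow> norm (A t - A s) \<le> e / 3" using tail[of "e/3"] by auto
    have "\<forall>\<^sub>F n in sequentially. dist (A (real n)) L < e / 3" by (rule tendstoD[OF L]) (use \<open>e > 0\<close> in simp)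
    then obtain M where M: "\<And>n. n \<ge> M \<Longrightarrow> dist (A (real n)) L < e / 3" by (auto simp: eventually_sequentially)
    obtain n :: nat where n: "max T (real M) \<le> real n" using real_arch_simple by blast
    have "dist (A t) L < e" if "t \<ge> real n" for t
    proof -
      have "dist (A t) (A (real n)) \<le> e / 3" using T[of "real n" t] n that by (simp add: dist_norm)
      moreover have "dist (A (real n)) L < e / 3" using M[of n] n by simp
      moreover have "dist (A t) L \<le> dist (A t) (A (real n)) + dist (A (real n)) L" by (rule dist_triangle)
      ultimately show ?thesis using \<open>e > 0\<close> by linarith
    qed
    thus "\<forall>\<^sub>F t in at_top. dist (A t) L < e" unfolding eventually_at_top_linorder by blast
  qed
  thus ?thesis by blast
qed

locale trace_class_perturbation =
  fixes A_minus :: "'h::{chilbert_space, second_countable_topology} \<Rightarrow>\<^sub>L 'h" and B B' :: "real \<Rightarrow> 'h \<Rightarrow>\<^sub>L 'h"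
  assumes sa_minus: "selfadjoint_op A_minus" and sa_B: "\<And>t. selfadjoint_op (B t)"
    and wac: "weakly_locally_abs_cont B"
    and deriv: "AE t in lebesgue. \<forall>g h.
           ((\<lambda>s. cinner g (B s h)) has_vector_derivative cinner g (B' t h)) (at t)"
    and tc: "\<And>t. trace_class (B' t)"
    and int: "integrable lebesgue (\<lambda>t. trace_norm (B' t))"
    and tcB: "\<forall>\<^sub>F t in at_bot. trace_class (B t)"
    and limB: "((\<lambda>t. trace_norm (B t)) \<longlongrightarrow> 0) at_bot"
begin

text \<open>Integrability in the completed measure is replaced by a Borel function that agrees
  almost everywhere. One null set collects all exceptional points for every \<open>g\<close> and
  \<open>h\<close>; the absolute value makes the bound nonnegative on that set as well.\<close>

lemma ex_dominating:
  "\<exists>\<tau> N. integrable lborel \<tau> \<and> (\<forall>t. \<tau> t \<ge> 0) \<and> negligible N \<and> (\<forall>t. t \<notin> N \<longrightarrow> norm (B' t) \<le> \<tau> t) \<and>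
    (\<forall>t g h. t \<notin> N \<longrightarrow> ((\<lambda>s. inner g (B s h)) has_real_derivative inner g (B' t h)) (at t))"
proof -
  obtain \<tau> where \<tau>: "\<tau> \<in> borel_measurable lborel" "AE t in lborel. trace_norm (B' t) = \<tau> t"
    using completion_ex_borel_measurable_real[OF borel_measurable_integrable[OF int]] by blast
  have ae: "AE t in lebesgue. trace_norm (B' t) = \<tau> t" by (rule AE_completion[OF \<tau>(2)])
  have \<tau>m: "\<tau> \<in> borel_measurable lebesgue" using \<tau>(1) by (rule measurable_completion)
  have "integrable lebesgue \<tau>"
    using int integrable_cong_AE[OF borel_measurable_integrable[OF int] \<tau>m ae] by simp
  hence i\<tau>: "integrable lborel \<tau>" using integrable_completion[OF \<tau>(1)] by simp
  have "AE t in lebesgue. trace_norm (B' t) = \<tau> t \<and> (\<forall>g h.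
           ((\<lambda>s. cinner g (B s h)) has_vector_derivative cinner g (B' t h)) (at t))"
    using ae deriv by eventually_elim simp
  then obtain N where N: "{t \<in> space lebesgue. \<not> (trace_norm (B' t) = \<tau> t \<and> (\<forall>g h.
           ((\<lambda>s. cinner g (B s h)) has_vector_derivative cinner g (B' t h)) (at t)))} \<subseteq> N"
      "emeasure lebesgue N = 0" "N \<in> sets lebesgue"
    by (rule AE_E)
  have neg: "negligible N" using N(2,3) by (simp add: negligible_iff_null_sets null_sets_def)
  have good: "trace_norm (B' t) = \<tau> t"
      "((\<lambda>s. cinner g (B s h)) has_vector_derivative cinner g (B' t h)) (at t)" if "t \<notin> N" for t g h
    using N(1) that by auto
  have "norm (B' t) \<le> \<bar>\<tau> t\<bar>" if "t \<notin> N" for t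
    using norm_le_trace_norm[OF tc[of t]] good(1)[OF that] by linarith
  moreover have "((\<lambda>s. inner g (B s h)) has_real_derivative inner g (B' t h)) (at t)" if "t \<notin> N" for t g h
    using bounded_linear.has_vector_derivative[OF bounded_linear_Re good(2)[OF that]]
    by (simp add: Re_cinner has_real_derivative_iff_has_vector_derivative)
  ultimately show ?thesis using i\<tau> neg
    by (intro exI[of _ "\<lambda>t. \<bar>\<tau> t\<bar>"] exI[of _ N]) auto
qed

text \<open>The integral of \<tau> bounds the norm of every increment of \<open>B\<close>. This
  yields norm continuity, boundedness and the limit at infinity; the same scalar integrals show that
  the increments are compact.\<close>

lemma asymptotic:
  defines "A \<equiv> \<lambda>t. A_minus + B t"
  shows "\<exists>K. asymptotic_family A K A_minus (Lim at_top A)"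
proof -
  obtain \<tau> N where \<tau>: "integrable lborel \<tau>" "\<And>t. \<tau> t \<ge> 0" and N: "negligible N"
    and dom: "\<And>t. t \<notin> N \<Longrightarrow> norm (B' t) \<le> \<tau> t"
    and d: "\<And>t g h. t \<notin> N \<Longrightarrow> ((\<lambda>s. inner g (B s h)) has_real_derivative inner g (B' t h)) (at t)"
    using ex_dominating by blast
  \<comment> \<open>Setting the integrand to 0 on the null set makes the domination by \<tau> valid
    at every point, as the gauge integral theorems ask.\<close>
  define f where "f g h t = (if t \<in> N then 0 else inner g (B' t h))" for g h t
  have hi: "(f g h has_integral inner g ((B b - B a) h)) {a..b}" if ab: "a \<le> b" for a b g h
  proof -
    obtain k where k: "has_ac_derivative (\<lambda>t. cinner g (B t h)) k"
      using wac unfolding weakly_locally_abs_cont_def locally_abs_cont_def by blast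
    have ac: "has_ac_derivative (\<lambda>t. inner g (B t h)) (\<lambda>t. Re (k t))"
      using has_ac_derivative_bounded_linear[OF bounded_linear_Re k] by (simp add: Re_cinner)
    have "(f g h has_integral (inner g (B b h) - inner g (B a h))) {a..b}"
      by (rule has_integral_ac_derivative[OF ac N _ _ ab]) (use d in \<open>simp_all add: f_def\<close>)
    thus ?thesis by (simp add: blinfun.diff_left inner_diff_right)
  qed
  have fle: "norm (f g h t) \<le> norm g * norm h * \<tau> t" for g h t
  proof (cases "t \<in> N")
    case False
    have "\<bar>inner g (B' t h)\<bar> \<le> norm g * norm (B' t h)" by (rule Cauchy_Schwarz_ineq2)
    also have "\<dots> \<le> norm g * (\<tau> t * norm h)"
      using norm_blinfun[of "B' t" h] mult_right_mono[OF dom[OF False] norm_ge_zero[of h]]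
      by (intro mult_left_mono) auto
    finally show ?thesis using False by (simp add: f_def mult_ac)
  qed (simp add: f_def \<tau>)
  note l\<tau> = integrable_locally_integrable[OF \<tau>(1)]
  have \<tau>hk: "\<tau> integrable_on {a..b}" "(LBINT t:{a..b}. \<tau> t) = integral {a..b} \<tau>" for a b
    using set_borel_integral_eq_integral[OF locally_integrableD[OF l\<tau>]] by auto
  have \<tau>nn: "0 \<le> (LBINT t:{a..b}. \<tau> t)" for a b
    unfolding set_lebesgue_integral_def by (intro integral_nonneg_AE AE_I2) (simp add: \<tau>)
  have incr: "norm (B b - B a) \<le> (LBINT t:{a..b}. \<tau> t)" if ab: "a \<le> b" for a b
  proof (rule norm_blinfun_le_if_inner[OF \<tau>nn])
    fix g h
    have "norm (integral {a..b} (f g h)) \<le> integral {a..b} (\<lambda>t. norm g * norm h * \<tau> t)"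
    proof (rule Henstock_Kurzweil_Integration.integral_norm_bound_integral)
      show "f g h integrable_on {a..b}" using hi[OF ab] by blast
      show "(\<lambda>t. norm g * norm h * \<tau> t) integrable_on {a..b}" by (intro integrable_on_mult_right \<tau>hk)
    qed (rule fle)
    thus "\<bar>inner g ((B b - B a) h)\<bar> \<le> norm g * norm h * (LBINT t:{a..b}. \<tau> t)"
      using integral_unique[OF hi[OF ab]] by (simp add: \<tau>hk(2))
  qed
  have ccincr: "completely_continuous (B b - B a)" if ab: "a \<le> b" for a b
    unfolding completely_continuous_def
  proof (intro allI impI)
    fix u :: "nat \<Rightarrow> 'h" assume u: "weakly_null u"
    then obtain M where M: "\<And>n. norm (u n) \<le> M" by (auto simp: weakly_null_def)
    \<comment> \<open>Norm convergence is tested with unit vectors that move with n, which dominated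
      convergence permits. If the image is 0, division by 0 makes \<open>g n\<close> equal to 0 and
      the identity below persists.\<close>
    define g where "g n = (1 / norm ((B b - B a) (u n))) *\<^sub>R ((B b - B a) (u n))" for n
    have g1: "norm (g n) \<le> 1" for n by (simp add: g_def)
    have gn: "inner (g n) ((B b - B a) (u n)) = norm ((B b - B a) (u n))" for n
      by (simp add: g_def power2_norm_eq_inner[symmetric] power2_eq_square)
    have "(\<lambda>n. integral {a..b} (f (g n) (u n))) \<longlonglongrightarrow> integral {a..b} (\<lambda>_. 0 :: real)"
    proof (rule dominated_convergence(2))
      show "f (g n) (u n) integrable_on {a..b}" for n using hi[OF ab] by blast
      show "(\<lambda>t. M * \<tau> t) integrable_on {a..b}" by (intro integrable_on_mult_right \<tau>hk)
      show "norm (f (g n) (u n) t) \<le> M * \<tau> t" for n t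
      proof -
        have "norm (g n) * norm (u n) \<le> 1 * M" by (intro mult_mono g1 M) auto
        hence "norm (g n) * norm (u n) * \<tau> t \<le> M * \<tau> t" by (intro mult_right_mono \<tau>) simp
        thus ?thesis using fle[of "g n" "u n" t] by linarith
      qed
      show "(\<lambda>n. f (g n) (u n) t) \<longlonglongrightarrow> 0" for t
      proof (cases "t \<in> N")
        case False
        have "(\<lambda>n. B' t (u n)) \<longlonglongrightarrow> 0"
          using trace_class_completely_continuous[OF tc[of t]] u by (simp add: completely_continuous_def)
        hence lim: "(\<lambda>n. norm (B' t (u n))) \<longlonglongrightarrow> 0" by (rule tendsto_norm_zero)
        have "norm (f (g n) (u n) t) \<le> norm (B' t (u n))" for n
        proof -
          have "\<bar>inner (g n) (B' t (u n))\<bar> \<le> norm (g n) * norm (B' t (u n))" by (rule Cauchy_Schwarz_ineq2)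
          also have "\<dots> \<le> 1 * norm (B' t (u n))" by (intro mult_right_mono g1) simp
          finally show ?thesis using False by (simp add: f_def)
        qed
        hence "\<forall>\<^sub>F n in sequentially. norm (f (g n) (u n) t) \<le> norm (B' t (u n))"
          by (intro always_eventually allI)
        thus ?thesis by (rule Lim_null_comparison[OF _ lim])
      qed (simp add: f_def)
    qed
    hence "(\<lambda>n. norm ((B b - B a) (u n))) \<longlonglongrightarrow> 0"
      using integral_unique[OF hi[OF ab]] by (simp add: gn)
    thus "(\<lambda>n. (B b - B a) (u n)) \<longlonglongrightarrow> 0" by (rule tendsto_norm_zero_cancel)
  qed
  \<comment> \<open>Near minus infinity \<open>B\<close> is trace class and hence compact; a compact
    increment leads from there to \<open>t\<close>. The minimum with T also covers t <= T, where the
    increment is 0.\<close>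
  have ccB: "completely_continuous (B t)" for t
  proof -
    obtain T where T: "\<And>s. s \<le> T \<Longrightarrow> trace_class (B s)" using tcB by (auto simp: eventually_at_bot_linorder)
    have "completely_continuous (B t - B (min t T) - (- B (min t T)))"
      by (intro completely_continuous_diff completely_continuous_uminus ccincr
          trace_class_completely_continuous T) auto
    thus ?thesis by simp
  qed
  have Bbot: "(B \<longlongrightarrow> 0) at_bot"
    by (rule Lim_null_comparison[OF _ limB]) (rule eventually_mono[OF tcB norm_le_trace_norm])
  have Adiff: "A t - A s = B t - B s" for s t by (simp add: A_def)
  have bot: "(A \<longlongrightarrow> A_minus) at_bot"
    using tendsto_add[OF tendsto_const[of A_minus] Bbot] by (simp add: A_def)
  have cont: "continuous_on UNIV A"
  proof -
    define M where "M = (\<lambda>t. 0 + (LBINT s=ereal 0..ereal t. \<tau> s))"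
    have acM: "has_ac_derivative M \<tau>" unfolding M_def by (rule has_ac_derivative_primitive[OF l\<tau>])
    have le: "norm (A t - A s) \<le> \<bar>M t - M s\<bar>" for s t
    proof (cases "s \<le> t")
      case True
      thus ?thesis using incr[OF True] has_ac_derivative_diff[OF acM True] by (simp add: Adiff)
    next
      case False
      hence ts: "t \<le> s" by simp
      show ?thesis using incr[OF ts] has_ac_derivative_diff[OF acM ts] by (simp add: Adiff norm_minus_commute)
    qed
    have cM: "continuous_on UNIV M" by (rule has_ac_derivative_continuous[OF acM])
    show ?thesis
      unfolding continuous_on_def
    proof
      fix r :: real
      have "(M \<longlongrightarrow> M r) (at r)" using cM by (simp add: continuous_on_def)
      hence "((\<lambda>t. M t - M r) \<longlongrightarrow> 0) (at r)" by (rule LIM_zero)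
      hence lim: "((\<lambda>t. \<bar>M t - M r\<bar>) \<longlongrightarrow> 0) (at r)" by (rule tendsto_rabs_zero)
      have "((\<lambda>t. A t - A r) \<longlongrightarrow> 0) (at r)"
        by (rule Lim_null_comparison[OF always_eventually[OF allI[OF le]] lim])
      thus "(A \<longlongrightarrow> A r) (at r within UNIV)" by (rule LIM_zero_cancel)
    qed
  qed
  have "\<exists>L. (A \<longlongrightarrow> L) at_top"
  proof (rule convergent_at_top_if_tails)
    fix e :: real assume e: "e > 0"
    have "(\<lambda>n. LBINT t:{real n..}. \<tau> t) \<longlonglongrightarrow> (LBINT t:{}. \<tau> t)"
    proof (rule tendsto_set_integral_sets[OF \<tau>(1)])
      fix x
      have "\<forall>\<^sub>F n in sequentially. real n > x"
        using filterlim_real_sequentially by (simp add: filterlim_at_top_dense)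
      thus "\<forall>\<^sub>F n in sequentially. x \<in> {real n..} \<longleftrightarrow> x \<in> {}" by eventually_elim auto
    qed auto
    hence "(\<lambda>n. LBINT t:{real n..}. \<tau> t) \<longlonglongrightarrow> 0" by (simp add: set_lebesgue_integral_def)
    hence "\<forall>\<^sub>F n in sequentially. (LBINT t:{real n..}. \<tau> t) < e" by (rule order_tendstoD(2)[OF _ e])
    then obtain n where n: "(LBINT t:{real n..}. \<tau> t) < e" by (auto simp: eventually_sequentially)
    have "norm (A t - A s) \<le> e" if "real n \<le> s" "s \<le> t" for s t
    proof -
      have "norm (A t - A s) \<le> (LBINT r:{s..t}. \<tau> r)" using incr[OF that(2)] by (simp add: Adiff)
      also have "\<dots> \<le> (LBINT r:{real n..}. \<tau> r)"
        unfolding set_lebesgue_integral_def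
        by (intro integral_mono integrable_mult_indicator \<tau>(1)) (use that \<tau>(2) in \<open>auto simp: indicator_def\<close>)
      finally show ?thesis using n by linarith
    qed
    thus "\<exists>T. \<forall>s t. T \<le> s \<longrightarrow> s \<le> t \<longrightarrow> norm (A t - A s) \<le> e" by blast
  qed
  then obtain L where L: "(A \<longlongrightarrow> L) at_top" by blast
  have LimL: "Lim at_top A = L" by (rule tendsto_Lim[OF _ L]) simp
  have saA: "selfadjoint_op (A t)" for t unfolding A_def by (intro selfadjoint_op_add sa_minus sa_B)
  \<comment> \<open>To the left of some point \<open>B\<close> has norm below 1, because it tends to
    0; from there on an increment costs at most the whole integral of \<tau>.\<close>
  have "\<exists>K. \<forall>t. norm (A t) \<le> K"
  proof -
    have "\<forall>\<^sub>F t in at_bot. dist (B t) 0 < 1" by (rule tendstoD[OF Bbot]) simp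
    then obtain s where s: "\<And>t. t \<le> s \<Longrightarrow> norm (B t) < 1" by (auto simp: eventually_at_bot_linorder)
    have "norm (A t) \<le> norm A_minus + (1 + integral\<^sup>L lborel \<tau>)" for t
    proof -
      have "norm (B t - B (min s t)) \<le> (LBINT r:{min s t..t}. \<tau> r)" by (rule incr) simp
      also have "\<dots> \<le> integral\<^sup>L lborel \<tau>" by (rule set_integral_le_integral[OF \<tau>(1)]) (simp_all add: \<tau>(2))
      finally have "norm (B t - B (min s t)) \<le> integral\<^sup>L lborel \<tau>" .
      moreover have "norm (B t) \<le> norm (B (min s t)) + norm (B t - B (min s t))"
        using norm_triangle_ineq[of "B (min s t)" "B t - B (min s t)"] by simp
      moreover have "norm (B (min s t)) < 1" by (rule s) simp
      moreover have "norm (A t) \<le> norm A_minus + norm (B t)" unfolding A_def by (rule norm_triangle_ineq)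
      ultimately show ?thesis by linarith
    qed
    thus ?thesis by blast
  qed
  then obtain K where K: "\<And>t. norm (A t) \<le> K" by blast
  have "asymptotic_family A K A_minus L"
  proof
    show "selfadjoint_op L" by (rule selfadjoint_op_limit[OF L _ saA]) simp
    show "completely_continuous (A t - A_minus)" for t using ccB[of t] by (simp add: A_def)
  qed (rule cont K saA bot L sa_minus)+
  thus ?thesis unfolding LimL by blast
qed

end

theorem theorem4p10:
  fixes A_minus A_plus :: "'h::{chilbert_space, second_countable_topology} \<Rightarrow>\<^sub>L 'h"
    and B B' A :: "real \<Rightarrow> 'h \<Rightarrow>\<^sub>L 'h"
  assumes "selfadjoint_op A_minus"
    and "\<And>t. selfadjoint_op (B t)"
    and "weakly_locally_abs_cont B"
    and "\<And>t. selfadjoint_op (B' t)"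
    and "AE t in lebesgue. \<forall>g h.
           ((\<lambda>s. cinner g (B s h)) has_vector_derivative cinner g (B' t h)) (at t)"
    and "\<And>t. trace_class (B' t)"
    and "integrable lebesgue (\<lambda>t. trace_norm (B' t))"
    and "\<forall>\<^sub>F t in at_bot. trace_class (B t)"
    and "((\<lambda>t. trace_norm (B t)) \<longlongrightarrow> 0) at_bot"
    and A_def: "\<And>t. A t = A_minus + B t"
    and A_plus_def: "A_plus = Lim at_top A"
  shows "(Fredholm (D_op A) \<longleftrightarrow> 0 \<in> resolvent_set A_plus \<inter> resolvent_set A_minus) \<and>
         (0 \<in> spectrum A_plus \<or> 0 \<in> spectrum A_minus \<longrightarrow>
            \<not> upper_semi_Fredholm (D_op A) \<and> \<not> lower_semi_Fredholm (D_op A))"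
proof -
  interpret P: trace_class_perturbation A_minus B B'
    by unfold_locales (fact assms)+
  have A: "A = (\<lambda>t. A_minus + B t)" using A_def by blast
  obtain K where "asymptotic_family A K A_minus A_plus"
    using P.asymptotic unfolding A_plus_def A by blast
  then interpret asymptotic_family A K A_minus A_plus .
  have neither: "\<not> upper_semi_Fredholm (D_op A) \<and> \<not> lower_semi_Fredholm (D_op A)"
    if "0 \<in> spectrum A_plus \<or> 0 \<in> spectrum A_minus"
  proof -
    have small_on_long_intervals
      using that small_on_long_intervals_top[OF lim_top sa_p] small_on_long_intervals_bot[OF lim_bot sa_m]
      by blast
    thus ?thesis using not_semi_Fredholm by blast
  qed
  have "Fredholm (D_op A)" if res: "0 \<in> resolvent_set A_plus \<inter> resolvent_set A_minus"
  proof -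
    obtain c where c: "c > 0" "\<And>x. norm (A_plus x) \<ge> c * norm x"
      using bounded_below_if_resolvent[of A_plus] res by auto
    obtain d where d: "d > 0" "\<And>x. norm (A_minus x) \<ge> d * norm x"
      using bounded_below_if_resolvent[of A_minus] res by auto
    show ?thesis
    proof (rule Fredholm_if_bounded_below)
      show "min c d > 0" using c d by simp
      show "min c d * norm x \<le> norm (A_minus x)" for x
        using d(2)[of x] mult_right_mono[of "min c d" d "norm x"] by simp
      show "min c d * norm x \<le> norm (A_plus x)" for x
        using c(2)[of x] mult_right_mono[of "min c d" c "norm x"] by simp
    qed
  qed
  moreover have "0 \<in> resolvent_set A_plus \<inter> resolvent_set A_minus" if "Fredholm (D_op A)"
  proof (rule ccontr)
    assume "0 \<notin> resolvent_set A_plus \<inter> resolvent_set A_minus"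
    hence "\<not> upper_semi_Fredholm (D_op A)" using neither by (auto simp: spectrum_def)
    with that show False by (simp add: Fredholm_def upper_semi_Fredholm_def)
  qed
  ultimately show ?thesis using neither by blast
qed

end
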